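(* Let $(T,f)$ be a Hubbard tree with kneading sequence $\nu$, and let $m\ge 1$. Then $(T,f)$ contains an evil orbit of exact period $m$ if and only if $\nu$ fails the admissibility condition for period $m$. Equivalently, a Hubbard tree $(T,f)$ can be embedded into the plane so that the dynamics respects the embedding (that is, $f$ respects the cyclic order of the local arms at all branch points) if and only if its kneading sequence does not fail the admissibility condition for any period $m\ge 1$.
   Context: Trees. A tree $T$ is a finite connected (topological) graph without loops. For $x\in T$, the (global) arms of $x$ are the connected components of $T\setminus\{x\}$; a local arm at $x$ is the intersection of a global arm with a sufficiently small neighborhood of $x$. The point $x$ is an endpoint if it has only one arm, a branch point if it has at least three arms. For $x,y\in T$, $[x,y]$ is the unique closed arc connecting them and $(x,y)$ its interior. Hubbard trees. A Hubbard tree is a tree $T$ with a map $f\colon T\to T$ and a distinguished point, the critical point, such that: (1) $f$ is continuous and surjective; (2) every point has at most two inverse images under $f$; (3) at every point other than the critical point, $f$ is a local homeomorphism onto its image; (4) all endpoints of $T$ are on the critical orbit; (5) the critical point is periodic or preperiodic, but not fixed; (6) (expansivity) if $x\neq y$ are branch points or points on the critical orbit, then there is $n\ge 0$ such that $f^{\circ n}([x,y])$ contains the critical point. Write $c_0=0$ for the critical point, $c_k=f^{\circ k}(0)$; $c_1$ is the critical value and $c_1\ne c_0$. The critical point is never on a periodic orbit of branch points, so $f$ induces a map on the local arms along such an orbit. Kneading sequence. Let $T_{\mathtt 1}$ be the component of $T\setminus\{0\}$ containing $c_1$, $T_\star=\{0\}$, $T_{\mathtt 0}=T\setminus(T_{\mathtt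 1}\cup\{0\})$ (possibly empty). The itinerary of $x\in T$ is the sequence $e_1e_2e_3\dots$ over $\{\mathtt 0,\star,\mathtt 1\}$ with $f^{\circ(j-1)}(x)\in T_{e_j}$. The kneading sequence $\nu=\nu_1\nu_2\dots$ of $(T,f)$ is the itinerary of $c_1$; it starts with $\mathtt 1$. Tame and evil. A periodic orbit of branch points is called tame if all its local arms are on the same cycle (under the map induced by $f$ on local arms), and evil otherwise. $\rho$-function. For $n\ge 1$ let $\rho(n)=\rho_\nu(n)=\inf\{k>n:\nu_k\ne\nu_{k-n}\}\in\{1,2,\dots\}\cup\{\infty\}$. The $\rho$-orbit of $k$ is $\mathrm{orb}_\rho(k)= k\to\rho(k)\to\rho(\rho(k))\to\cdots$ (stopping before $\infty$ is reached). The internal address of $\nu$ is $\mathrm{orb}_\rho(1)$. Admissibility condition. $\nu$ fails the admissibility condition for period $m$ if all three of the following hold: (1) the internal address of $\nu$ does not contain $m$; (2) if $k<m$ divides $m$, then $\rho(k)\le m$; (3) $\rho(m)<\infty$ and, if $r\in\{1,\dots,m\}$ is congruent to $\rho(m)$ modulo $m$, then $\mathrm{orb}_\rho(r)$ contains $m$. *)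

theory Defs
  imports "HOL-Analysis.Analysis"
begin

section \<open>Trees\<close>

definition is_arc :: "'a::topological_space set \<Rightarrow> 'a \<Rightarrow> 'a \<Rightarrow> bool" where
  "is_arc S x y \<longleftrightarrow> (\<exists>g. arc g \<and> path_image g = S \<and> pathstart g = x \<and> pathfinish g = y)"

text \<open>
  A finite topological graph is a Hausdorff space that is a union of finitely many vertices and
  finitely many arcs (edges) which meet the vertex set exactly in their two endpoints and meet each
  other only in vertices. An edge with coinciding endpoints can be subdivided, so requiring edges to
  be arcs is no restriction. A tree contains no simple closed curve.
\<close>

definition finite_graph :: "'a::t2_space set \<Rightarrow> bool" where
  "finite_graph T \<longleftrightarrow>
     (\<exists>V E. finite V \<and> finite E \<and> T = V \<union> \<Union>E \<and>
        (\<forall>e\<in>E. \<exists>a b. is_arc e a b \<and> e \<inter> V = {a, b}) \<and>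
        (\<forall>e\<in>E. \<forall>e'\<in>E. e \<noteq> e' \<longrightarrow> e \<inter> e' \<subseteq> V))"

definition tree :: "'a::t2_space set \<Rightarrow> bool" where
  "tree T \<longleftrightarrow> T \<noteq> {} \<and> finite_graph T \<and> connected T \<and>
     \<not> (\<exists>g. simple_path g \<and> pathfinish g = pathstart g \<and> path_image g \<subseteq> T)"

definition segment :: "'a::t2_space set \<Rightarrow> 'a \<Rightarrow> 'a \<Rightarrow> 'a set" where
  "segment T x y = (if x = y then {x} else (THE S. S \<subseteq> T \<and> is_arc S x y))"

definition arms :: "'a::t2_space set \<Rightarrow> 'a \<Rightarrow> 'a set set" where
  "arms T x = components (T - {x})"

definition endpoints :: "'a::t2_space set \<Rightarrow> 'a set" where
  "endpoints T = {x \<in> T. card (arms T x) = 1}"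

definition branch_points :: "'a::t2_space set \<Rightarrow> 'a set" where
  "branch_points T = {x \<in> T. card (arms T x) \<ge> 3}"


section \<open>Hubbard trees\<close>

definition crit_orbit :: "('a \<Rightarrow> 'a) \<Rightarrow> 'a \<Rightarrow> 'a set" where
  "crit_orbit f c = {(f ^^ k) c | k. True}"

text \<open>Here \<open>c\<close> is the critical point; only the restriction of \<open>f\<close> to \<open>T\<close> matters.\<close>

definition hubbard_tree :: "'a::t2_space set \<Rightarrow> ('a \<Rightarrow> 'a) \<Rightarrow> 'a \<Rightarrow> bool" where
  "hubbard_tree T f c \<longleftrightarrow>
     tree T \<and> c \<in> T \<and>
     continuous_on T f \<and> f ` T = T \<and>
     (\<forall>y\<in>T. finite {x\<in>T. f x = y} \<and> card {x\<in>T. f x = y} \<le> 2) \<and>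
     (\<forall>x\<in>T - {c}. \<exists>U g. openin (top_of_set T) U \<and> x \<in> U \<and> homeomorphism U (f ` U) f g) \<and>
     endpoints T \<subseteq> crit_orbit f c \<and>
     (\<exists>k l. k < l \<and> (f ^^ k) c = (f ^^ l) c) \<and> f c \<noteq> c \<and>
     (\<forall>x \<in> branch_points T \<union> crit_orbit f c. \<forall>y \<in> branch_points T \<union> crit_orbit f c.
        x \<noteq> y \<longrightarrow> (\<exists>n. c \<in> (f ^^ n) ` segment T x y))"


section \<open>Itineraries and kneading sequences\<close>

datatype symbol = Zero | Star | One

definition tree_symbol :: "'a::t2_space set \<Rightarrow> ('a \<Rightarrow> 'a) \<Rightarrow> 'a \<Rightarrow> 'a \<Rightarrow> symbol" where
  "tree_symbol T f c x =
     (if x = c then Star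
      else if x \<in> connected_component_set (T - {c}) (f c) then One
      else Zero)"

text \<open>Sequences are indexed from 1; the value at 0 is never used.\<close>

definition itinerary :: "'a::t2_space set \<Rightarrow> ('a \<Rightarrow> 'a) \<Rightarrow> 'a \<Rightarrow> 'a \<Rightarrow> nat \<Rightarrow> symbol" where
  "itinerary T f c x j = tree_symbol T f c ((f ^^ (j - 1)) x)"

definition kneading :: "'a::t2_space set \<Rightarrow> ('a \<Rightarrow> 'a) \<Rightarrow> 'a \<Rightarrow> nat \<Rightarrow> symbol" where
  "kneading T f c = itinerary T f c (f c)"


section \<open>The admissibility condition\<close>

definition rho :: "(nat \<Rightarrow> 'b) \<Rightarrow> nat \<Rightarrow> enat" where
  "rho \<nu> n = Inf (enat ` {k. k > n \<and> \<nu> k \<noteq> \<nu> (k - n)})"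

inductive_set rho_orbit :: "(nat \<Rightarrow> 'b) \<Rightarrow> nat \<Rightarrow> nat set"
  for \<nu> :: "nat \<Rightarrow> 'b" and k :: nat where
  start: "k \<in> rho_orbit \<nu> k"
| step: "l \<in> rho_orbit \<nu> k \<Longrightarrow> rho \<nu> l = enat l' \<Longrightarrow> l' \<in> rho_orbit \<nu> k"

definition internal_address :: "(nat \<Rightarrow> 'b) \<Rightarrow> nat set" where
  "internal_address \<nu> = rho_orbit \<nu> 1"

definition fails_admissibility :: "(nat \<Rightarrow> 'b) \<Rightarrow> nat \<Rightarrow> bool" where
  "fails_admissibility \<nu> m \<longleftrightarrow>
     m \<notin> internal_address \<nu> \<and>
     (\<forall>k. 1 \<le> k \<and> k < m \<and> k dvd m \<longrightarrow> rho \<nu> k \<le> enat m) \<and>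
     (\<exists>n. rho \<nu> m = enat n \<and>
        (\<forall>r\<in>{1..m}. r mod m = n mod m \<longrightarrow> m \<in> rho_orbit \<nu> r))"


section \<open>Local arms, tame and evil orbits\<close>

text \<open>
  Each local arm at \<open>x\<close> is the germ at \<open>x\<close> of exactly one global arm, and is represented by that
  global arm. The image of the local arm in \<open>A\<close> is the local arm at \<open>f x\<close> whose global arm contains
  \<open>f y\<close> for all \<open>y \<in> A\<close> close to \<open>x\<close>.
\<close>

definition local_arm_image :: "'a::t2_space set \<Rightarrow> ('a \<Rightarrow> 'a) \<Rightarrow> 'a \<Rightarrow> 'a set \<Rightarrow> 'a set" where
  "local_arm_image T f x A =
     (THE B. B \<in> arms T (f x) \<and> (\<forall>\<^sub>F y in at x within A. f y \<in> B))"

definition local_arm_map :: "'a::t2_space set \<Rightarrow> ('a \<Rightarrow> 'a) \<Rightarrow> 'a \<times> 'a set \<Rightarrow> 'a \<times> 'a set" where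
  "local_arm_map T f = (\<lambda>(x, A). (f x, local_arm_image T f x A))"

definition periodic_orbit :: "('a \<Rightarrow> 'a) \<Rightarrow> nat \<Rightarrow> 'a set \<Rightarrow> bool" where
  "periodic_orbit f m P \<longleftrightarrow>
     m \<ge> 1 \<and> (\<exists>x. P = {(f ^^ k) x | k. k < m} \<and> (f ^^ m) x = x \<and>
       (\<forall>k. 1 \<le> k \<and> k < m \<longrightarrow> (f ^^ k) x \<noteq> x))"

definition branch_orbit :: "'a::t2_space set \<Rightarrow> ('a \<Rightarrow> 'a) \<Rightarrow> nat \<Rightarrow> 'a set \<Rightarrow> bool" where
  "branch_orbit T f m P \<longleftrightarrow> periodic_orbit f m P \<and> P \<subseteq> branch_points T"

text \<open>
  Since every local arm on \<open>P\<close> is required to reach every other one, including its own predecessors,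
  the local arms form a single cycle.
\<close>

definition tame :: "'a::t2_space set \<Rightarrow> ('a \<Rightarrow> 'a) \<Rightarrow> 'a set \<Rightarrow> bool" where
  "tame T f P \<longleftrightarrow>
     (\<forall>a \<in> Sigma P (arms T). \<forall>b \<in> Sigma P (arms T). \<exists>n. (local_arm_map T f ^^ n) a = b)"

definition has_evil_orbit :: "'a::t2_space set \<Rightarrow> ('a \<Rightarrow> 'a) \<Rightarrow> nat \<Rightarrow> bool" where
  "has_evil_orbit T f m \<longleftrightarrow> (\<exists>P. branch_orbit T f m P \<and> \<not> tame T f P)"


section \<open>Embeddings into the plane\<close>

text \<open>
  \<open>first_exit T h r x A y\<close>: following the embedded arm \<open>h ` A\<close> from \<open>h x\<close> outwards, \<open>h y\<close> is the
  first point on the circle of radius \<open>r\<close> around \<open>h x\<close>. For an arbitrary topological embedding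
  \<open>h\<close> and small \<open>r\<close>, every arm at \<open>x\<close> has exactly one such point, and the counterclockwise order of
  these points on the circle is independent of \<open>r\<close>: it is the cyclic order of the local arms at
  \<open>x\<close> induced by the embedding.
\<close>

definition first_exit ::
  "'a::t2_space set \<Rightarrow> ('a \<Rightarrow> complex) \<Rightarrow> real \<Rightarrow> 'a \<Rightarrow> 'a set \<Rightarrow> 'a \<Rightarrow> bool" where
  "first_exit T h r x A y \<longleftrightarrow>
     y \<in> A \<and> dist (h y) (h x) = r \<and> (\<forall>z \<in> segment T x y - {y}. dist (h z) (h x) < r)"

definition ccw_arms ::
  "'a::t2_space set \<Rightarrow> ('a \<Rightarrow> complex) \<Rightarrow> real \<Rightarrow> 'a \<Rightarrow> 'a set \<Rightarrow> 'a set \<Rightarrow> 'a set \<Rightarrow> bool" where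
  "ccw_arms T h r x A B C \<longleftrightarrow>
     (\<exists>a b c s t u. first_exit T h r x A a \<and> first_exit T h r x B b \<and> first_exit T h r x C c \<and>
        h a = h x + of_real r * cis s \<and> h b = h x + of_real r * cis t \<and>
        h c = h x + of_real r * cis u \<and> s < t \<and> t < u \<and> u < s + 2 * pi)"

definition respects_cyclic_order ::
  "'a::t2_space set \<Rightarrow> ('a \<Rightarrow> 'a) \<Rightarrow> ('a \<Rightarrow> complex) \<Rightarrow> bool" where
  "respects_cyclic_order T f h \<longleftrightarrow>
     (\<forall>\<^sub>F r in at_right 0. \<forall>x \<in> branch_points T.
        \<forall>A \<in> arms T x. \<forall>B \<in> arms T x. \<forall>C \<in> arms T x.
          ccw_arms T h r x A B C \<longrightarrow>
          ccw_arms T h r (f x)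
            (local_arm_image T f x A) (local_arm_image T f x B) (local_arm_image T f x C))"

definition planar_dynamics :: "'a::t2_space set \<Rightarrow> ('a \<Rightarrow> 'a) \<Rightarrow> bool" where
  "planar_dynamics T f \<longleftrightarrow>
     (\<exists>h :: 'a \<Rightarrow> complex. (\<exists>h'. homeomorphism T (h ` T) h h') \<and> respects_cyclic_order T f h)"

end

theory Submission
  imports Defs
begin

text \<open>
  Let \<open>z\<close> be the characteristic point of a periodic orbit of branch points, i.e. the one whose arm
  \<open>G1\<close> towards the critical value contains no point of the orbit, and let \<open>G0\<close> be its arm towards
  the critical point. Arms without orbit points can be pulled back along the orbit, and by
  expansivity no cycle of arms avoids the critical point. Hence the first return map sends \<open>G0\<close> either
  to \<open>G1\<close> (and the orbit is tame) or to itself (and the remaining arms form one further cycle).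

  The arm at \<open>z\<close> containing a point \<open>P\<close> is followed by iterating \<open>P\<close>, except that \<open>P\<close> is replaced
  by the critical value whenever the critical point separates it from the orbit of \<open>z\<close>. These
  replacement times are \<open>\<rho>\<close>-orbits of the kneading sequence, which turns the behaviour of \<open>G0\<close> and
  \<open>G1\<close> into the admissibility condition.

  Conversely, if \<open>\<nu>\<close> fails the condition for \<open>m\<close>, a fixed point argument for \<open>f\<^sup>m\<close> on the set of
  points sharing the first \<open>m\<close> symbols with the critical value yields a point \<open>p\<close> such that the median
  of \<open>p\<close>, \<open>c\<^sub>1\<close> and \<open>c\<^bsub>m+1\<^esub>\<close> follows a majority vote of three pointers, of which at most one
  disagrees with the period-\<open>m\<close> continuation of \<open>\<nu>\<^sub>1\<dots>\<nu>\<^sub>m\<close> at any time. So the median has this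
  itinerary, and by expansivity it is an evil branch point.

  In a planar tree the first return map preserves the cyclic order of the arms, which excludes a
  fixed arm next to a nontrivial cycle. If all orbits are tame, the arms at every branch point are
  cyclically ordered by their arrival times at a base arm modulo the length of its cycle, \<open>f\<close> shifts
  these times by one, and the tree is drawn with straight edges realizing this order.
\<close>

section \<open>Arcs in Hausdorff spaces\<close>

text \<open>Two facts about \<open>f\<close> carry the argument. In a tree a locally injective path
  is injective, so \<open>f\<close> maps a segment injectively onto a segment unless the critical
  point is interior to it. And the critical value is an endpoint, so the critical point has at most
  two arms; hence two points other than it have equal symbols exactly if it does not separate them.

  The harder direction has to find a periodic point from combinatorial data. Prescribing the first
  \<open>m\<close> symbols gives a set that is convex but not closed; adding the points that pass
  through the critical point makes it closed, but nothing makes it invariant under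
  \<open>f ^^ m\<close>, so a fixed point in it cannot be expected. What survives is a gate: a point
  \<open>p\<close> at which the walk from the critical value towards the image stops, and from which
  the segment to \<open>(f ^^ m) p\<close> leaves the set at once. As \<open>p\<close> separates the
  relevant points from its image, the image may be replaced by \<open>p\<close> in a median after
  each period, and the same \<open>p\<close> serves forever. The last condition in
  \<open>fails_admissibility\<close> brings the third pointer back to the critical value at the end
  of a period.\<close>

lemma is_arcI:
  assumes "a < (b::real)" "continuous_on {a..b} g" "inj_on g {a..b}"
  shows "is_arc (g ` {a..b}) (g a) (g b)"
proof -
  define h where "h = (\<lambda>t::real. g (a + (b - a) * t))"
  have img: "(\<lambda>t. a + (b - a) * t) ` {0..1} = {a..b}"
  proof -
    have "s \<in> (\<lambda>t. a + (b - a) * t) ` {0..1}" if "s \<in> {a..b}" for s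
      using that assms(1)
      by (intro image_eqI[where x="(s - a) / (b - a)"]) (auto simp: field_simps)
    moreover have "a + (b - a) * t \<in> {a..b}" if "t \<in> {0..1}" for t
    proof -
      have "0 \<le> (b - a) * t" "(b - a) * t \<le> b - a"
        using that assms(1) by (auto intro: mult_right_le_one_le)
      then show ?thesis by simp
    qed
    ultimately show ?thesis by blast
  qed
  have "continuous_on {0..1} h"
    unfolding h_def
    by (rule continuous_on_compose2[OF assms(2)]) (use img in \<open>auto intro!: continuous_intros\<close>)
  moreover have "inj_on h {0..1}"
  proof (rule inj_onI)
    fix s t :: real assume st: "s \<in> {0..1}" "t \<in> {0..1}" "h s = h t"
    then have "a + (b - a) * s = a + (b - a) * t"
      using inj_onD[OF assms(3)] img unfolding h_def by blast
    then show "s = t" using assms(1) by simp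
  qed
  ultimately have "arc h" by (auto simp: arc_def path_def)
  moreover have "path_image h = g ` {a..b}"
    using img unfolding path_image_def h_def by (metis image_image)
  ultimately show ?thesis
    unfolding is_arc_def
    by (intro exI[of _ h]) (auto simp: pathstart_def pathfinish_def h_def)
qed

lemma is_arcE:
  assumes "is_arc S x y"
  obtains g where "continuous_on {0..1::real} g" "inj_on g {0..1}" "g ` {0..1} = S" "g 0 = x" "g 1 = y"
  using assms
  by (auto simp: is_arc_def arc_def path_def path_image_def pathstart_def pathfinish_def)

lemma is_arc_sym: "is_arc S x y \<Longrightarrow> is_arc S y x"
  unfolding is_arc_def by (metis arc_reversepath path_image_reversepath pathfinish_reversepath pathstart_reversepath)

lemma is_arc_ends: "is_arc S x y \<Longrightarrow> x \<in> S \<and> y \<in> S \<and> x \<noteq> y"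
  unfolding is_arc_def by (metis arc_distinct_ends pathfinish_in_path_image pathstart_in_path_image)

lemma is_arc_compact: "is_arc S x y \<Longrightarrow> compact S"
  unfolding is_arc_def using compact_arc_image by blast

lemma is_arc_closed: "is_arc S x y \<Longrightarrow> closed (S :: 'a::t2_space set)"
  using is_arc_compact compact_imp_closed by blast

lemma is_arc_connected: "is_arc S x y \<Longrightarrow> connected S"
  unfolding is_arc_def using connected_arc_image by blast

lemma is_arc_split:
  assumes "is_arc S x y" "z \<in> S" "z \<noteq> x" "z \<noteq> y"
  obtains S1 S2 where "is_arc S1 x z" "is_arc S2 z y" "S = S1 \<union> S2" "S1 \<inter> S2 = {z}"
proof -
  obtain g where g: "continuous_on {0..1::real} g" "inj_on g {0..1}" "g ` {0..1} = S" "g 0 = x" "g 1 = y"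
    using is_arcE[OF assms(1)] by blast
  obtain t where t: "t \<in> {0..1}" "g t = z" using g(3) assms(2) by blast
  then have t': "0 < t" "t < 1" using assms(3,4) g(4,5) by (auto simp: less_le)
  have "is_arc (g ` {0..t}) (g 0) (g t)"
    by (rule is_arcI) (use t' in \<open>auto intro: continuous_on_subset[OF g(1)] inj_on_subset[OF g(2)]\<close>)
  moreover have "is_arc (g ` {t..1}) (g t) (g 1)"
    by (rule is_arcI) (use t' in \<open>auto intro: continuous_on_subset[OF g(1)] inj_on_subset[OF g(2)]\<close>)
  moreover have "S = g ` {0..t} \<union> g ` {t..1}"
  proof -
    have "{0..1} = {0..t} \<union> {t..1}" using t' by auto
    then show ?thesis using g(3) by (metis image_Un)
  qed
  moreover have "g ` {0..t} \<inter> g ` {t..1} = {z}"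
  proof -
    have "g ` {0..t} \<inter> g ` {t..1} = g ` ({0..t} \<inter> {t..1})"
      by (rule inj_on_image_Int[symmetric, OF g(2)]) (use t' in auto)
    also have "{0..t} \<inter> {t..1} = {t}" using t' by auto
    finally show ?thesis using t by simp
  qed
  ultimately show ?thesis using that g t by blast
qed

lemma is_arc_join:
  assumes "is_arc S1 x z" "is_arc S2 z y" "S1 \<inter> S2 = {z}"
  shows "is_arc (S1 \<union> S2) x y"
proof -
  obtain g1 where 1: "arc g1" "path_image g1 = S1" "pathstart g1 = x" "pathfinish g1 = z"
    using assms(1) is_arc_def by blast
  obtain g2 where 2: "arc g2" "path_image g2 = S2" "pathstart g2 = z" "pathfinish g2 = y"
    using assms(2) is_arc_def by blast
  have "arc (g1 +++ g2)" by (rule arc_join) (use 1 2 assms(3) in auto)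
  then show ?thesis unfolding is_arc_def
    using 1 2 by (metis path_image_join pathfinish_join pathstart_join)
qed

lemma is_arc_first_hit:
  assumes "is_arc S x y" "closed C" "x \<notin> C" "y \<in> C"
  obtains z S1 where "z \<in> C" "S1 \<subseteq> S" "is_arc S1 x z" "S1 \<inter> C = {z}"
proof -
  obtain g where g: "continuous_on {0..1::real} g" "inj_on g {0..1}" "g ` {0..1} = S" "g 0 = x" "g 1 = y"
    using is_arcE[OF assms(1)] by blast
  define A where "A = {0..1} \<inter> g -` C"
  have "closed A" unfolding A_def
    using continuous_closed_preimage[OF g(1) _ assms(2)] by simp
  then have "compact A" using compact_Int_closed[OF compact_Icc, of A 0 1] by (simp add: A_def)
  moreover have "1 \<in> A" using assms(4) g(5) by (auto simp: A_def)
  then have "A \<noteq> {}" by blast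
  ultimately obtain t where t: "t \<in> A" "\<And>s. s \<in> A \<Longrightarrow> t \<le> s"
    by (meson compact_attains_inf)
  have t': "0 < t" "t \<le> 1" using t(1) assms(3) g(4) by (auto simp: A_def less_le)
  have "is_arc (g ` {0..t}) (g 0) (g t)"
    by (rule is_arcI) (use t' in \<open>auto intro: continuous_on_subset[OF g(1)] inj_on_subset[OF g(2)]\<close>)
  moreover have "g ` {0..t} \<inter> C = {g t}"
  proof -
    have "s = t" if "s \<in> {0..t}" "g s \<in> C" for s
      using t(2)[of s] that t' by (auto simp: A_def)
    moreover have "g t \<in> C" using t(1) by (auto simp: A_def)
    ultimately show ?thesis using t' by fastforce
  qed
  moreover have "g ` {0..t} \<subseteq> S" using t' g(3) by auto
  ultimately show ?thesis using that t g(4) by (auto simp: A_def)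
qed

lemma is_arc_subarc:
  assumes "is_arc S x y" "u \<in> S" "v \<in> S" "u \<noteq> v"
  obtains S' where "S' \<subseteq> S" "is_arc S' u v"
proof -
  have *: "\<exists>S'\<subseteq>S. is_arc S' x v" if "v \<in> S" "v \<noteq> x" for v
  proof (cases "v = y")
    case True then show ?thesis using assms by blast
  next
    case False then show ?thesis using is_arc_split[OF assms(1) that(1,2)] by blast
  qed
  consider "u = x" | "u = y" | "u \<noteq> x" "u \<noteq> y" by blast
  then show ?thesis
  proof cases
    case 1 then show ?thesis using * assms that by metis
  next
    case 2
    show ?thesis
    proof (cases "v = x")
      case True then show ?thesis using 2 assms that is_arc_sym by blast
    next
      case False
      then show ?thesis
        using is_arc_split[OF assms(1) assms(3)] 2 assms(4) that is_arc_sym by (metis Un_upper2)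
    qed
  next
    case 3
    obtain S1 S2 where s: "is_arc S1 x u" "is_arc S2 u y" "S = S1 \<union> S2" "S1 \<inter> S2 = {u}"
      using is_arc_split[OF assms(1) assms(2) 3] by blast
    consider "v \<in> S1" | "v \<in> S2" using s assms by blast
    then show ?thesis
    proof cases
      case 1
      show ?thesis
      proof (cases "v = x")
        case True then show ?thesis using s that is_arc_sym by blast
      next
        case False
        then show ?thesis
          using is_arc_split[OF s(1) 1] assms(4) that is_arc_sym s(3) by (metis Un_upper2 le_supI1)
      qed
    next
      case 2
      show ?thesis
      proof (cases "v = y")
        case True then show ?thesis using s that is_arc_sym by blast
      next
        case False
        then show ?thesis
          using is_arc_split[OF s(2) 2] assms(4) that s(3) by (metis Un_upper1 le_supI2)
      qed
    qed
  qed
qed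

text \<open>Two arcs glued at \<open>y\<close> may cross, so the first is left where it first meets
  the second; the pieces kept then meet in one point only.\<close>

lemma is_arc_trans:
  fixes S1 S2 :: "'a::t2_space set"
  assumes "is_arc S1 x y" "is_arc S2 y z" "x \<noteq> z"
  obtains S where "S \<subseteq> S1 \<union> S2" "is_arc S x z"
proof (cases "x \<in> S2")
  case True
  then obtain S where "S \<subseteq> S2" "is_arc S x z"
    using is_arc_subarc[OF assms(2), of x z] assms(3) is_arc_ends[OF assms(2)] by blast
  then show ?thesis using that by blast
next
  case False
  obtain w S1' where w: "w \<in> S2" "S1' \<subseteq> S1" "is_arc S1' x w" "S1' \<inter> S2 = {w}"
    using is_arc_first_hit[OF assms(1) is_arc_closed[OF assms(2)] False] is_arc_ends[OF assms(2)] by blast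
  show ?thesis
  proof (cases "w = z")
    case True then show ?thesis using w that by blast
  next
    case False
    then obtain S2' where s: "S2' \<subseteq> S2" "is_arc S2' w z"
      using is_arc_subarc[OF assms(2) w(1)] is_arc_ends[OF assms(2)] by metis
    have "S1' \<inter> S2' = {w}" using s w is_arc_ends[OF s(2)] is_arc_ends[OF w(3)] by blast
    then have "is_arc (S1' \<union> S2') x z" using is_arc_join w s by blast
    moreover have "S1' \<union> S2' \<subseteq> S1 \<union> S2" using w(2) s(1) by blast
    ultimately show ?thesis using that by blast
  qed
qed

lemma is_arc_loop:
  assumes "is_arc S1 x y" "is_arc S2 x y" "S1 \<inter> S2 \<subseteq> {x, y}"
  shows "\<exists>g. simple_path g \<and> pathfinish g = pathstart g \<and> path_image g = S1 \<union> S2"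
proof -
  obtain g1 where 1: "arc g1" "path_image g1 = S1" "pathstart g1 = x" "pathfinish g1 = y"
    using assms(1) is_arc_def by blast
  obtain g2 where 2: "arc g2" "path_image g2 = S2" "pathstart g2 = y" "pathfinish g2 = x"
    using is_arc_sym[OF assms(2)] is_arc_def by metis
  have "simple_path (g1 +++ g2)"
    by (rule simple_path_join_loop) (use 1 2 assms(3) in auto)
  then show ?thesis using 1 2 by (intro exI[of _ "g1 +++ g2"]) (auto simp: path_image_join)
qed

text \<open>Transported to the unit interval: a connected set of reals containing 0 and 1 contains
  everything between. Two different arcs with common ends thus yield a point of one off the
  other.\<close>

lemma is_arc_connected_subset:
  fixes S :: "'a::t2_space set"
  assumes "is_arc S x y" "connected C" "C \<subseteq> S" "x \<in> C" "y \<in> C"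
  shows "C = S"
proof -
  obtain g where g: "continuous_on {0..1::real} g" "inj_on g {0..1}" "g ` {0..1} = S" "g 0 = x" "g 1 = y"
    using is_arcE[OF assms(1)] by blast
  obtain h where h: "homeomorphism {0..1} S g h"
    using homeomorphism_compact[OF _ g(1,3,2)] by auto
  have "connected (h ` C)"
    using h assms by (meson connected_continuous_image continuous_on_subset homeomorphism_def)
  moreover have "h x = 0" "h y = 1" using h g by (auto simp: homeomorphism_def)
  ultimately have "{0..1} \<subseteq> h ` C"
    using assms(4,5) by (metis connected_contains_Icc image_eqI)
  then have *: "h p \<in> h ` C" if "p \<in> S" for p using h that by (auto simp: homeomorphism_def)
  have gh: "g (h p) = p" if "p \<in> S" for p using h that by (simp add: homeomorphism_def)
  have "p \<in> C" if p: "p \<in> S" for p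
  proof -
    obtain q where q: "q \<in> C" "h p = h q" using *[OF p] by (rule imageE)
    then have "p = q" using gh[OF p] gh[of q] assms(3) by auto
    then show ?thesis using q by simp
  qed
  then have "S \<subseteq> C" by blast
  then show ?thesis using assms(3) by blast
qed

text \<open>From a point \<open>p\<close> of \<open>S1\<close> off \<open>S2\<close>, follow
  \<open>S1\<close> in both directions until \<open>S2\<close> is met at \<open>u\<close> and
  \<open>v\<close>. The piece of \<open>S1\<close> through \<open>p\<close> and the piece of
  \<open>S2\<close> between \<open>u\<close> and \<open>v\<close> close up.\<close>

lemma is_arc_two_loop:
  fixes S1 S2 :: "'a::t2_space set"
  assumes "is_arc S1 x y" "is_arc S2 x y" "S1 \<noteq> S2"
  shows "\<exists>g. simple_path g \<and> pathfinish g = pathstart g \<and> path_image g \<subseteq> S1 \<union> S2"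
proof -
  obtain p where p: "p \<in> S1" "p \<notin> S2"
    using assms is_arc_connected_subset[OF assms(2) is_arc_connected[OF assms(1)]] is_arc_ends[OF assms(1)] by blast
  have ends: "x \<in> S2" "y \<in> S2" using is_arc_ends[OF assms(2)] by auto
  obtain A B where s: "is_arc A x p" "is_arc B p y" "S1 = A \<union> B" "A \<inter> B = {p}"
    using is_arc_split[OF assms(1) p(1)] p ends by metis
  obtain u A' where u: "u \<in> S2" "A' \<subseteq> A" "is_arc A' p u" "A' \<inter> S2 = {u}"
    using is_arc_first_hit[OF is_arc_sym[OF s(1)] is_arc_closed[OF assms(2)] p(2) ends(1)] by blast
  obtain v B' where v: "v \<in> S2" "B' \<subseteq> B" "is_arc B' p v" "B' \<inter> S2 = {v}"
    using is_arc_first_hit[OF s(2) is_arc_closed[OF assms(2)] p(2) ends(2)] by blast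
  have "u \<in> A" "v \<in> B" using u(2,4) v(2,4) by auto
  then have "u \<noteq> v" using s(4) u(1) p(2) by auto
  then obtain S' where s': "S' \<subseteq> S2" "is_arc S' u v"
    using is_arc_subarc[OF assms(2) u(1) v(1)] by metis
  have "A' \<inter> B' = {p}" using u(2) v(2) s(4) is_arc_ends[OF u(3)] is_arc_ends[OF v(3)] by auto
  then have a: "is_arc (A' \<union> B') u v" using is_arc_join[OF is_arc_sym[OF u(3)] v(3)] by blast
  have "(A' \<union> B') \<inter> S' \<subseteq> {u, v}" "A' \<union> B' \<union> S' \<subseteq> S1 \<union> S2"
    using u(2,4) v(2,4) s(3) s'(1) by blast+
  then show ?thesis using is_arc_loop[OF a s'(2)] by metis
qed

section \<open>Segments and arms in trees\<close>

text \<open>The neighbourhood of \<open>x\<close> is described by a closed set \<open>C\<close> to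
  be avoided, so that finitely many edges can be treated together by a union; an edge missing
  \<open>x\<close> contributes itself.\<close>

lemma arc_local:
  fixes e :: "'a::t2_space set"
  assumes e: "is_arc e a b" and W: "open W" "x \<in> W"
  obtains C where "closed C" "x \<notin> C" "\<And>y. \<lbrakk>y \<in> e; y \<notin> C; y \<noteq> x\<rbrakk> \<Longrightarrow> \<exists>S\<subseteq>W \<inter> e. is_arc S x y"
proof (cases "x \<in> e")
  case False
  then show ?thesis using that[of e] is_arc_closed[OF e] by blast
next
  case True
  obtain g where g: "continuous_on {0..1::real} g" "inj_on g {0..1}" "g ` {0..1} = e" "g 0 = a" "g 1 = b"
    using is_arcE[OF e] by blast
  obtain t where t: "t \<in> {0..1}" "g t = x" using g(3) True by blast
  obtain A where A: "open A" "A \<inter> {0..1} = g -` W \<inter> {0..1}"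
    using g(1) W(1) continuous_on_open_invariant by metis
  have "t \<in> A" using A(2) t W(2) by blast
  then obtain d where d: "d > 0" "ball t d \<subseteq> A" using A(1) open_contains_ball by blast
  have W': "g s \<in> W" if "s \<in> {0..1}" "\<bar>s - t\<bar> < d" for s
  proof -
    have "s \<in> ball t d" using that by (auto simp: dist_real_def)
    then show ?thesis using d(2) A(2) that(1) by blast
  qed
  define C where "C = g ` ({0..1} - ball t d)"
  have "compact ({0..1} - ball t d)" by (simp add: compact_diff)
  then have "compact C" unfolding C_def
    by (intro compact_continuous_image continuous_on_subset[OF g(1)]) auto
  then have 1: "closed C" by (rule compact_imp_closed)
  have 2: "x \<notin> C"
  proof
    assume "x \<in> C"
    then obtain s where s: "s \<in> {0..1}" "s \<notin> ball t d" "g s = g t" unfolding C_def t(2) by auto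
    then have "s = t" using inj_onD[OF g(2)] t(1) by blast
    then show False using s d by simp
  qed
  have 3: "\<exists>S\<subseteq>W \<inter> e. is_arc S x y" if y: "y \<in> e" "y \<notin> C" "y \<noteq> x" for y
  proof -
    obtain s where s: "s \<in> {0..1}" "g s = y" using g(3) y(1) by blast
    have sb: "\<bar>s - t\<bar> < d"
      using y(2) s unfolding C_def by (auto simp: dist_real_def)
    have "s \<noteq> t" using s t y by blast
    then consider "s < t" | "t < s" by linarith
    then show ?thesis
    proof cases
      case 1
      have "is_arc (g ` {s..t}) (g s) (g t)"
        by (rule is_arcI) (use 1 s t in \<open>auto intro: continuous_on_subset[OF g(1)] inj_on_subset[OF g(2)]\<close>)
      moreover have "g ` {s..t} \<subseteq> W \<inter> e"
      proof
        fix w assume "w \<in> g ` {s..t}"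
        then obtain r where r: "r \<in> {s..t}" "w = g r" by blast
        then show "w \<in> W \<inter> e" using W'[of r] sb s t g(3) by auto
      qed
      ultimately show ?thesis using is_arc_sym s t by metis
    next
      case 2
      have "is_arc (g ` {t..s}) (g t) (g s)"
        by (rule is_arcI) (use 2 s t in \<open>auto intro: continuous_on_subset[OF g(1)] inj_on_subset[OF g(2)]\<close>)
      moreover have "g ` {t..s} \<subseteq> W \<inter> e"
      proof
        fix w assume "w \<in> g ` {t..s}"
        then obtain r where r: "r \<in> {t..s}" "w = g r" by blast
        then show "w \<in> W \<inter> e" using W'[of r] sb s t g(3) by auto
      qed
      ultimately show ?thesis using s t by metis
    qed
  qed
  show ?thesis using that[OF 1 2 3] by blast
qed

lemma finite_components_Union:
  assumes "finite \<C>" "\<And>C. C \<in> \<C> \<Longrightarrow> connected C" "\<Union>\<C> = S"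
  shows "finite (components S)"
proof -
  have "\<exists>C. C \<in> \<C> \<and> C \<subseteq> D \<and> C \<noteq> {}" if D: "D \<in> components S" for D
  proof -
    obtain x where x: "x \<in> D" using in_components_nonempty[OF D] by blast
    then have "x \<in> S" using in_components_subset[OF D] by blast
    then obtain C where C: "C \<in> \<C>" "x \<in> C" using assms(3) by blast
    then have "C \<subseteq> D" using components_maximal[OF D assms(2)[OF C(1)]] assms(3) x by blast
    then show ?thesis using C by blast
  qed
  then obtain g where g: "\<And>D. D \<in> components S \<Longrightarrow> g D \<in> \<C> \<and> g D \<subseteq> D \<and> g D \<noteq> {}" by metis
  have "inj_on g (components S)"
  proof (rule inj_onI)
    fix D D' assume a: "D \<in> components S" "D' \<in> components S" "g D = g D'"
    then have "D \<inter> D' \<noteq> {}" using g[OF a(1)] g[OF a(2)] by auto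
    then show "D = D'" using components_eq[OF a(1,2)] by blast
  qed
  moreover have "g ` components S \<subseteq> \<C>" using g by blast
  ultimately show ?thesis using assms(1) inj_on_finite by blast
qed

locale top_tree =
  fixes T :: "'a::t2_space set"
  assumes tree: "tree T"
begin

lemma graphE:
  obtains V E where "finite V" "finite E" "T = V \<union> \<Union>E"
    "\<And>e. e \<in> E \<Longrightarrow> \<exists>a b. is_arc e a b \<and> e \<inter> V = {a, b}"
    "\<And>e e'. \<lbrakk>e \<in> E; e' \<in> E; e \<noteq> e'\<rbrakk> \<Longrightarrow> e \<inter> e' \<subseteq> V"
proof -
  have "finite_graph T" using tree by (simp add: tree_def)
  then obtain V E where "finite V \<and> finite E \<and> T = V \<union> \<Union>E \<and>
        (\<forall>e\<in>E. \<exists>a b. is_arc e a b \<and> e \<inter> V = {a, b}) \<and>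
        (\<forall>e\<in>E. \<forall>e'\<in>E. e \<noteq> e' \<longrightarrow> e \<inter> e' \<subseteq> V)"
    unfolding finite_graph_def by (elim exE)
  then show ?thesis by (intro that[of V E]) simp_all
qed

lemma connected_T: "connected T" and T_nonempty: "T \<noteq> {}"
  using tree by (auto simp: tree_def)

lemma compact_T: "compact T"
proof -
  obtain V E where VE: "finite V" "finite E" "T = V \<union> \<Union>E"
    "\<And>e. e \<in> E \<Longrightarrow> \<exists>a b. is_arc e a b \<and> e \<inter> V = {a, b}"
    using graphE by metis
  have "compact e" if "e \<in> E" for e using VE(4)[OF that] is_arc_compact by blast
  then show ?thesis using VE(1-3) by (simp add: compact_Un compact_Union finite_imp_compact)
qed

lemma closed_T: "closed T" using compact_T compact_imp_closed by blast

lemma arc_unique: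
  assumes "is_arc S1 x y" "is_arc S2 x y" "S1 \<subseteq> T" "S2 \<subseteq> T"
  shows "S1 = S2"
proof (rule ccontr)
  assume "S1 \<noteq> S2"
  then obtain g where "simple_path g \<and> pathfinish g = pathstart g \<and> path_image g \<subseteq> S1 \<union> S2"
    using is_arc_two_loop[OF assms(1,2)] by blast
  then show False using tree assms(3,4) unfolding tree_def by blast
qed

lemma local_arcs:
  assumes "x \<in> T" "open W" "x \<in> W"
  obtains N where "openin (top_of_set T) N" "x \<in> N" "\<And>y. \<lbrakk>y \<in> N; y \<noteq> x\<rbrakk> \<Longrightarrow> \<exists>S\<subseteq>W \<inter> T. is_arc S x y"
proof -
  obtain V E where VE: "finite V" "finite E" "T = V \<union> \<Union>E"
    "\<And>e. e \<in> E \<Longrightarrow> \<exists>a b. is_arc e a b \<and> e \<inter> V = {a, b}"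
    using graphE by metis
  have "\<exists>C. closed C \<and> x \<notin> C \<and> (\<forall>y. y \<in> e \<longrightarrow> y \<notin> C \<longrightarrow> y \<noteq> x \<longrightarrow> (\<exists>S\<subseteq>W \<inter> e. is_arc S x y))"
    if e: "e \<in> E" for e
  proof -
    obtain a b where "is_arc e a b" using VE(4)[OF e] by blast
    from arc_local[OF this assms(2,3)] show ?thesis by metis
  qed
  then obtain C where C: "\<And>e. e \<in> E \<Longrightarrow> closed (C e)" "\<And>e. e \<in> E \<Longrightarrow> x \<notin> C e"
    "\<And>e y. \<lbrakk>e \<in> E; y \<in> e; y \<notin> C e; y \<noteq> x\<rbrakk> \<Longrightarrow> \<exists>S\<subseteq>W \<inter> e. is_arc S x y"
    by metis
  \<comment> \<open>Avoiding the other vertices forces a nearby point off the vertex set and onto an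
    edge; avoiding \<open>C e\<close> then makes it reachable from \<open>x\<close> inside
    \<open>W\<close>.\<close>
  define Z where "Z = (V - {x}) \<union> \<Union>(C ` E)"
  have "closed Z" unfolding Z_def using VE(1,2) C(1)
    by (intro closed_Un closed_Union) (auto intro: finite_imp_closed)
  then have "openin (top_of_set T) (T - Z)"
    by (metis Diff_eq closed_def openin_open_Int)
  moreover have "x \<in> T - Z" using assms(1) C(2) by (auto simp: Z_def)
  moreover have "\<exists>S\<subseteq>W \<inter> T. is_arc S x y" if y: "y \<in> T - Z" "y \<noteq> x" for y
  proof -
    have "y \<notin> V" using y by (auto simp: Z_def)
    then obtain e where e: "e \<in> E" "y \<in> e" using y(1) VE(3) by blast
    have "y \<notin> C e" using y(1) e(1) by (auto simp: Z_def)
    then obtain S where "S \<subseteq> W \<inter> e" "is_arc S x y" using C(3)[OF e _ y(2)] by blast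
    moreover have "W \<inter> e \<subseteq> W \<inter> T" using e(1) VE(3) by blast
    ultimately show ?thesis by blast
  qed
  ultimately show ?thesis using that by blast
qed

text \<open>Being joined by an arc in \<open>W\<close> is an equivalence relation whose classes are
  open by \<open>local_arcs\<close>, so a connected set lies in one class.\<close>

lemma component_arc:
  assumes W: "openin (top_of_set T) W" and xy: "connected_component W x y" "x \<noteq> y"
  shows "\<exists>S\<subseteq>W. is_arc S x y"
proof -
  define C where "C = connected_component_set W x"
  define R where "R u v \<longleftrightarrow> u = v \<or> (\<exists>S\<subseteq>W. is_arc S u v)" for u v
  obtain U where U: "open U" "W = T \<inter> U" using W openin_open by blast
  have CW: "C \<subseteq> W" unfolding C_def by (rule connected_component_subset)
  have "R x y"
  proof (rule connected_equivalence_relation[of C])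
    show "connected C" unfolding C_def by simp
    show "x \<in> C" "y \<in> C" unfolding C_def
      using xy connected_component_in by (auto simp: connected_component_refl_eq)
    show "R v u" if "R u v" for u v using that is_arc_sym unfolding R_def by metis
    show "R u w" if uvw: "R u v" "R v w" for u v w
    proof (cases "u = v \<or> v = w \<or> u = w")
      case True then show ?thesis using uvw unfolding R_def by metis
    next
      case False
      obtain S1 where S1: "S1 \<subseteq> W" "is_arc S1 u v" using uvw(1) False unfolding R_def by metis
      obtain S2 where S2: "S2 \<subseteq> W" "is_arc S2 v w" using uvw(2) False unfolding R_def by metis
      have "u \<noteq> w" using False by simp
      from is_arc_trans[OF S1(2) S2(2) this] obtain S where "S \<subseteq> S1 \<union> S2" "is_arc S u w" by metis
      then show ?thesis unfolding R_def using S1(1) S2(1) by (meson Un_least subset_trans)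
    qed
    show "\<exists>N. openin (top_of_set C) N \<and> a \<in> N \<and> (\<forall>x\<in>N. R a x)" if a: "a \<in> C" for a
    proof -
      have a': "a \<in> T" "a \<in> U" using a CW U(2) by auto
      obtain N where N: "openin (top_of_set T) N" "a \<in> N"
          "\<And>y. \<lbrakk>y \<in> N; y \<noteq> a\<rbrakk> \<Longrightarrow> \<exists>S\<subseteq>U \<inter> T. is_arc S a y"
        using local_arcs[OF a'(1) U(1) a'(2)] by metis
      obtain N' where N': "open N'" "N = T \<inter> N'" using N(1) openin_open by blast
      have "openin (top_of_set C) (C \<inter> N')" using N'(1) by (rule openin_open_Int)
      moreover have "a \<in> C \<inter> N'" using a N(2) N'(2) by blast
      moreover have "R a v" if v: "v \<in> C \<inter> N'" for v
      proof (cases "v = a")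
        case True then show ?thesis by (simp add: R_def)
      next
        case False
        have "v \<in> N" using v CW U(2) N'(2) by blast
        from N(3)[OF this False] show ?thesis unfolding R_def U(2) by (simp add: Int_commute)
      qed
      ultimately show ?thesis by blast
    qed
  qed
  then show ?thesis using xy(2) unfolding R_def by blast
qed

lemma openin_component:
  assumes W: "openin (top_of_set T) W"
  shows "openin (top_of_set T) (connected_component_set W x)"
proof (subst openin_subopen, intro ballI)
  fix y assume y: "y \<in> connected_component_set W x"
  obtain U where U: "open U" "W = T \<inter> U" using W openin_open by blast
  have yW: "y \<in> T" "y \<in> U" using y connected_component_subset[of W x] U by auto
  obtain N where N: "openin (top_of_set T) N" "y \<in> N"
    "\<And>z. \<lbrakk>z \<in> N; z \<noteq> y\<rbrakk> \<Longrightarrow> \<exists>S\<subseteq>U \<inter> T. is_arc S y z"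
    using local_arcs[OF yW(1) U(1) yW(2)] by metis
  have "z \<in> connected_component_set W x" if z: "z \<in> N" for z
  proof (cases "z = y")
    case True then show ?thesis using y by simp
  next
    case False
    obtain S where S: "S \<subseteq> U \<inter> T" "is_arc S y z" using N(3)[OF z False] by blast
    have "connected_component W y z"
      by (rule connected_componentI[of S]) (use S is_arc_connected[OF S(2)] is_arc_ends[OF S(2)] U(2) in auto)
    then show ?thesis using y connected_component_trans[of W x y z] by simp
  qed
  then show "\<exists>N. openin (top_of_set T) N \<and> y \<in> N \<and> N \<subseteq> connected_component_set W x"
    using N(1,2) by blast
qed

lemma arc_exists: "\<lbrakk>x \<in> T; y \<in> T; x \<noteq> y\<rbrakk> \<Longrightarrow> \<exists>S\<subseteq>T. is_arc S x y"
  by (rule component_arc) (use connected_T connected_iff_connected_component in auto)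

section \<open>Betweenness on segments: splitting, medians, initial pieces\<close>

abbreviation "seg \<equiv> segment T"

lemma seg_refl [simp]: "seg x x = {x}" by (simp add: segment_def)

lemma seg_eq:
  assumes "is_arc S x y" "S \<subseteq> T"
  shows "seg x y = S"
proof -
  have "(THE S. S \<subseteq> T \<and> is_arc S x y) = S"
    by (rule the_equality) (use assms arc_unique in blast)+
  then show ?thesis using is_arc_ends[OF assms(1)] by (simp add: segment_def)
qed

lemma seg_arc: "\<lbrakk>x \<in> T; y \<in> T; x \<noteq> y\<rbrakk> \<Longrightarrow> is_arc (seg x y) x y"
  using arc_exists seg_eq by metis

lemma seg_subset: "\<lbrakk>x \<in> T; y \<in> T\<rbrakk> \<Longrightarrow> seg x y \<subseteq> T"
  using arc_exists seg_eq by (metis empty_subsetI insert_subset seg_refl)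

lemma seg_in: "\<lbrakk>z \<in> seg x y; x \<in> T; y \<in> T\<rbrakk> \<Longrightarrow> z \<in> T"
  using seg_subset by blast

lemma seg_sym: "\<lbrakk>x \<in> T; y \<in> T\<rbrakk> \<Longrightarrow> seg y x = seg x y"
  using seg_arc seg_eq seg_subset is_arc_sym by metis

lemma seg_ends:
  assumes "x \<in> T" "y \<in> T"
  shows "x \<in> seg x y" "y \<in> seg x y"
proof -
  have "x \<in> seg x y \<and> y \<in> seg x y"
  proof (cases "x = y")
    case False then show ?thesis using is_arc_ends[OF seg_arc[OF assms False]] by blast
  qed simp
  then show "x \<in> seg x y" "y \<in> seg x y" by auto
qed

lemma connected_seg: "\<lbrakk>x \<in> T; y \<in> T\<rbrakk> \<Longrightarrow> connected (seg x y)"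
  using seg_arc is_arc_connected by (metis connected_sing seg_refl)

lemma compact_seg: "\<lbrakk>x \<in> T; y \<in> T\<rbrakk> \<Longrightarrow> compact (seg x y)"
  using seg_arc is_arc_compact by (metis compact_sing seg_refl)

lemma seg_trans:
  assumes "z \<in> seg x y" "x \<in> T" "y \<in> T" "w \<in> T"
  shows "z \<in> seg x w \<or> z \<in> seg w y"
proof -
  consider "x = y" | "x = w" | "w = y" | "x \<noteq> y" "x \<noteq> w" "w \<noteq> y" by blast
  then show ?thesis
  proof cases
    case 1 then show ?thesis using assms seg_ends by auto
  next
    case 4
    obtain S where S: "S \<subseteq> seg x w \<union> seg w y" "is_arc S x y"
      using is_arc_trans[OF seg_arc[OF assms(2,4) 4(2)] seg_arc[OF assms(4,3) 4(3)] 4(1)] by metis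
    have "S \<subseteq> T" using S(1) seg_subset assms by blast
    then have "seg x y = S" using seg_eq S(2) by blast
    then show ?thesis using S(1) assms(1) by blast
  qed (use assms in auto)
qed

lemma seg_split:
  assumes "z \<in> seg x y" "x \<in> T" "y \<in> T"
  shows "seg x y = seg x z \<union> seg z y" "seg x z \<inter> seg z y = {z}"
proof -
  have zT: "z \<in> T" using seg_in assms by blast
  have "seg x y = seg x z \<union> seg z y \<and> seg x z \<inter> seg z y = {z}"
  proof (cases "z = x \<or> z = y")
    case True
    then show ?thesis using assms seg_ends[OF assms(2,3)] by auto
  next
    case False
    then have "x \<noteq> y" using assms by auto
    obtain S1 S2 where s: "is_arc S1 x z" "is_arc S2 z y" "seg x y = S1 \<union> S2" "S1 \<inter> S2 = {z}"
      using is_arc_split[OF seg_arc[OF assms(2,3) \<open>x \<noteq> y\<close>] assms(1)] False by metis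
    have "S1 \<subseteq> T" "S2 \<subseteq> T" using s(3) seg_subset[OF assms(2,3)] by auto
    then have "seg x z = S1" "seg z y = S2" using seg_eq s(1,2) by auto
    then show ?thesis using s by simp
  qed
  then show "seg x y = seg x z \<union> seg z y" "seg x z \<inter> seg z y = {z}" by auto
qed

lemma seg_sub1: "\<lbrakk>w \<in> seg x z; z \<in> seg x y; x \<in> T; y \<in> T\<rbrakk> \<Longrightarrow> w \<in> seg x y"
  using seg_split by blast

lemma seg_sub2: "\<lbrakk>w \<in> seg z y; z \<in> seg x y; x \<in> T; y \<in> T\<rbrakk> \<Longrightarrow> w \<in> seg x y"
  using seg_split by blast

lemma seg_antisym: "\<lbrakk>z \<in> seg x y; y \<in> seg x z; x \<in> T; y \<in> T\<rbrakk> \<Longrightarrow> y = z"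
  using seg_split(2)[of z x y] seg_ends[of z y] seg_in by blast

lemma seg_mid:
  assumes "w \<in> seg x z" "z \<in> seg x y" "x \<in> T" "y \<in> T"
  shows "z \<in> seg w y"
proof -
  have T: "z \<in> T" "w \<in> T" using assms seg_in by blast+
  have w: "w \<in> seg x y" using seg_sub1 assms by blast
  from seg_split(1)[OF w assms(3,4)] assms(2) consider "z \<in> seg x w" | "z \<in> seg w y" by blast
  then show ?thesis
  proof cases
    case 1
    then have "w = z" using seg_antisym[OF assms(1) 1] assms T seg_antisym by metis
    then show ?thesis using seg_ends T assms by simp
  qed
qed

text \<open>The median is the point where the path from \<open>x\<close> to \<open>y\<close> first
  meets the segment from \<open>y\<close> to \<open>z\<close>.\<close>

lemma median_exists:
  assumes "x \<in> T" "y \<in> T" "z \<in> T"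
  obtains w where "w \<in> seg x y" "w \<in> seg y z" "w \<in> seg x z"
proof (cases "x \<in> seg y z")
  case True then show ?thesis using that assms seg_ends by blast
next
  case False
  show ?thesis
  proof (cases "y = z")
    case True then show ?thesis using that assms seg_ends by auto
  next
    case yz: False
    have xy: "x \<noteq> y" using False seg_ends assms by blast
    have cl: "closed (seg y z)" using compact_seg assms compact_imp_closed by blast
    obtain w S where w: "w \<in> seg y z" "S \<subseteq> seg x y" "is_arc S x w" "S \<inter> seg y z = {w}"
      using is_arc_first_hit[OF seg_arc[OF assms(1,2) xy] cl False] seg_ends assms by metis
    have ST: "S \<subseteq> T" using w(2) seg_subset assms by blast
    then have S: "S = seg x w" using seg_eq w(3) by blast
    have wT: "w \<in> T" using seg_in w(1) assms by blast
    have "w \<in> seg x y" using w(2) is_arc_ends[OF w(3)] by blast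
    moreover have "w \<in> seg x z"
    proof (cases "w = z")
      case True then show ?thesis using seg_ends assms by blast
    next
      case False
      have "seg w z \<subseteq> seg y z" using seg_sub2[OF _ w(1)] assms by blast
      then have "S \<inter> seg w z = {w}" using w(4) seg_ends[OF wT assms(3)] is_arc_ends[OF w(3)] by blast
      then have "is_arc (S \<union> seg w z) x z" using is_arc_join[OF w(3) seg_arc[OF wT assms(3) False]] by blast
      then have "seg x z = S \<union> seg w z" using seg_eq ST seg_subset[OF wT assms(3)] by blast
      then show ?thesis using seg_ends[OF wT assms(3)] by blast
    qed
    ultimately show ?thesis using that w(1) by blast
  qed
qed

lemma median_unique:
  assumes "w \<in> seg x y" "w \<in> seg y z" "w \<in> seg x z" "v \<in> seg x y" "v \<in> seg y z" "v \<in> seg x z"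
    and T: "x \<in> T" "y \<in> T" "z \<in> T"
  shows "v = w"
proof -
  have "v \<in> seg x w \<or> v \<in> seg w y" "v \<in> seg y w \<or> v \<in> seg w z" "v \<in> seg x w \<or> v \<in> seg w z"
    using assms seg_split(1) by blast+
  moreover have "w \<in> T" using seg_in assms by blast
  then have "seg x w \<inter> seg w y = {w}" "seg y w \<inter> seg w z = {w}" "seg x w \<inter> seg w z = {w}" "seg y w = seg w y"
    using assms seg_split(2) seg_sym by blast+
  ultimately show ?thesis by blast
qed

lemma seg_initial:
  assumes "x \<in> T" "u \<in> T" "x \<noteq> u" "open W" "x \<in> W"
  obtains y where "y \<in> seg x u" "y \<noteq> x" "y \<noteq> u" "seg x y \<subseteq> W"
proof -
  obtain g where g: "continuous_on {0..1::real} g" "inj_on g {0..1}" "g ` {0..1} = seg x u" "g 0 = x" "g 1 = u"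
    using is_arcE[OF seg_arc[OF assms(1-3)]] by blast
  obtain A where A: "open A" "A \<inter> {0..1} = g -` W \<inter> {0..1}"
    using g(1) assms(4) continuous_on_open_invariant by metis
  have "0 \<in> A" using A(2) g(4) assms(5) by auto
  then obtain d where d: "d > 0" "ball 0 d \<subseteq> A" using A(1) open_contains_ball by blast
  define s where "s = min (d/2) (1/2)"
  have s: "0 < s" "s < 1" "s < d" using d by (auto simp: s_def)
  have a: "is_arc (g ` {0..s}) (g 0) (g s)"
    by (rule is_arcI) (use s in \<open>auto intro: continuous_on_subset[OF g(1)] inj_on_subset[OF g(2)]\<close>)
  have sub: "g ` {0..s} \<subseteq> seg x u" using g(3) s by auto
  then have "seg x (g s) = g ` {0..s}" using seg_eq a g(4) seg_subset assms by (metis subset_trans)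
  moreover have "g ` {0..s} \<subseteq> W"
  proof
    fix w assume "w \<in> g ` {0..s}"
    then obtain r where r: "r \<in> {0..s}" "w = g r" by blast
    then have "r \<in> ball 0 d" "r \<in> {0..1}" using s by (auto simp: dist_real_def)
    then have "r \<in> A \<inter> {0..1}" using d(2) by blast
    then show "w \<in> W" unfolding A(2) r(2) by blast
  qed
  moreover have "g s \<noteq> x" "g s \<noteq> u"
    using inj_onD[OF g(2), of s 0] inj_onD[OF g(2), of s 1] g(4,5) s by auto
  moreover have "g s \<in> seg x u" using sub s by auto
  ultimately show ?thesis using that by blast
qed

lemma openin_delete: "openin (top_of_set T) (T - {z})"
  by (metis Diff_eq closed_def closed_singleton openin_open_Int)

section \<open>Arms in terms of segments\<close>

definition arm :: "'a \<Rightarrow> 'a \<Rightarrow> 'a set" where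
  "arm z x = connected_component_set (T - {z}) x"

text \<open>The bridge from topology to betweenness: statements about components become questions
  whether \<open>z\<close> lies on a segment.\<close>

lemma mem_arm_iff:
  assumes "z \<in> T" "x \<in> T"
  shows "y \<in> arm z x \<longleftrightarrow> x \<noteq> z \<and> y \<noteq> z \<and> y \<in> T \<and> z \<notin> seg x y"
proof
  assume "y \<in> arm z x"
  then have c: "connected_component (T - {z}) x y" by (simp add: arm_def)
  then have xy: "x \<in> T - {z}" "y \<in> T - {z}" using connected_component_in by metis+
  have "z \<notin> seg x y"
  proof (cases "x = y")
    case False
    obtain S where S: "S \<subseteq> T - {z}" "is_arc S x y" using component_arc[OF openin_delete c False] by blast
    then have "seg x y = S" using seg_eq by blast
    then show ?thesis using S by blast
  qed (use xy in auto)
  then show "x \<noteq> z \<and> y \<noteq> z \<and> y \<in> T \<and> z \<notin> seg x y" using xy by blast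
next
  assume a: "x \<noteq> z \<and> y \<noteq> z \<and> y \<in> T \<and> z \<notin> seg x y"
  then have "connected (seg x y)" "seg x y \<subseteq> T - {z}" "x \<in> seg x y" "y \<in> seg x y"
    using assms connected_seg[of x y] seg_subset[of x y] seg_ends[of x y] by auto
  then have "connected_component (T - {z}) x y" by (rule connected_componentI)
  then show "y \<in> arm z x" by (simp add: arm_def)
qed

lemma arm_refl: "\<lbrakk>x \<in> T; x \<noteq> z\<rbrakk> \<Longrightarrow> x \<in> arm z x"
  by (simp add: arm_def connected_component_refl_eq)

lemma arm_subset: "arm z x \<subseteq> T - {z}"
  unfolding arm_def by (rule connected_component_subset)

lemma arm_eq: "y \<in> arm z x \<Longrightarrow> arm z y = arm z x"
  unfolding arm_def using connected_component_eq by metis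

lemma arm_eq_iff:
  assumes "z \<in> T" "x \<in> T" "y \<in> T" "x \<noteq> z" "y \<noteq> z"
  shows "arm z x = arm z y \<longleftrightarrow> z \<notin> seg x y"
  using assms mem_arm_iff arm_refl arm_eq by metis

lemma arms_iff: "A \<in> arms T z \<longleftrightarrow> (\<exists>x\<in>T - {z}. A = arm z x)"
  unfolding arms_def arm_def components_iff by blast

lemma arm_in_arms: "\<lbrakk>x \<in> T; x \<noteq> z\<rbrakk> \<Longrightarrow> arm z x \<in> arms T z"
  using arms_iff by blast

lemma arms_mem_eq: "\<lbrakk>A \<in> arms T z; x \<in> A\<rbrakk> \<Longrightarrow> A = arm z x"
  using arms_iff arm_eq by metis

lemma arms_nonempty: "A \<in> arms T z \<Longrightarrow> \<exists>x. x \<in> A \<and> x \<in> T \<and> x \<noteq> z \<and> A = arm z x"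
  by (metis DiffE arm_refl arms_iff insertI1)

lemma openin_arm: "openin (top_of_set T) (arm z x)"
  unfolding arm_def by (rule openin_component[OF openin_delete])

lemma arm_open: obtains W where "open W" "arm z x = T \<inter> W"
  using openin_arm openin_open by metis

lemma closed_beyond:
  assumes "a \<in> T" "x \<in> T"
  shows "closed {y \<in> T. x \<in> seg a y}"
proof (cases "a = x")
  case True
  then have "{y \<in> T. x \<in> seg a y} = T" using seg_ends assms by auto
  then show ?thesis using closed_T by simp
next
  case False
  have "{y \<in> T. x \<in> seg a y} = T - arm x a"
    using mem_arm_iff[OF assms(2,1)] False seg_ends[OF assms] by auto
  moreover obtain W where "open W" "arm x a = T \<inter> W" using arm_open by metis
  ultimately have "{y \<in> T. x \<in> seg a y} = T - W" by auto
  then show ?thesis using closed_T \<open>open W\<close> by (simp add: closed_Diff)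
qed

text \<open>Zorn's lemma for the order \<open>x \<in> seg z y\<close>. A chain is bounded because
  the closed sets of points beyond its members have the finite intersection property in the compact
  set \<open>Q\<close>.\<close>

lemma maximal_exists:
  assumes Q: "closed Q" "Q \<subseteq> T" "Q \<noteq> {}" and z: "z \<in> T"
  obtains x where "x \<in> Q" "\<And>y. \<lbrakk>y \<in> Q; x \<in> seg z y\<rbrakk> \<Longrightarrow> y = x"
proof -
  define P where "P x y \<longleftrightarrow> x \<in> seg z y" for x y
  have QT: "\<And>x. x \<in> Q \<Longrightarrow> x \<in> T" using Q(2) by blast
  have Prefl: "P x x" if "x \<in> Q" for x using seg_ends(2) z QT that by (auto simp: P_def)
  have Ptrans: "P x w" if "P x y" "P y w" "w \<in> Q" for x y w
    using that seg_sub1 z QT unfolding P_def by blast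
  have Panti: "x = y" if "P x y" "P y x" "x \<in> Q" "y \<in> Q" for x y
    using that seg_antisym[of x z y] z QT unfolding P_def by blast
  have "\<exists>m\<in>Q. \<forall>a\<in>Q. P m a \<longrightarrow> a = m"
  proof (rule predicate_Zorn)
    show "partial_order_on Q (relation_of P Q)"
      by (rule partial_order_on_relation_ofI) (use Prefl Ptrans Panti in blast)+
    fix C assume C: "C \<in> Chains (relation_of P Q)"
    have CQ: "C \<subseteq> Q" and tot: "\<And>a b. \<lbrakk>a \<in> C; b \<in> C\<rbrakk> \<Longrightarrow> P a b \<or> P b a"
      using C unfolding Chains_def relation_of_def by auto
    have cQ: "compact Q" using compact_Int_closed[OF compact_T Q(1)] Q(2) by (simp add: Int_absorb1)
    have "Q \<inter> (\<Inter>c\<in>C. {y \<in> T. c \<in> seg z y}) \<noteq> {}"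
    proof (rule compact_imp_fip_image[OF cQ])
      fix c assume "c \<in> C" then show "closed {y \<in> T. c \<in> seg z y}"
        using closed_beyond z CQ QT by blast
    next
      fix I assume I: "finite I" "I \<subseteq> C"
      have "I \<noteq> {} \<Longrightarrow> \<exists>m\<in>I. \<forall>c\<in>I. P c m"
        using I
      proof (induction I rule: finite_induct)
        case (insert x F)
        show ?case
        proof (cases "F = {}")
          case True then show ?thesis using Prefl insert CQ by auto
        next
          case False
          then obtain m where m: "m \<in> F" "\<forall>c\<in>F. P c m" using insert by auto
          have "P x m \<or> P m x" using tot m(1) insert.prems by blast
          then show ?thesis
          proof
            assume "P x m" then show ?thesis using m by auto
          next
            assume mx: "P m x"
            have "P c x" if "c \<in> F" for c using Ptrans[OF _ mx] m(2) that insert.prems CQ by blast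
            moreover have "P x x" using Prefl insert.prems CQ by blast
            ultimately show ?thesis by blast
          qed
        qed
      qed simp
      then show "Q \<inter> (\<Inter>c\<in>I. {y \<in> T. c \<in> seg z y}) \<noteq> {}"
      proof (cases "I = {}")
        case True then show ?thesis using Q(3) by simp
      next
        case False
        then obtain m where m: "m \<in> I" "\<forall>c\<in>I. P c m" using \<open>I \<noteq> {} \<Longrightarrow> _\<close> by blast
        then have "m \<in> Q" using I CQ by blast
        then have "m \<in> Q \<inter> (\<Inter>c\<in>I. {y \<in> T. c \<in> seg z y})" using m QT unfolding P_def by blast
        then show ?thesis by blast
      qed
    qed
    then show "\<exists>u\<in>Q. \<forall>a\<in>C. P a u" unfolding P_def by blast
  qed
  then show ?thesis using that unfolding P_def by blast
qed

text \<open>Deleting one point leaves at most two connected pieces of every edge, and a finite union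
  of connected sets has finitely many components.\<close>

lemma finite_arms: "finite (arms T x)"
proof -
  obtain V E where VE: "finite V" "finite E" "T = V \<union> \<Union>E"
    "\<And>e. e \<in> E \<Longrightarrow> \<exists>a b. is_arc e a b \<and> e \<inter> V = {a, b}"
    using graphE by metis
  have "\<exists>A B. connected A \<and> connected B \<and> A \<union> B = e - {x}" if e: "e \<in> E" for e
  proof -
    obtain a b where ab: "is_arc e a b" using VE(4)[OF e] by blast
    obtain g where g: "continuous_on {0..1::real} g" "inj_on g {0..1}" "g ` {0..1} = e"
      using is_arcE[OF ab] by metis
    show ?thesis
    proof (cases "x \<in> e")
      case False
      then show ?thesis using is_arc_connected[OF ab] by (intro exI[of _ e] exI[of _ "{}"]) auto
    next
      case True
      then obtain t where t: "t \<in> {0..1}" "x = g t" using g(3) by blast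
      have "{0..1} - {t} = {0..<t} \<union> {t<..1}" using t by auto
      moreover have "g ` ({0..1} - {t}) = e - {x}"
        using inj_on_image_set_diff[OF g(2), of "{0..1}" "{t}"] t g(3) by auto
      ultimately have "g ` {0..<t} \<union> g ` {t<..1} = e - {x}" by (metis image_Un)
      moreover have "connected (g ` {0..<t})" "connected (g ` {t<..1})"
        by (rule connected_continuous_image; use t in \<open>auto intro: continuous_on_subset[OF g(1)]\<close>)+
      ultimately show ?thesis by blast
    qed
  qed
  then obtain A B where AB: "\<And>e. e \<in> E \<Longrightarrow> connected (A e) \<and> connected (B e) \<and> A e \<union> B e = e - {x}"
    by metis
  show ?thesis unfolding arms_def
  proof (rule finite_components_Union)
    show "finite ((\<lambda>v. {v}) ` (V - {x}) \<union> (A ` E \<union> B ` E))" using VE(1,2) by simp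
    show "connected C" if "C \<in> (\<lambda>v. {v}) ` (V - {x}) \<union> (A ` E \<union> B ` E)" for C
      using that AB by auto
    have "\<Union> (A ` E \<union> B ` E) = \<Union>E - {x}"
    proof -
      have "\<Union> (A ` E \<union> B ` E) = (\<Union>e\<in>E. A e \<union> B e)" by blast
      also have "\<dots> = (\<Union>e\<in>E. e - {x})" using AB by simp
      finally show ?thesis by blast
    qed
    then show "\<Union> ((\<lambda>v. {v}) ` (V - {x}) \<union> (A ` E \<union> B ` E)) = T - {x}"
      unfolding VE(3) by (simp only: Union_Un_distrib) auto
  qed
qed

text \<open>A point farthest out beyond \<open>v\<close> is an endpoint: an arm at it other than the
  one back to \<open>z\<close> would contain a point still farther out.\<close>

lemma arm_has_endpoint:
  assumes "z \<in> T" "v \<in> T" "v \<noteq> z"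
  obtains e where "e \<in> endpoints T" "e \<in> arm z v"
proof -
  define Q where "Q = {y \<in> T. v \<in> seg z y}"
  have "closed Q" unfolding Q_def using closed_beyond assms by blast
  moreover have "v \<in> Q" unfolding Q_def using seg_ends assms by blast
  ultimately obtain x where x: "x \<in> Q" "\<And>y. \<lbrakk>y \<in> Q; x \<in> seg z y\<rbrakk> \<Longrightarrow> y = x"
    using maximal_exists[of Q z] assms(1) unfolding Q_def by blast
  have xT: "x \<in> T" and vx: "v \<in> seg z x" using x(1) by (auto simp: Q_def)
  have xz: "x \<noteq> z" using vx assms(3) by auto
  have "z \<notin> seg v x"
    using seg_antisym[of z x v] seg_sym[of v x] seg_sym[of z x] vx xT assms by blast
  then have xa: "x \<in> arm z v" using mem_arm_iff[OF assms(1,2)] xT xz assms(3) by blast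
  have "A = arm x z" if A: "A \<in> arms T x" for A
  proof (rule ccontr)
    assume neq: "A \<noteq> arm x z"
    obtain b where b: "b \<in> T" "b \<noteq> x" "A = arm x b" using A arms_iff by blast
    then have "x \<in> seg z b" using neq arm_eq_iff[OF xT assms(1) b(1)] xz by auto
    moreover have "v \<in> seg z b" using seg_sub1[OF vx] \<open>x \<in> seg z b\<close> assms b by blast
    ultimately show False using x(2)[of b] b by (auto simp: Q_def)
  qed
  moreover have "arm x z \<in> arms T x" using arm_in_arms assms xz by metis
  ultimately have "arms T x = {arm x z}" by blast
  then have "x \<in> endpoints T" using xT by (simp add: endpoints_def)
  then show ?thesis using that xa by blast
qed

end

section \<open>Germs of arms and the gate fixed point argument\<close>

context top_tree
begin

lemma arm_seg:
  assumes "w \<in> seg x v" "w \<noteq> x" "x \<in> T" "v \<in> T"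
  shows "arm x w = arm x v"
proof -
  have w: "w \<in> T" using assms seg_in by blast
  have "v \<noteq> x" using assms by auto
  have "x \<notin> seg w v"
  proof
    assume "x \<in> seg w v"
    then have "x = w" using seg_antisym[of w v x] assms w seg_sym by metis
    then show False using assms by simp
  qed
  then show ?thesis using arm_eq_iff[OF assms(3) w assms(4)] assms(2) \<open>v \<noteq> x\<close> by blast
qed

lemma arm_openE:
  obtains W where "open W" "\<And>y. y \<in> T \<Longrightarrow> y \<in> W \<longleftrightarrow> y \<in> arm z x"
proof -
  obtain W where "open W" "arm z x = T \<inter> W" using arm_open by metis
  then show ?thesis using that[of W] by simp
qed

lemma common_germ:
  assumes "arm x u = arm x v" "x \<in> T" "u \<in> T" "v \<in> T" "u \<noteq> x" "v \<noteq> x"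
  obtains w where "w \<in> T" "w \<noteq> x" "w \<in> seg x u" "w \<in> seg x v"
proof -
  obtain w where w: "w \<in> seg x u" "w \<in> seg u v" "w \<in> seg x v"
    using median_exists[OF assms(2-4)] by metis
  have "x \<notin> seg u v" using arm_eq_iff[OF assms(2-6)] assms(1) by blast
  then have "w \<noteq> x" using w by blast
  then show ?thesis using that w seg_in assms by blast
qed

lemma arm_at: assumes "x \<in> T" "v \<in> T" "v \<noteq> x" "open W" "x \<in> W"
  obtains y where "y \<in> T" "y \<noteq> x" "y \<in> seg x v" "y \<in> W" "arm x y = arm x v"
proof -
  obtain y where y: "y \<in> seg x v" "y \<noteq> x" "seg x y \<subseteq> W"
    using seg_initial[OF assms(1,2) _ assms(4,5)] assms(3) by metis
  have yT: "y \<in> T" using y(1) assms seg_in by blast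
  then have "y \<in> W" using y(3) seg_ends[OF assms(1) yT] by blast
  then show ?thesis using that[OF yT y(2,1)] arm_seg[OF y(1,2) assms(1,2)] by blast
qed

text \<open>Walking from \<open>a\<close> towards \<open>h x\<close> as long as this leads away from \<open>a\<close>, one is only stopped
  by a fixed point of \<open>h\<close> or by a point where the walk leaves \<open>K\<close>.\<close>

lemma gate_fixed_point:
  assumes K: "closed K" "K \<subseteq> T" "\<And>x y. \<lbrakk>x \<in> K; y \<in> K\<rbrakk> \<Longrightarrow> seg x y \<subseteq> K" and a: "a \<in> K"
    and h: "continuous_on K h" "h ` K \<subseteq> T"
  obtains p where "p \<in> K" "p \<in> seg a (h p)" "seg p (h p) \<inter> K = {p}"
proof -
  have KT: "\<And>x. x \<in> K \<Longrightarrow> x \<in> T" and hT: "\<And>x. x \<in> K \<Longrightarrow> h x \<in> T" using K(2) h(2) by auto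
  have aT: "a \<in> T" using a KT by blast
  have h_open: "\<exists>A. open A \<and> (\<forall>x\<in>K. x \<in> A \<longleftrightarrow> h x \<in> arm u v)" for u v
  proof -
    obtain W where W: "open W" "\<And>y. y \<in> T \<Longrightarrow> y \<in> W \<longleftrightarrow> y \<in> arm u v" using arm_openE by metis
    obtain A where A: "open A" "A \<inter> K = h -` W \<inter> K"
      using h(1) W(1) continuous_on_open_invariant by metis
    have "x \<in> A \<longleftrightarrow> h x \<in> arm u v" if "x \<in> K" for x
      using A(2) W(2)[OF hT[OF that]] that by blast
    then show ?thesis using A(1) by blast
  qed
  \<comment> \<open>\<open>G\<close> collects the points that \<open>h\<close> fixes or moves
    straight away from \<open>a\<close>, and \<open>Q\<close> those that are reached from
    \<open>a\<close> inside \<open>G\<close>. A maximal element of \<open>Q\<close> will be the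
    required point.\<close>
  define G where "G = {y \<in> K. y \<in> seg a (h y)}"
  define Q where "Q = {x \<in> K. seg a x \<subseteq> G}"
  have G_open: "\<exists>A. open A \<and> y \<in> A \<and> A \<inter> G = {}" if y: "y \<in> K" "y \<notin> G" for y
  proof -
    have yT: "y \<in> T" "h y \<in> T" using y KT hT by auto
    have ny: "y \<notin> seg a (h y)" using y by (simp add: G_def)
    obtain w where w: "w \<in> seg y a" "w \<in> seg a (h y)" "w \<in> seg y (h y)"
      using median_exists[OF yT(1) aT yT(2)] by metis
    have wT: "w \<in> T" using w aT yT seg_in by blast
    have "w \<noteq> y" using w ny by blast
    \<comment> \<open>\<open>w\<close> is where the way from \<open>a\<close> to \<open>h y\<close>
      parts from the way to \<open>y\<close>. A point \<open>u\<close> strictly between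
      \<open>w\<close> and \<open>y\<close> separates all \<open>x\<close> near \<open>y\<close>
      from \<open>a\<close>, but does not separate \<open>h x\<close> from \<open>a\<close>; so such
      \<open>x\<close> are not in \<open>G\<close>.\<close>
    obtain u where u: "u \<in> seg y w" "u \<noteq> y" "u \<noteq> w"
      using seg_initial[OF yT(1) wT _ open_UNIV] \<open>w \<noteq> y\<close> by (metis UNIV_I)
    have uT: "u \<in> T" using u wT yT seg_in by blast
    have u1: "u \<in> seg y a" "u \<in> seg y (h y)" using seg_sub1 u(1) w(1,3) aT yT by blast+
    have w1: "w \<in> seg u a" "w \<in> seg u (h y)" using seg_mid u(1) w(1,3) aT yT by blast+
    have ne: "a \<noteq> u" "h y \<noteq> u" using w1 u(3) by auto
    have e1: "arm u a = arm u w" "arm u (h y) = arm u w"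
      using arm_seg[OF w1(1)] arm_seg[OF w1(2)] u(3) uT aT yT by auto
    have e2: "arm u y \<noteq> arm u a" using arm_eq_iff[OF uT yT(1) aT] u1(1) u(2) ne by auto
    obtain A where A: "open A" "\<forall>x\<in>K. x \<in> A \<longleftrightarrow> h x \<in> arm u a" using h_open by blast
    obtain B where B: "open B" "\<And>q. q \<in> T \<Longrightarrow> q \<in> B \<longleftrightarrow> q \<in> arm u y" using arm_openE by metis
    have "h y \<in> arm u a" using arm_refl[OF yT(2) ne(2)] e1 by simp
    then have "y \<in> A" using A(2) y(1) by blast
    moreover have "y \<in> B" using B(2)[OF yT(1)] arm_refl[OF yT(1) u(2)[symmetric]] by blast
    ultimately have "y \<in> A \<inter> B" by blast
    moreover have "A \<inter> B \<inter> G = {}"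
    proof (rule ccontr)
      assume "A \<inter> B \<inter> G \<noteq> {}"
      then obtain x where x: "x \<in> A" "x \<in> B" "x \<in> G" by blast
      then have xK: "x \<in> K" "x \<in> seg a (h x)" by (auto simp: G_def)
      then have xT: "x \<in> T" "h x \<in> T" using KT hT by auto
      have "h x \<in> arm u a" using A(2) x xK by blast
      then have h1: "u \<notin> seg a (h x)" using mem_arm_iff[OF uT aT] by blast
      have "x \<in> arm u y" using B(2)[OF xT(1)] x(2) by blast
      then have "arm u x \<noteq> arm u a" using arm_eq e2 by metis
      moreover have "x \<noteq> u" using \<open>x \<in> arm u y\<close> arm_subset by blast
      ultimately have "u \<in> seg x a" using arm_eq_iff[OF uT xT(1) aT] ne by blast
      then have "u \<in> seg a x" using seg_sym[OF aT xT(1)] by simp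
      then show False using seg_sub1[OF _ xK(2) aT xT(2)] h1 by blast
    qed
    ultimately show ?thesis using A(1) B(1) by blast
  qed
  have "a \<in> Q" using a seg_ends aT hT by (auto simp: Q_def G_def)
  have Q_open: "\<exists>A. open A \<and> x \<in> A \<and> A \<inter> Q = {}" if x: "x \<in> K" "x \<notin> Q" for x
  proof -
    have xT: "x \<in> T" using x KT by blast
    obtain y where y: "y \<in> seg a x" "y \<notin> G" using x by (auto simp: Q_def)
    have yK: "y \<in> K" using K(3)[OF a x(1)] y(1) by blast
    have yT: "y \<in> T" using yK KT by blast
    have ya: "y \<noteq> a" using \<open>a \<in> Q\<close> y(2) unfolding Q_def using seg_ends(1)[OF aT aT] by auto
    show ?thesis
    proof (cases "y = x")
      case True
      obtain A where A: "open A" "y \<in> A" "A \<inter> G = {}" using G_open yK y(2) by blast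
      have "Q \<subseteq> G" unfolding Q_def using seg_ends(2)[OF aT KT] by blast
      then show ?thesis using A True by blast
    next
      case False
      obtain B where B: "open B" "\<And>q. q \<in> T \<Longrightarrow> q \<in> B \<longleftrightarrow> q \<in> arm y x" using arm_openE by metis
      have "x \<in> B" using B(2)[OF xT] arm_refl[OF xT False[symmetric]] by blast
      moreover have "B \<inter> Q = {}"
      proof (rule ccontr)
        assume "B \<inter> Q \<noteq> {}"
        then obtain v where v: "v \<in> B" "v \<in> Q" by blast
        then have vT: "v \<in> T" using KT by (auto simp: Q_def)
        have "v \<in> arm y x" using B(2)[OF vT] v(1) by blast
        then have v1: "v \<noteq> y" "arm y v = arm y x" using arm_subset[of y x] arm_eq[of v y x] by auto
        have "arm y a \<noteq> arm y x" using arm_eq_iff[OF yT aT xT] y(1) ya False by auto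
        then have "y \<in> seg a v" using arm_eq_iff[OF yT aT vT] v1 ya by auto
        then show False using v(2) y(2) by (auto simp: Q_def)
      qed
      ultimately show ?thesis using B(1) by blast
    qed
  qed
  have QK: "Q \<subseteq> K" by (auto simp: Q_def)
  have "open (- Q)"
  proof (subst open_subopen, intro ballI)
    fix x assume "x \<in> - Q"
    show "\<exists>A. open A \<and> x \<in> A \<and> A \<subseteq> - Q"
    proof (cases "x \<in> K")
      case True then show ?thesis using Q_open[OF True] \<open>x \<in> - Q\<close> by blast
    next
      case False
      then show ?thesis using K(1) QK by (intro exI[of _ "- K"]) (auto simp: closed_def)
    qed
  qed
  then have "closed Q" by (simp add: closed_def)
  then obtain p where p: "p \<in> Q" "\<And>y. \<lbrakk>y \<in> Q; p \<in> seg a y\<rbrakk> \<Longrightarrow> y = p"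
    using maximal_exists[of Q a] QK KT aT \<open>a \<in> Q\<close> by (metis empty_iff subset_iff)
  have pK: "p \<in> K" using p(1) QK by blast
  have pT: "p \<in> T" "h p \<in> T" using pK KT hT by auto
  have pG: "p \<in> seg a (h p)" using p(1) seg_ends(2)[OF aT pT(1)] by (auto simp: Q_def G_def)
  have "seg p (h p) \<inter> K = {p}"
  proof (rule ccontr)
    assume "seg p (h p) \<inter> K \<noteq> {p}"
    then obtain y where y: "y \<in> seg p (h p)" "y \<in> K" "y \<noteq> p" using pK seg_ends(1)[OF pT] by blast
    have yT: "y \<in> T" using y KT by blast
    \<comment> \<open>Continuity at \<open>p\<close>: points \<open>v\<close> just beyond
      \<open>p\<close> towards \<open>y\<close> are still mapped beyond \<open>u\<close>, so they
      belong to \<open>Q\<close>, contradicting the maximality of \<open>p\<close>.\<close>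
    obtain u where u: "u \<in> seg p y" "u \<noteq> p" "u \<noteq> y"
      using seg_initial[OF pT(1) yT _ open_UNIV] y(3) by (metis UNIV_I)
    have uT: "u \<in> T" using u yT pT seg_in by blast
    have uK: "u \<in> K" using K(3)[OF pK y(2)] u(1) by blast
    have u1: "u \<in> seg p (h p)" using seg_sub1[OF u(1) y(1) pT] .
    have u2: "u \<in> seg a (h p)" using seg_sub2[OF u1 pG aT pT(2)] .
    have u3: "p \<in> seg a u"
    proof -
      have "u \<in> seg p (h p)" by fact
      then have "p \<in> seg (h p) a" "u \<in> seg (h p) p" using pG seg_sym aT pT by auto
      then have "p \<in> seg u a" using seg_mid aT pT by blast
      then show ?thesis using seg_sym[OF aT uT] by simp
    qed
    have uh: "u \<noteq> h p" using seg_antisym[OF u(1) _ pT(1) yT] y(1) u(3) by blast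
    obtain A where A: "open A" "\<forall>x\<in>K. x \<in> A \<longleftrightarrow> h x \<in> arm u (h p)" using h_open by blast
    have "p \<in> A" using A(2) pK arm_refl[OF pT(2) uh[symmetric]] by blast
    then obtain v where v: "v \<in> seg p u" "v \<noteq> p" "seg p v \<subseteq> A"
      using seg_initial[OF pT(1) uT _ A(1)] u(2) by metis
    have vT: "v \<in> T" using v uT pT seg_in by blast
    have vK: "v \<in> K" using K(3)[OF pK uK] v(1) by blast
    have v2: "p \<in> seg a v"
    proof -
      have "v \<in> seg u p" "p \<in> seg u a" using v(1) u3 seg_sym aT uT pT by auto
      then have "p \<in> seg v a" using seg_mid uT aT by blast
      then show ?thesis using seg_sym[OF aT vT] by simp
    qed
    have inG: "x \<in> G" if x: "x \<in> seg p v" for x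
    proof -
      have xK: "x \<in> K" using K(3)[OF pK vK] x by blast
      then have xT: "x \<in> T" "h x \<in> T" using KT hT by auto
      have "h x \<in> arm u (h p)" using A(2) xK x v(3) by blast
      then have hx: "h x \<noteq> u" "arm u (h x) = arm u (h p)"
        using arm_subset[of u "h p"] arm_eq[of "h x" u "h p"] by auto
      have "x \<in> seg p u" using seg_sub1[OF x v(1) pT(1) uT] .
      then have xau: "x \<in> seg a u" using seg_sub2[OF _ u3 aT uT] by blast
      have "u \<in> seg a (h x)"
      proof (cases "a = u")
        case True then show ?thesis using seg_ends aT xT by blast
      next
        case False
        have "arm u a \<noteq> arm u (h p)" using arm_eq_iff[OF uT aT pT(2)] False uh u2 by auto
        then show ?thesis using arm_eq_iff[OF uT aT xT(2)] False hx by auto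
      qed
      then have "x \<in> seg a (h x)" using seg_sub1[OF xau _ aT xT(2)] by blast
      then show ?thesis using xK by (simp add: G_def)
    qed
    have "seg a v \<subseteq> G"
      using seg_split(1)[OF v2 aT vT] inG p(1) by (auto simp: Q_def)
    then have "v \<in> Q" using vK by (simp add: Q_def)
    then show False using p(2)[OF _ v2] v(2) by blast
  qed
  then show ?thesis using that pK pG by blast
qed

section \<open>Locally injective paths in trees are injective\<close>

lemma no_loop_interval:
  fixes g :: "real \<Rightarrow> 'a"
  assumes "s < t" "continuous_on {s..t} g" "g ` {s..t} \<subseteq> T" "g s = g t"
    and inj: "\<And>u v. \<lbrakk>s < u; u < v; v < t\<rbrakk> \<Longrightarrow> g u \<noteq> g v"
    and ends: "\<And>u. \<lbrakk>s < u; u < t\<rbrakk> \<Longrightarrow> g u \<noteq> g s"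
  shows False
proof -
  define r where "r = (s + t) / 2"
  have r: "s < r" "r < t" using assms(1) by (auto simp: r_def)
  have key: "g u = g v \<longleftrightarrow> u = v \<or> (u = s \<and> v = t)" if "s \<le> u" "u \<le> v" "v \<le> t" for u v
    using that inj[of u v] ends[of u] ends[of v] assms(4) by (cases "u = s"; cases "v = t"; force)
  have 1: "inj_on g {s..r}"
    by (rule linorder_inj_onI) (use key r in auto)
  have 2: "inj_on g {r..t}"
    by (rule linorder_inj_onI) (use key r in auto)
  have a1: "is_arc (g ` {s..r}) (g s) (g r)"
    by (rule is_arcI) (use r 1 in \<open>auto intro: continuous_on_subset[OF assms(2)]\<close>)
  have a2: "is_arc (g ` {r..t}) (g r) (g t)"
    by (rule is_arcI) (use r 2 in \<open>auto intro: continuous_on_subset[OF assms(2)]\<close>)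
  have "g ` {s..r} \<inter> g ` {r..t} \<subseteq> {g s, g r}"
  proof
    fix x assume "x \<in> g ` {s..r} \<inter> g ` {r..t}"
    then obtain u v where uv: "u \<in> {s..r}" "v \<in> {r..t}" "x = g u" "x = g v" by blast
    then have "u = v \<or> (u = s \<and> v = t)" using key[of u v] r by auto
    then show "x \<in> {g s, g r}" using uv r by auto
  qed
  then obtain p where "simple_path p \<and> pathfinish p = pathstart p \<and> path_image p = g ` {s..r} \<union> g ` {r..t}"
    using is_arc_loop[OF a1 is_arc_sym[OF a2[folded assms(4)]]] by blast
  moreover have "g ` {s..r} \<union> g ` {r..t} \<subseteq> T" using assms(3) r by auto
  ultimately show False using tree unfolding tree_def by metis
qed

text \<open>Let \<open>m\<close> be the supremum of the times up to which \<open>g\<close> is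
  injective. A coincidence at \<open>m\<close> itself would close a loop. Beyond \<open>m\<close>,
  local injectivity handles the recent past, and the older part is a compact set \<open>C\<close>
  not containing \<open>g m\<close>, which the path avoids for a while.\<close>

lemma locally_inj_imp_inj:
  fixes g :: "real \<Rightarrow> 'a"
  assumes "a \<le> b" and cont: "continuous_on {a..b} g" and T: "g ` {a..b} \<subseteq> T"
    and loc: "\<And>t. t \<in> {a..b} \<Longrightarrow> \<exists>e>0. inj_on g ({a..b} \<inter> {t-e<..<t+e})"
  shows "inj_on g {a..b}"
proof -
  define A where "A = {t \<in> {a..b}. inj_on g {a..t}}"
  have aA: "a \<in> A" using assms(1) by (simp add: A_def)
  have bA: "bdd_above A" unfolding A_def by (rule bdd_aboveI[of _ b]) auto
  define m where "m = Sup A"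
  have Ab: "\<And>t. t \<in> A \<Longrightarrow> t \<le> b" by (simp add: A_def)
  have m: "a \<le> m" unfolding m_def using cSup_upper[OF aA bA] .
  have "A \<noteq> {}" using aA by blast
  then have m: "a \<le> m" "m \<le> b" using m cSup_least[of A b] Ab unfolding m_def by auto
  have down: "inj_on g {a..t}" if tm: "t < m" "a \<le> t" for t
  proof -
    obtain s where s: "s \<in> A" "t < s" using less_cSup_iff[OF \<open>A \<noteq> {}\<close> bA, of t] tm(1) unfolding m_def by blast
    then have "inj_on g {a..s}" by (simp add: A_def)
    then show ?thesis by (rule inj_on_subset) (use s in auto)
  qed
  have lt: "g u \<noteq> g v" if "a \<le> u" "u < v" "v < m" for u v
    using down[of v] that inj_onD[of g "{a..v}" u v] by auto
  have neq: "g u \<noteq> g m" if u: "a \<le> u" "u < m" for u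
  proof
    assume eq: "g u = g m"
    show False
    proof (rule no_loop_interval[of u m g])
      show "continuous_on {u..m} g" by (rule continuous_on_subset[OF cont]) (use u m in auto)
      show "g ` {u..m} \<subseteq> T" using T u m by fastforce
      show "g x \<noteq> g y" if "u < x" "x < y" "y < m" for x y using lt[of x y] that u by auto
      show "g x \<noteq> g u" if "u < x" "x < m" for x using lt[of u x] that u by auto
    qed (use u eq in auto)
  qed
  have injm: "inj_on g {a..m}"
    by (rule linorder_inj_onI) (use lt neq in \<open>auto simp: le_less\<close>)
  have "m = b"
  proof (rule ccontr)
    assume "m \<noteq> b"
    then have mb: "m < b" using m by simp
    obtain e where e: "e > 0" "inj_on g ({a..b} \<inter> {m-e<..<m+e})" using loc[of m] m by auto
    define C where "C = g ` {a..m - e/2}"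
    have "compact C" unfolding C_def
      by (rule compact_continuous_image) (use m e in \<open>auto intro: continuous_on_subset[OF cont]\<close>)
    then have "open (- C)" using compact_imp_closed open_Compl by blast
    then obtain B where B: "open B" "B \<inter> {a..b} = g -` (- C) \<inter> {a..b}"
      using cont continuous_on_open_invariant by metis
    have "g m \<notin> C" unfolding C_def using neq e by force
    then have "m \<in> B" using B(2) m by auto
    then obtain d where d: "d > 0" "ball m d \<subseteq> B" using B(1) open_contains_ball by blast
    define k where "k = min (min d e) (b - m) / 2"
    have k: "k > 0" "k < d" "k < e" "m + k < b" using d e mb by (auto simp: k_def min_def field_simps)
    have "inj_on g {a..m + k}"
    proof (rule linorder_inj_onI)
      fix u v :: real assume uv: "u < v" "u \<in> {a..m + k}" "v \<in> {a..m + k}"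
      show "g u \<noteq> g v"
      proof (cases "v \<le> m")
        case True then show ?thesis using inj_onD[OF injm, of u v] uv by auto
      next
        case v: False
        show ?thesis
        proof (cases "u \<le> m - e/2")
          case True
          have "v \<in> ball m d" using v uv k by (auto simp: dist_real_def)
          then have "v \<in> B \<inter> {a..b}" using d(2) uv k by auto
          then have "g v \<notin> C" unfolding B(2) by blast
          moreover have "g u \<in> C" unfolding C_def using True uv by auto
          ultimately show ?thesis by metis
        next
          case False
          then have "u \<in> {a..b} \<inter> {m-e<..<m+e}" "v \<in> {a..b} \<inter> {m-e<..<m+e}" using v uv k e m by auto
          then show ?thesis using inj_onD[OF e(2)] uv(1) by fastforce
        qed
      qed
    qed auto
    then have "m + k \<in> A" using k m by (auto simp: A_def)
    then have "m + k \<le> m" unfolding m_def using cSup_upper bA by blast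
    then show False using k by simp
  qed
  then show ?thesis using injm by simp
qed

text \<open>The ends are exempt because segments ending at the critical point, where
  \<open>f\<close> need not be locally injective, have to be covered.\<close>

lemma locally_inj_interior_imp_inj:
  fixes g :: "real \<Rightarrow> 'a"
  assumes "a < b" and cont: "continuous_on {a..b} g" and T: "g ` {a..b} \<subseteq> T"
    and loc: "\<And>t. \<lbrakk>a < t; t < b\<rbrakk> \<Longrightarrow> \<exists>e>0. inj_on g ({a..b} \<inter> {t-e<..<t+e})"
  shows "inj_on g {a..b}"
proof -
  have 1: "g u \<noteq> g v" if uv: "a < u" "u < v" "v < b" for u v
  proof -
    have "inj_on g {u..v}"
    proof (rule locally_inj_imp_inj)
      fix t assume "t \<in> {u..v}"
      then obtain e where e: "e > 0" "inj_on g ({a..b} \<inter> {t-e<..<t+e})" using loc[of t] uv by auto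
      have "inj_on g ({u..v} \<inter> {t-e<..<t+e})" by (rule inj_on_subset[OF e(2)]) (use uv in auto)
      then show "\<exists>e>0. inj_on g ({u..v} \<inter> {t-e<..<t+e})" using e(1) by blast
    next
      have s: "{u..v} \<subseteq> {a..b}" using uv by auto
      show "continuous_on {u..v} g" by (rule continuous_on_subset[OF cont s])
      show "g ` {u..v} \<subseteq> T" using T s by blast
    qed (use uv in auto)
    then show ?thesis using uv inj_onD[of g "{u..v}" u v] by auto
  qed
  have sub: "continuous_on {u..v} g" "g ` {u..v} \<subseteq> T" if "a \<le> u" "v \<le> b" for u v
  proof -
    have "{u..v} \<subseteq> {a..b}" using that by auto
    then show "continuous_on {u..v} g" "g ` {u..v} \<subseteq> T"
      using continuous_on_subset[OF cont] T by blast+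
  qed
  have 2: "g a \<noteq> g v" if v: "a < v" "v < b" for v
  proof
    assume eq: "g a = g v"
    show False
    proof (rule no_loop_interval[of a v g])
      show "g x \<noteq> g y" if "a < x" "x < y" "y < v" for x y using 1 that v by simp
      show "g x \<noteq> g a" if "a < x" "x < v" for x using 1[of x v] that v eq by simp
    qed (use v eq sub in auto)
  qed
  have 3: "g v \<noteq> g b" if v: "a < v" "v < b" for v
  proof
    assume eq: "g v = g b"
    show False
    proof (rule no_loop_interval[of v b g])
      show "g x \<noteq> g y" if "v < x" "x < y" "y < b" for x y using 1 that v by simp
      show "g x \<noteq> g v" if "v < x" "x < b" for x using 1[of v x] that v by auto
    qed (use v eq sub in auto)
  qed
  have 4: "g a \<noteq> g b"
  proof
    assume eq: "g a = g b"
    show False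
    proof (rule no_loop_interval[of a b g])
      show "g x \<noteq> g y" if "a < x" "x < y" "y < b" for x y using 1 that by simp
      show "g x \<noteq> g a" if "a < x" "x < b" for x using 2[of x] that by auto
    qed (use assms(1) eq sub in auto)
  qed
  show ?thesis
    by (rule linorder_inj_onI) (use 1 2 3 4 in \<open>auto simp: le_less\<close>)
qed

end

section \<open>Hubbard trees\<close>

locale hubbard = top_tree T for T :: "'a::t2_space set" +
  fixes f :: "'a \<Rightarrow> 'a" and c :: 'a
  assumes hub: "hubbard_tree T f c"
begin

lemma cT: "c \<in> T" and cont_f: "continuous_on T f" and f_onto: "f ` T = T" and fc: "f c \<noteq> c"
  and ends_crit: "endpoints T \<subseteq> crit_orbit f c"
  using hub unfolding hubbard_tree_def by blast+

lemma fib: "y \<in> T \<Longrightarrow> finite {x\<in>T. f x = y} \<and> card {x\<in>T. f x = y} \<le> 2"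
  using hub unfolding hubbard_tree_def by blast

lemma local_homeo:
  assumes "x \<in> T" "x \<noteq> c"
  obtains U where "open U" "x \<in> U" "inj_on f (T \<inter> U)"
proof -
  obtain U g where U: "openin (top_of_set T) U" "x \<in> U" "homeomorphism U (f ` U) f g"
    using hub assms unfolding hubbard_tree_def by blast
  have "inj_on f U" using U(3) unfolding homeomorphism_def by (metis inj_on_inverseI)
  moreover obtain W where W: "open W" "U = T \<inter> W" using U(1) openin_open by blast
  ultimately show ?thesis using that[of W] U(2) by blast
qed

lemma fT: "x \<in> T \<Longrightarrow> f x \<in> T" using f_onto by blast

lemma fcT: "f c \<in> T" using fT cT .

lemma fpT: "x \<in> T \<Longrightarrow> (f ^^ n) x \<in> T" by (induction n) (auto intro: fT)

section \<open>The map on segments and on local arms\<close>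

definition sep :: "'a \<Rightarrow> 'a \<Rightarrow> bool" where
  "sep x y \<longleftrightarrow> c \<in> seg x y \<and> x \<noteq> c \<and> y \<noteq> c"

text \<open>The critical point is not interior to the segment, so \<open>f\<close> is locally
  injective along the interior, and in a tree this makes the image path an arc.\<close>

lemma
  assumes "x \<in> T" "y \<in> T" "\<not> sep x y"
  shows f_inj_seg: "inj_on f (seg x y)" and f_seg: "f ` seg x y = seg (f x) (f y)"
proof -
  have "inj_on f (seg x y) \<and> f ` seg x y = seg (f x) (f y)"
  proof (cases "x = y")
    case False
    obtain g where g: "continuous_on {0..1::real} g" "inj_on g {0..1}" "g ` {0..1} = seg x y" "g 0 = x" "g 1 = y"
      using is_arcE[OF seg_arc[OF assms(1,2) False]] by blast
    have gT: "g ` {0..1} \<subseteq> T" using g(3) seg_subset assms by blast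
    have cont: "continuous_on {0..1} (f \<circ> g)"
      by (rule continuous_on_compose[OF g(1) continuous_on_subset[OF cont_f gT]])
    have imT: "(f \<circ> g) ` {0..1} \<subseteq> T" using gT fT by auto
    have inj: "inj_on (f \<circ> g) {0..1}"
    proof (rule locally_inj_interior_imp_inj[OF _ cont imT])
      fix t :: real assume t: "0 < t" "t < 1"
      have gt: "g t \<in> T" using gT t by auto
      have "g t \<noteq> x" "g t \<noteq> y" using inj_onD[OF g(2), of t 0] inj_onD[OF g(2), of t 1] g(4,5) t by auto
      moreover have "g t \<in> seg x y" using g(3) t by auto
      ultimately have "g t \<noteq> c" using assms(3) unfolding sep_def by metis
      then obtain U where U: "open U" "g t \<in> U" "inj_on f (T \<inter> U)" using local_homeo[OF gt] by metis
      obtain A where A: "open A" "A \<inter> {0..1} = g -` U \<inter> {0..1}"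
        using g(1) U(1) continuous_on_open_invariant by metis
      have "t \<in> g -` U \<inter> {0..1}" using U(2) t by simp
      then have "t \<in> A" unfolding A(2)[symmetric] by simp
      then obtain e where e: "e > 0" "ball t e \<subseteq> A" using A(1) open_contains_ball by blast
      have sub: "{0..1} \<inter> {t-e<..<t+e} \<subseteq> {0..1} \<inter> ball t e" by (auto simp: dist_real_def)
      have gU: "g s \<in> T \<inter> U" if "s \<in> {0..1} \<inter> {t-e<..<t+e}" for s
      proof -
        have "s \<in> A \<inter> {0..1}" using that sub e(2) by blast
        then have "g s \<in> U" unfolding A(2) by blast
        then show ?thesis using gT that by blast
      qed
      have "inj_on (f \<circ> g) ({0..1} \<inter> {t-e<..<t+e})"
      proof (rule inj_onI)
        fix r s assume rs: "r \<in> {0..1} \<inter> {t-e<..<t+e}" "s \<in> {0..1} \<inter> {t-e<..<t+e}" "(f \<circ> g) r = (f \<circ> g) s"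
        then have "g r = g s" using inj_onD[OF U(3)] gU[OF rs(1)] gU[OF rs(2)] by simp
        then show "r = s" using inj_onD[OF g(2)] rs by blast
      qed
      then show "\<exists>e>0. inj_on (f \<circ> g) ({0..1} \<inter> {t-e<..<t+e})" using e(1) by blast
    qed simp
    have "is_arc ((f \<circ> g) ` {0..1}) ((f \<circ> g) 0) ((f \<circ> g) 1)"
      by (rule is_arcI[OF _ cont inj]) simp
    then have "seg (f x) (f y) = (f \<circ> g) ` {0..1}" using seg_eq imT g(4,5) by simp
    moreover have "(f \<circ> g) ` {0..1} = f ` seg x y" using g(3) by (metis image_comp)
    moreover have "inj_on f (seg x y)" using inj_on_imageI[OF inj] g(3) by simp
    ultimately show ?thesis by simp
  qed simp
  then show "inj_on f (seg x y)" "f ` seg x y = seg (f x) (f y)" by auto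
qed

lemma f_neq: "\<lbrakk>x \<in> T; y \<in> T; \<not> sep x y; x \<noteq> y\<rbrakk> \<Longrightarrow> f x \<noteq> f y"
  using f_inj_seg[of x y] seg_ends[of x y] inj_onD by metis

lemma f_mem: "\<lbrakk>x \<in> T; y \<in> T; \<not> sep x y; w \<in> seg x y\<rbrakk> \<Longrightarrow> f w \<in> seg (f x) (f y)"
  using f_seg[of x y] by blast

text \<open>Strict separation never occurs when one end is \<open>c\<close> itself, so
  \<open>f\<close> is injective on every segment ending at \<open>c\<close>.\<close>

lemma f_eq_fc: "\<lbrakk>x \<in> T; f x = f c\<rbrakk> \<Longrightarrow> x = c"
  using f_neq[of x c] cT by (auto simp: sep_def)

text \<open>\<open>v\<close> may lie far out in the arm. Its segment from \<open>x\<close> and that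
  of a point \<open>y\<close> near \<open>x\<close> start with a common piece, on which
  \<open>f\<close> is injective, so \<open>f v\<close> and \<open>f y\<close> lie in the same arm at
  \<open>f x\<close>.\<close>

lemma arm_f:
  assumes T: "x \<in> T" "v \<in> T" "v \<noteq> x" and ns: "\<not> sep x v"
  shows "local_arm_image T f x (arm x v) = arm (f x) (f v)"
proof -
  have fT': "f x \<in> T" "f v \<in> T" "f v \<noteq> f x" using fT T f_neq[OF T(1,2) ns] by auto
  have ev: "\<forall>\<^sub>F y in at x within arm x v. f y \<in> arm (f x) (f v)"
  proof -
    obtain U where U: "open U" "x \<in> U" "\<And>y. \<lbrakk>y \<in> T; y \<in> U\<rbrakk> \<Longrightarrow> \<not> sep x y"
    proof (cases "x = c")
      case True then show ?thesis using that[of UNIV] by (auto simp: sep_def)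
    next
      case False
      obtain W where W: "open W" "\<And>q. q \<in> T \<Longrightarrow> q \<in> W \<longleftrightarrow> q \<in> arm c x" using arm_openE by metis
      have "x \<in> W" using arm_refl[OF T(1) False] W(2)[OF T(1)] by blast
      moreover have "\<not> sep x y" if "y \<in> T" "y \<in> W" for y
        using mem_arm_iff[OF cT T(1), of y] W(2)[OF that(1)] that(2) by (auto simp: sep_def)
      ultimately show ?thesis using that W(1) by blast
    qed
    have "f y \<in> arm (f x) (f v)" if y: "y \<in> arm x v" "y \<in> U" for y
    proof -
      have yT: "y \<in> T" "y \<noteq> x" using y arm_subset by blast+
      have e: "arm x y = arm x v" using arm_eq[OF y(1)] .
      obtain w where w: "w \<in> T" "w \<noteq> x" "w \<in> seg x y" "w \<in> seg x v"
        using common_germ[OF e T(1) yT(1) T(2) yT(2) T(3)] by metis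
      have ns': "\<not> sep x y" using U(3) yT y(2) by blast
      have "\<not> sep x w"
        using seg_sub1[OF _ w(4) T(1,2)] ns w(4) unfolding sep_def
        by (metis T seg_antisym)
      then have "f w \<noteq> f x" using f_neq[OF T(1) w(1)] w(2) by metis
      moreover have "f w \<in> seg (f x) (f y)" "f w \<in> seg (f x) (f v)"
        using f_mem[OF T(1) yT(1) ns' w(3)] f_mem[OF T(1,2) ns w(4)] by auto
      ultimately have "arm (f x) (f y) = arm (f x) (f v)"
        using arm_seg fT'(1,2) fT[OF yT(1)] by metis
      moreover have "f y \<noteq> f x" using f_neq[OF T(1) yT(1) ns'] yT(2) by metis
      ultimately show ?thesis using arm_refl fT[OF yT(1)] by metis
    qed
    then show ?thesis using U(1,2) unfolding eventually_at_topological by blast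
  qed
  show ?thesis unfolding local_arm_image_def
  proof (rule the_equality)
    show "arm (f x) (f v) \<in> arms T (f x) \<and> (\<forall>\<^sub>F y in at x within arm x v. f y \<in> arm (f x) (f v))"
      using ev arm_in_arms fT' by blast
    fix B assume B: "B \<in> arms T (f x) \<and> (\<forall>\<^sub>F y in at x within arm x v. f y \<in> B)"
    have "\<forall>\<^sub>F y in at x within arm x v. f y \<in> B \<and> f y \<in> arm (f x) (f v)"
      using B ev eventually_conj by blast
    then obtain W where W: "open W" "x \<in> W"
      "\<And>y. \<lbrakk>y \<in> W; y \<noteq> x; y \<in> arm x v\<rbrakk> \<Longrightarrow> f y \<in> B \<and> f y \<in> arm (f x) (f v)"
      unfolding eventually_at_topological by blast
    obtain y where y: "y \<in> T" "y \<noteq> x" "y \<in> W" "arm x y = arm x v"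
      using arm_at[OF T W(1,2)] by metis
    have "y \<in> arm x v" using arm_refl[OF y(1,2)] y(4) by simp
    then have "f y \<in> B" "f y \<in> arm (f x) (f v)" using W(3) y by blast+
    then show "B = arm (f x) (f v)" using arms_mem_eq B arm_eq by metis
  qed
qed

text \<open>\<open>c\<close> lies in the same arm as \<open>v\<close> and can represent it. This
  replacement is the origin of all resets to the critical value.\<close>

lemma arm_f_c: "\<lbrakk>x \<in> T; x \<noteq> c; v \<in> T; v \<noteq> x; c \<in> seg x v\<rbrakk> \<Longrightarrow> local_arm_image T f x (arm x v) = arm (f x) (f c)"
  using arm_f[of x c] arm_seg[of c x v] cT by (auto simp: sep_def)

lemma f_neq_fc: "\<lbrakk>x \<in> T; x \<noteq> c\<rbrakk> \<Longrightarrow> f x \<noteq> f c" using f_eq_fc by blast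

lemma local_arm_image_arms:
  assumes "x \<in> T" "A \<in> arms T x"
  shows "local_arm_image T f x A \<in> arms T (f x)"
proof -
  obtain v where v: "v \<in> T" "v \<noteq> x" "A = arm x v" using assms(2) arms_nonempty by blast
  show ?thesis
  proof (cases "sep x v")
    case True
    then have "local_arm_image T f x A = arm (f x) (f c)" "x \<noteq> c"
      using arm_f_c[OF assms(1) _ v(1,2)] v(3) by (auto simp: sep_def)
    then show ?thesis using arm_in_arms fT cT f_neq_fc[OF assms(1)] by metis
  next
    case False
    then show ?thesis using arm_f[OF assms(1) v(1,2)] v(3) arm_in_arms fT v f_neq[OF assms(1) v(1)] by metis
  qed
qed

text \<open>Points \<open>p\<close> and \<open>q\<close> of two different arms, both near
  \<open>x\<close>, lie on the same side of \<open>c\<close>. Hence \<open>f\<close> is injective on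
  the segment between them, and \<open>f x\<close> separates their images.\<close>

lemma local_arm_image_inj:
  assumes x: "x \<in> T" "x \<noteq> c"
  shows "inj_on (local_arm_image T f x) (arms T x)"
proof (rule inj_onI, rule ccontr)
  fix A B assume AB: "A \<in> arms T x" "B \<in> arms T x" "local_arm_image T f x A = local_arm_image T f x B" "A \<noteq> B"
  obtain u where u: "u \<in> T" "u \<noteq> x" "A = arm x u" using AB(1) arms_nonempty by blast
  obtain v where v: "v \<in> T" "v \<noteq> x" "B = arm x v" using AB(2) arms_nonempty by blast
  obtain W where W: "open W" "\<And>q. q \<in> T \<Longrightarrow> q \<in> W \<longleftrightarrow> q \<in> arm c x" using arm_openE by metis
  have xW: "x \<in> W" using arm_refl[OF x] W(2)[OF x(1)] by blast
  obtain p where p: "p \<in> T" "p \<noteq> x" "p \<in> W" "arm x p = A" using arm_at[OF x(1) u(1,2) W(1) xW] u(3) by metis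
  obtain q where q: "q \<in> T" "q \<noteq> x" "q \<in> W" "arm x q = B" using arm_at[OF x(1) v(1,2) W(1) xW] v(3) by metis
  have pc: "p \<in> arm c x" "q \<in> arm c x" using W(2)[OF p(1)] W(2)[OF q(1)] p(3) q(3) by auto
  have nsx: "\<not> sep x p" "\<not> sep x q" using pc mem_arm_iff[OF cT x(1)] by (auto simp: sep_def)
  have "arm c p = arm c q" using pc arm_eq by metis
  moreover have "p \<noteq> c" "q \<noteq> c" using pc arm_subset by blast+
  ultimately have ns: "\<not> sep p q" using arm_eq_iff[OF cT p(1) q(1)] by (auto simp: sep_def)
  have "x \<in> seg p q" using arm_eq_iff[OF x(1) p(1) q(1) p(2) q(2)] p(4) q(4) AB(4) by blast
  then have "f x \<in> seg (f p) (f q)" using f_mem[OF p(1) q(1) ns] by blast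
  moreover have "f p \<noteq> f x" "f q \<noteq> f x"
    using f_neq[OF x(1) p(1) nsx(1)] f_neq[OF x(1) q(1) nsx(2)] p q by metis+
  ultimately have "arm (f x) (f p) \<noteq> arm (f x) (f q)"
    using arm_eq_iff[OF fT fT fT, OF x(1) p(1) q(1)] by blast
  moreover have "local_arm_image T f x A = arm (f x) (f p)" "local_arm_image T f x B = arm (f x) (f q)"
    using arm_f[OF x(1) p(1,2) nsx(1)] arm_f[OF x(1) q(1,2) nsx(2)] p(4) q(4) by auto
  ultimately show False using AB(3) by simp
qed

lemma card_arms_le: "\<lbrakk>x \<in> T; x \<noteq> c\<rbrakk> \<Longrightarrow> card (arms T x) \<le> card (arms T (f x))"
  by (rule card_inj_on_le[OF local_arm_image_inj]) (use local_arm_image_arms finite_arms in auto)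

section \<open>Arms at the critical value and at the critical point\<close>

lemma crit_orbitI: "(f ^^ k) c \<in> crit_orbit f c" by (auto simp: crit_orbit_def)

text \<open>Off \<open>c\<close> the number of arms does not drop under \<open>f\<close>. If the
  critical value had two arms, its orbit would contain no endpoint before a return to
  \<open>c\<close>, so \<open>c\<close> would be the only endpoint of the tree; but the arm of
  \<open>c\<close> towards \<open>f c\<close> contains one.\<close>

lemma c1_endpoint: "f c \<in> endpoints T"
proof (rule ccontr)
  assume ne: "f c \<notin> endpoints T"
  have "arms T (f c) \<noteq> {}" using arm_in_arms[OF cT, of "f c"] fc by auto
  then have "card (arms T (f c)) \<noteq> 0" using finite_arms by simp
  then have two: "card (arms T (f c)) \<ge> 2" using ne fT[OF cT] unfolding endpoints_def by auto
  have key: "card (arms T ((f ^^ Suc k) c)) \<ge> 2" if "\<And>j. 1 \<le> j \<Longrightarrow> j \<le> k \<Longrightarrow> (f ^^ j) c \<noteq> c" for k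
    using that
  proof (induction k)
    case (Suc k)
    then have "card (arms T ((f ^^ Suc k) c)) \<ge> 2" by simp
    moreover have "card (arms T ((f ^^ Suc k) c)) \<le> card (arms T (f ((f ^^ Suc k) c)))"
      by (rule card_arms_le[OF fpT[OF cT]]) (use Suc.prems[of "Suc k"] in auto)
    ultimately show ?case by simp
  qed (use two in simp)
  have only: "e = c" if e: "e \<in> endpoints T" for e
  proof (rule ccontr)
    assume "e \<noteq> c"
    obtain k0 where "e = (f ^^ k0) c" using e ends_crit by (auto simp: crit_orbit_def)
    then have ex: "\<exists>k. e = (f ^^ k) c" by blast
    \<comment> \<open>The first visit is chosen so that the orbit has not returned to
      \<open>c\<close> before it.\<close>
    define k where "k = (LEAST k. e = (f ^^ k) c)"
    have k: "e = (f ^^ k) c" unfolding k_def using LeastI_ex[OF ex] .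
    have kmin: "e \<noteq> (f ^^ j) c" if "j < k" for j using not_less_Least that unfolding k_def by blast
    obtain k' where k': "k = Suc k'" using k \<open>e \<noteq> c\<close> by (cases k) auto
    have "card (arms T ((f ^^ Suc k') c)) \<ge> 2"
    proof (rule key)
      fix j assume j: "1 \<le> j" "j \<le> k'"
      show "(f ^^ j) c \<noteq> c"
      proof
        assume cc: "(f ^^ j) c = c"
        have "(f ^^ k) c = (f ^^ (k - j)) ((f ^^ j) c)" using j k' by (metis Suc_leD funpow_add le_SucI le_add_diff_inverse2 comp_apply)
        then show False using kmin[of "k - j"] k cc j k' by simp
      qed
    qed
    then show False using e k k' by (simp add: endpoints_def)
  qed
  obtain e where e: "e \<in> endpoints T" "e \<in> arm c (f c)" using arm_has_endpoint[OF cT fT[OF cT] fc] .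
  have "e \<noteq> c" using e(2) arm_subset by blast
  then show False using only e(1) by blast
qed

lemma arm_c1_unique: "\<lbrakk>x \<in> T; y \<in> T; x \<noteq> f c; y \<noteq> f c\<rbrakk> \<Longrightarrow> arm (f c) x = arm (f c) y"
proof -
  assume a: "x \<in> T" "y \<in> T" "x \<noteq> f c" "y \<noteq> f c"
  have "card (arms T (f c)) = 1" using c1_endpoint by (simp add: endpoints_def)
  then obtain A where "arms T (f c) = {A}" using card_1_singletonE by metis
  then show ?thesis using arm_in_arms a by (metis singletonD)
qed

text \<open>Near \<open>c\<close> every arm is mapped into the single arm at the critical value, so
  three arms would give a point \<open>w\<close> with three preimages.\<close>

lemma arms_c_le2: "card (arms T c) \<le> 2"
proof (rule ccontr)
  assume "\<not> card (arms T c) \<le> 2"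
  then have "3 \<le> card (arms T c)" by simp
  then obtain \<A> where \<A>: "\<A> \<subseteq> arms T c" "card \<A> = 3" by (metis obtain_subset_with_card_n)
  then obtain A1 A2 A3 where A: "\<A> = {A1, A2, A3}" "A1 \<noteq> A2" "A1 \<noteq> A3" "A2 \<noteq> A3"
    by (metis card_3_iff)
  have Am: "A1 \<in> arms T c" "A2 \<in> arms T c" "A3 \<in> arms T c" using \<A>(1) unfolding A(1) by auto
  obtain v1 where v1: "v1 \<in> T" "v1 \<noteq> c" "A1 = arm c v1" using arms_nonempty[OF Am(1)] by blast
  obtain v2 where v2: "v2 \<in> T" "v2 \<noteq> c" "A2 = arm c v2" using arms_nonempty[OF Am(2)] by blast
  obtain v3 where v3: "v3 \<in> T" "v3 \<noteq> c" "A3 = arm c v3" using arms_nonempty[OF Am(3)] by blast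
  have fcT: "f c \<in> T" using fT cT by blast
  have fv: "f v1 \<in> T" "f v2 \<in> T" "f v3 \<in> T" "f v1 \<noteq> f c" "f v2 \<noteq> f c" "f v3 \<noteq> f c"
    using v1 v2 v3 fT f_neq_fc by auto
  obtain u where u: "u \<in> T" "u \<noteq> f c" "u \<in> seg (f c) (f v1)" "u \<in> seg (f c) (f v2)"
    using common_germ[OF arm_c1_unique fcT, of "f v1" "f v2"] fv by metis
  obtain w where w: "w \<in> T" "w \<noteq> f c" "w \<in> seg (f c) u" "w \<in> seg (f c) (f v3)"
    using common_germ[OF arm_c1_unique fcT, of u "f v3"] fv u by metis
  have pre: "\<exists>p. p \<in> T \<and> f p = w \<and> arm c p = arm c v \<and> p \<noteq> c" if wv: "w \<in> seg (f c) (f v)" "v \<in> T" "v \<noteq> c" for v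
  proof -
    have "f ` seg c v = seg (f c) (f v)" using f_seg[OF cT wv(2)] by (simp add: sep_def)
    then have "w \<in> f ` seg c v" using wv(1) by simp
    then obtain p where p: "p \<in> seg c v" "f p = w" by (auto simp: image_iff)
    have pc: "p \<noteq> c" using p(2) w(2) by auto
    have "p \<in> T" using seg_in[OF p(1) cT wv(2)] .
    moreover have "arm c p = arm c v" using arm_seg[OF p(1) pc cT wv(2)] .
    ultimately show ?thesis using p(2) pc by blast
  qed
  have w12: "w \<in> seg (f c) (f v1)" "w \<in> seg (f c) (f v2)"
    using seg_sub1[OF w(3) u(3) fcT fv(1)] seg_sub1[OF w(3) u(4) fcT fv(2)] by auto
  obtain p1 where p1: "p1 \<in> T" "f p1 = w" "arm c p1 = A1" using pre[OF w12(1) v1(1,2)] v1(3) by auto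
  obtain p2 where p2: "p2 \<in> T" "f p2 = w" "arm c p2 = A2" using pre[OF w12(2) v2(1,2)] v2(3) by auto
  obtain p3 where p3: "p3 \<in> T" "f p3 = w" "arm c p3 = A3" using pre[OF w(4) v3(1,2)] v3(3) by auto
  have d: "p1 \<noteq> p2" "p1 \<noteq> p3" "p2 \<noteq> p3" using p1 p2 p3 A by auto
  have "card {p1, p2, p3} \<le> card {x \<in> T. f x = w}"
    by (rule card_mono) (use fib[OF w(1)] p1 p2 p3 in auto)
  then show False using fib[OF w(1)] d by simp
qed

section \<open>Symbols, sides and expansivity\<close>

abbreviation "sy \<equiv> tree_symbol T f c"

lemma sym_Star [simp]: "sy x = Star \<longleftrightarrow> x = c"
  by (simp add: tree_symbol_def)

text \<open>As \<open>c\<close> has at most two arms, the points with symbol \<open>Zero\<close>, if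
  there are any, form a single arm as well.\<close>

lemma sym_eq_iff:
  assumes "x \<in> T" "y \<in> T" "x \<noteq> c" "y \<noteq> c"
  shows "sy x = sy y \<longleftrightarrow> c \<notin> seg x y"
proof -
  have fc': "f c \<in> T" "f c \<noteq> c" using fT cT fc by auto
  have sx: "sy z = One \<longleftrightarrow> arm c z = arm c (f c)" "sy z = Zero \<longleftrightarrow> arm c z \<noteq> arm c (f c)"
    if "z \<in> T" "z \<noteq> c" for z
  proof -
    have "z \<in> arm c (f c) \<longleftrightarrow> arm c z = arm c (f c)"
      using arm_refl[OF that] arm_eq[of z c "f c"] by auto
    then show "sy z = One \<longleftrightarrow> arm c z = arm c (f c)" "sy z = Zero \<longleftrightarrow> arm c z \<noteq> arm c (f c)"
      using that(2) unfolding tree_symbol_def arm_def[symmetric] by auto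
  qed
  have "arm c x = arm c y" if n: "arm c x \<noteq> arm c (f c)" "arm c y \<noteq> arm c (f c)"
  proof (rule ccontr)
    assume "arm c x \<noteq> arm c y"
    then have "card {arm c x, arm c y, arm c (f c)} = 3" using n by simp
    moreover have "card {arm c x, arm c y, arm c (f c)} \<le> card (arms T c)"
      by (rule card_mono[OF finite_arms]) (use arm_in_arms assms fc' in auto)
    ultimately show False using arms_c_le2 by simp
  qed
  note same = this
  have cl: "sy z = (if arm c z = arm c (f c) then One else Zero)" if "z \<in> T" "z \<noteq> c" for z
    using sx[OF that] by (cases "arm c z = arm c (f c)") auto
  have "sy x = sy y \<longleftrightarrow> arm c x = arm c y"
    using same unfolding cl[OF assms(1,3)] cl[OF assms(2,4)] by auto
  then show ?thesis using arm_eq_iff[OF cT assms] by blast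
qed

lemma sep_iff: "\<lbrakk>x \<in> T; y \<in> T\<rbrakk> \<Longrightarrow> sep x y \<longleftrightarrow> x \<noteq> c \<and> y \<noteq> c \<and> sy x \<noteq> sy y"
  using sym_eq_iff unfolding sep_def by blast

lemma c_in_seg: "\<lbrakk>x \<in> T; y \<in> T; sy x \<noteq> sy y\<rbrakk> \<Longrightarrow> c \<in> seg x y"
  using sym_eq_iff[of x y] seg_ends[of x y] by (cases "x = c"; cases "y = c") auto

text \<open>A half of the tree on which \<open>f\<close> is injective; adding \<open>c\<close> makes
  it closed.\<close>

definition side :: "symbol \<Rightarrow> 'a set" where
  "side a = {x \<in> T. sy x = a \<or> x = c}"

lemma side_T: "x \<in> side a \<Longrightarrow> x \<in> T" by (simp add: side_def)

lemma side_sep: "\<lbrakk>x \<in> side a; y \<in> side a\<rbrakk> \<Longrightarrow> \<not> sep x y"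
  by (auto simp: side_def sep_iff)

lemma side_convex:
  assumes "x \<in> side a" "y \<in> side a" "w \<in> seg x y"
  shows "w \<in> side a"
proof -
  have T: "x \<in> T" "y \<in> T" "w \<in> T" using assms side_T seg_in by blast+
  show ?thesis
  proof (cases "w = c")
    case True then show ?thesis using cT by (simp add: side_def)
  next
    case False
    have "sy w = a"
    proof (rule ccontr)
      assume n: "sy w \<noteq> a"
      then have "c \<in> seg x w" "c \<in> seg w y"
        using assms(1,2) T c_in_seg[of x w] c_in_seg[of w y] seg_ends by (auto simp: side_def)
      then have "c \<in> seg x w \<inter> seg w y" by simp
      then show False using seg_split(2)[OF assms(3) T(1,2)] False by simp
    qed
    then show ?thesis using T by (simp add: side_def)
  qed
qed

lemma sym_open:
  assumes "x \<in> T" "x \<noteq> c"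
  obtains W where "open W" "x \<in> W" "\<And>y. \<lbrakk>y \<in> T; y \<in> W\<rbrakk> \<Longrightarrow> sy y = sy x"
proof -
  obtain W where W: "open W" "\<And>q. q \<in> T \<Longrightarrow> q \<in> W \<longleftrightarrow> q \<in> arm c x" using arm_openE by metis
  have "x \<in> W" using arm_refl[OF assms] W(2)[OF assms(1)] by blast
  moreover have "sy y = sy x" if "y \<in> T" "y \<in> W" for y
  proof -
    have "y \<in> arm c x" using W(2)[OF that(1)] that(2) by blast
    then have "y \<noteq> c" "c \<notin> seg x y" using mem_arm_iff[OF cT assms(1)] by auto
    then show ?thesis using sym_eq_iff assms that(1) by metis
  qed
  ultimately show ?thesis using that W(1) by blast
qed

lemma closed_side:
  assumes "a \<noteq> Star" shows "closed (side a)"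
proof -
  have "open (- side a)"
  proof (subst open_subopen, intro ballI)
    fix x assume x: "x \<in> - side a"
    show "\<exists>A. open A \<and> x \<in> A \<and> A \<subseteq> - side a"
    proof (cases "x \<in> T")
      case False
      then show ?thesis using closed_T side_T by (intro exI[of _ "- T"]) (auto simp: closed_def)
    next
      case True
      then have n: "x \<noteq> c" "sy x \<noteq> a" using x by (auto simp: side_def)
      obtain W where W: "open W" "x \<in> W" "\<And>y. \<lbrakk>y \<in> T; y \<in> W\<rbrakk> \<Longrightarrow> sy y = sy x"
        using sym_open[OF True n(1)] by metis
      have "W \<subseteq> - side a"
      proof
        fix y assume y: "y \<in> W"
        show "y \<in> - side a"
        proof
          assume "y \<in> side a"
          then have "sy y = a \<or> sy y = Star" "sy y = sy x" using W(3)[OF side_T y] by (auto simp: side_def)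
          then show False using n by auto
        qed
      qed
      then show ?thesis using W by blast
    qed
  qed
  then show ?thesis by (simp add: closed_def)
qed

definition V :: "'a set" where "V = branch_points T \<union> crit_orbit f c"

lemma branch_T: "x \<in> branch_points T \<Longrightarrow> x \<in> T" by (simp add: branch_points_def)

lemma c_not_branch: "c \<notin> branch_points T" using arms_c_le2 by (simp add: branch_points_def)

lemma V_T: "x \<in> V \<Longrightarrow> x \<in> T"
  using fpT[OF cT] by (auto simp: V_def crit_orbit_def branch_T)

lemma f_branch:
  assumes "x \<in> branch_points T" shows "f x \<in> branch_points T"
proof -
  have "x \<in> T" "x \<noteq> c" using assms branch_T c_not_branch by auto
  then show ?thesis using card_arms_le[of x] fT[of x] assms by (simp add: branch_points_def)
qed

lemma fp_branch: "x \<in> branch_points T \<Longrightarrow> (f ^^ n) x \<in> branch_points T"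
  by (induction n) (auto intro: f_branch)

lemma crit_V: "(f ^^ k) c \<in> V" using crit_orbitI by (simp add: V_def)

text \<open>As long as the symbols agree, the images of the segment are the segments between the
  images of its ends, and none of them contains the critical point; expansivity forbids this
  forever.\<close>

lemma expand:
  assumes "x \<in> V" "y \<in> V" "x \<noteq> y"
  shows "\<exists>n. sy ((f ^^ n) x) \<noteq> sy ((f ^^ n) y)"
proof (rule ccontr)
  assume "\<not> ?thesis"
  then have eq: "sy ((f ^^ n) x) = sy ((f ^^ n) y)" for n by blast
  have T: "x \<in> T" "y \<in> T" using assms V_T by auto
  have ns: "\<not> sep ((f ^^ n) x) ((f ^^ n) y)" for n
    using eq[of n] sep_iff fpT T by blast
  have 1: "(f ^^ n) x \<noteq> (f ^^ n) y" for n
  proof (induction n)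
    case (Suc n)
    then show ?case using f_neq[OF fpT[OF T(1)] fpT[OF T(2)] ns] by simp
  qed (use assms in simp)
  have 2: "(f ^^ n) ` seg x y = seg ((f ^^ n) x) ((f ^^ n) y)" for n
  proof (induction n)
    case (Suc n)
    have "(f ^^ Suc n) ` seg x y = f ` ((f ^^ n) ` seg x y)" by (simp add: image_comp)
    then show ?case using Suc f_seg[OF fpT[OF T(1)] fpT[OF T(2)] ns] by simp
  qed simp
  obtain n where "c \<in> (f ^^ n) ` seg x y"
    using hub assms unfolding hubbard_tree_def V_def by blast
  then have "c \<in> seg ((f ^^ n) x) ((f ^^ n) y)" using 2 by simp
  moreover have "(f ^^ n) x \<noteq> c \<and> (f ^^ n) y \<noteq> c"
    using eq[of n] 1[of n] sym_Star by metis
  ultimately show False using ns[of n] by (simp add: sep_def)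
qed

text \<open>The pointer dynamics: if \<open>z\<close> has symbol \<open>a\<close>, the arm at \<open>z\<close> containing \<open>P\<close> is mapped to the
  arm at \<open>f z\<close> containing \<open>nxt a P\<close>, since \<open>[z, P]\<close> either avoids the critical point or
  may be cut there.\<close>

definition nxt :: "symbol \<Rightarrow> 'a \<Rightarrow> 'a" where
  "nxt a P = (if sy P = a then f P else f c)"

lemma nxt_T: "P \<in> T \<Longrightarrow> nxt a P \<in> T" by (simp add: nxt_def fT cT)

lemma arm_nxt:
  assumes "z \<in> T" "z \<noteq> c" "P \<in> T" "P \<noteq> z"
  shows "local_arm_image T f z (arm z P) = arm (f z) (nxt (sy z) P)" "nxt (sy z) P \<noteq> f z"
proof -
  show "local_arm_image T f z (arm z P) = arm (f z) (nxt (sy z) P)"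
  proof (cases "sy P = sy z")
    case True
    then show ?thesis using arm_f[OF assms(1,3,4)] sep_iff assms by (auto simp: nxt_def)
  next
    case False
    then show ?thesis using arm_f_c[OF assms] c_in_seg[OF assms(1,3)] by (auto simp: nxt_def)
  qed
  show "nxt (sy z) P \<noteq> f z"
  proof (cases "sy P = sy z")
    case True
    then have "\<not> sep z P" using sep_iff[OF assms(1,3)] by simp
    then show ?thesis using f_neq[OF assms(1,3)] assms(4) True by (metis nxt_def)
  next
    case False
    then show ?thesis using f_neq_fc[OF assms(1,2)] by (simp add: nxt_def)
  qed
qed

text \<open>The steering sequence is a parameter and not the itinerary of a point, so that pointers
  can also be steered by a word for which a point is still being sought.\<close>

fun ptr :: "(nat \<Rightarrow> symbol) \<Rightarrow> 'a \<Rightarrow> nat \<Rightarrow> 'a" where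
  "ptr \<tau> v 0 = v"
| "ptr \<tau> v (Suc n) = nxt (\<tau> n) (ptr \<tau> v n)"

lemma ptr_T: "v \<in> T \<Longrightarrow> ptr \<tau> v n \<in> T" by (induction n) (auto intro: nxt_T)

lemma ptr_add: "ptr \<tau> v (m + n) = ptr (\<lambda>i. \<tau> (m + i)) (ptr \<tau> v m) n"
  by (induction n) auto

lemma ptr_follow: "(\<And>i. i < n \<Longrightarrow> sy ((f ^^ i) v) = \<tau> i) \<Longrightarrow> ptr \<tau> v n = (f ^^ n) v"
  by (induction n) (auto simp: nxt_def)

definition itin :: "'a \<Rightarrow> nat \<Rightarrow> symbol" where "itin z n = sy ((f ^^ n) z)"

lemma itin_shift: "itin ((f ^^ k) z) n = itin z (k + n)"
  unfolding itin_def by (metis add.commute comp_apply funpow_add)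

abbreviation "F \<equiv> local_arm_map T f"

lemma F_arm: "F (z, A) = (f z, local_arm_image T f z A)" by (simp add: local_arm_map_def)

lemma fst_Fn: "fst ((F ^^ n) a) = (f ^^ n) (fst a)"
  by (induction n) (auto simp: local_arm_map_def split: prod.splits)

lemma F_ptr:
  assumes "z \<in> T" "\<And>n. (f ^^ n) z \<noteq> c" "P \<in> T" "P \<noteq> z"
  shows "(F ^^ n) (z, arm z P) = ((f ^^ n) z, arm ((f ^^ n) z) (ptr (itin z) P n))"
    and ptr_neq: "ptr (itin z) P n \<noteq> (f ^^ n) z"
proof -
  have "(F ^^ n) (z, arm z P) = ((f ^^ n) z, arm ((f ^^ n) z) (ptr (itin z) P n)) \<and> ptr (itin z) P n \<noteq> (f ^^ n) z"
  proof (induction n)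
    case (Suc n)
    have e: "itin z n = sy ((f ^^ n) z)" by (simp add: itin_def)
    show ?case
      using Suc arm_nxt[of "(f ^^ n) z" "ptr (itin z) P n"] fpT[OF assms(1)] assms(2) ptr_T[OF assms(3)]
      by (simp add: F_arm e)
  qed (use assms in simp)
  then show "(F ^^ n) (z, arm z P) = ((f ^^ n) z, arm ((f ^^ n) z) (ptr (itin z) P n))"
    "ptr (itin z) P n \<noteq> (f ^^ n) z" by auto
qed

end

section \<open>Characteristic points\<close>

text \<open>Exactness of the period is demanded of itineraries. Expansivity distinguishes
  itineraries only for branch points and critical orbit points, while the locale is also used for a
  periodic point not yet known to be a branch point.\<close>

locale periodic_point = hubbard T f c for T :: "'a::t2_space set" and f c +
  fixes z :: 'a and m :: nat
  assumes zT: "z \<in> T" and m: "m \<ge> 1" and per: "(f ^^ m) z = z"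
    and nc: "\<And>n. (f ^^ n) z \<noteq> c"
    and exact: "\<And>k. \<lbrakk>1 \<le> k; k < m\<rbrakk> \<Longrightarrow> itin ((f ^^ k) z) \<noteq> itin z"
begin

definition orb :: "'a set" where "orb = {(f ^^ k) z | k. k < m}"

lemma per_mult: "(f ^^ (m * k)) z = z"
proof (induction k)
  case (Suc k)
  have "(f ^^ (m * Suc k)) z = (f ^^ m) ((f ^^ (m * k)) z)" by (simp add: funpow_add)
  then show ?case using Suc per by simp
qed simp

lemma per_mod: "(f ^^ n) z = (f ^^ (n mod m)) z"
proof -
  have "(f ^^ n) z = (f ^^ (n mod m + m * (n div m))) z" by simp
  also have "\<dots> = (f ^^ (n mod m)) ((f ^^ (m * (n div m))) z)" by (simp only: funpow_add comp_apply)
  finally show ?thesis by (simp add: per_mult)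
qed

lemma orbI: "(f ^^ n) z \<in> orb"
  unfolding orb_def using per_mod[of n] m mod_less_divisor[of m n] by auto

lemma z_orb: "z \<in> orb" using orbI[of 0] by simp

lemma finite_orb: "finite orb" by (simp add: orb_def)

lemma orb_T: "w \<in> orb \<Longrightarrow> w \<in> T" using fpT[OF zT] by (auto simp: orb_def)

lemma orb_f: "w \<in> orb \<Longrightarrow> f w \<in> orb"
  using orbI[of "Suc k" for k] by (auto simp: orb_def)

lemma orb_fp: "w \<in> orb \<Longrightarrow> (f ^^ n) w \<in> orb"
  by (induction n) (auto intro: orb_f)

lemma orb_nc: "w \<in> orb \<Longrightarrow> (f ^^ n) w \<noteq> c"
proof -
  assume "w \<in> orb"
  then obtain k where "(f ^^ n) w = (f ^^ k) z" using orb_fp[of w n] by (auto simp: orb_def)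
  then show ?thesis using nc by simp
qed

lemma orb_not_c: "w \<in> orb \<Longrightarrow> w \<noteq> c"
  using orb_nc[of w 0] by simp

lemma orb_per: "w \<in> orb \<Longrightarrow> (f ^^ m) w = w"
proof -
  assume "w \<in> orb"
  then obtain k where k: "w = (f ^^ k) z" by (auto simp: orb_def)
  have "(f ^^ m) w = (f ^^ (m + k)) z" unfolding k by (simp add: funpow_add)
  also have "\<dots> = (f ^^ (k + m)) z" by (simp only: add.commute)
  also have "\<dots> = w" unfolding k using per by (simp add: funpow_add)
  finally show ?thesis .
qed

lemma orb_back: "w \<in> orb \<Longrightarrow> f ((f ^^ (m - 1)) w) = w"
  using orb_per[of w] m by (cases m) auto

lemma orb_inj: "inj_on f orb"
proof (rule inj_onI)
  fix u v assume a: "u \<in> orb" "v \<in> orb" "f u = f v"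
  have "(f ^^ m) u = (f ^^ m) v"
    using a(3) m by (cases m) (auto simp: funpow_swap1)
  then show "u = v" using orb_per a by simp
qed

text \<open>The only preimage of the critical value is \<open>c\<close>, which the orbit
  avoids.\<close>

lemma orb_not_c1: "w \<in> orb \<Longrightarrow> w \<noteq> f c"
proof
  assume w: "w \<in> orb" "w = f c"
  then have "(f ^^ (m - 1)) w = c" using orb_back[OF w(1)] f_eq_fc orb_fp orb_T by metis
  then show False using orb_nc[OF w(1)] by blast
qed

lemma exact_neq: "\<lbrakk>1 \<le> k; k < m\<rbrakk> \<Longrightarrow> (f ^^ k) z \<noteq> z" using exact by metis

lemma orb_reach:
  assumes "u \<in> orb" "v \<in> orb" obtains n where "n < m" "v = (f ^^ n) u"
proof -
  obtain i where i: "i < m" "u = (f ^^ i) z" using assms by (auto simp: orb_def)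
  obtain j where j: "j < m" "v = (f ^^ j) z" using assms by (auto simp: orb_def)
  have "(f ^^ ((j + m - i) mod m)) u = (f ^^ ((j + m - i) mod m + i)) z" by (simp add: i funpow_add)
  also have "\<dots> = (f ^^ (((j + m - i) mod m + i) mod m)) z" using per_mod by blast
  also have "((j + m - i) mod m + i) mod m = j" using i j by (simp add: mod_add_left_eq)
  finally show ?thesis using that[of "(j + m - i) mod m"] j m by simp
qed

lemma orb_itin_inj:
  assumes "u \<in> orb" "v \<in> orb" "itin u = itin v" shows "u = v"
proof -
  obtain i where i: "i < m" "z = (f ^^ i) u" using orb_reach[OF assms(1) z_orb] .
  obtain n where n: "n < m" "v = (f ^^ n) u" using orb_reach[OF assms(1,2)] .
  have "itin ((f ^^ n) z) = itin z"
  proof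
    fix k
    have "itin ((f ^^ n) z) k = itin u (n + i + k)"
      unfolding i(2) by (simp add: itin_shift funpow_add ac_simps)
    also have "\<dots> = itin v (i + k)" by (simp add: n(2) itin_shift ac_simps)
    also have "\<dots> = itin u (i + k)" using assms(3) by simp
    also have "\<dots> = itin z k" by (simp add: i(2) itin_shift)
    finally show "itin ((f ^^ n) z) k = itin z k" .
  qed
  then have "n = 0" using exact[of n] n(1) by (cases n) auto
  then show ?thesis using n by simp
qed

section \<open>The permutation of the local arms along the orbit\<close>

definition SA :: "('a \<times> 'a set) set" where "SA = Sigma orb (arms T)"

lemma finite_SA: "finite SA" unfolding SA_def using finite_orb finite_arms by blast

lemma SA_iff: "(w, A) \<in> SA \<longleftrightarrow> w \<in> orb \<and> A \<in> arms T w" by (simp add: SA_def)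

lemma F_SA: "a \<in> SA \<Longrightarrow> F a \<in> SA"
  using local_arm_image_arms orb_f orb_T by (cases a) (auto simp: SA_iff F_arm)

lemma Fn_SA: "a \<in> SA \<Longrightarrow> (F ^^ n) a \<in> SA" by (induction n) (auto intro: F_SA)

lemma F_inj: "inj_on F SA"
proof (rule inj_onI)
  fix a b assume ab: "a \<in> SA" "b \<in> SA" "F a = F b"
  obtain u A where a: "a = (u, A)" by fastforce
  obtain v B where b: "b = (v, B)" by fastforce
  have uv: "u \<in> orb" "v \<in> orb" "A \<in> arms T u" "B \<in> arms T v" using ab a b by (auto simp: SA_iff)
  have "f u = f v" using ab(3) a b by (simp add: F_arm)
  then have "u = v" using inj_onD[OF orb_inj] uv by blast
  moreover have "local_arm_image T f u A = local_arm_image T f v B" using ab(3) a b by (simp add: F_arm)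
  ultimately have "A = B"
    using inj_onD[OF local_arm_image_inj[OF orb_T[OF uv(1)] orb_not_c[OF uv(1)]]] uv by simp
  then show "a = b" using a b \<open>u = v\<close> by simp
qed

lemma F_onto: "F ` SA = SA"
  using endo_inj_surj[OF finite_SA _ F_inj] F_SA by blast

lemma Fn_inj: "inj_on (F ^^ n) SA"
proof (induction n)
  case (Suc n)
  have "(F ^^ n) ` SA \<subseteq> SA" using Fn_SA by blast
  then show ?case using comp_inj_on[OF Suc inj_on_subset[OF F_inj]] by (simp add: comp_def)
qed simp

text \<open>The lower bound \<open>N\<close> makes it possible to subtract a given time from the
  return time.\<close>

lemma Fn_return:
  assumes "a \<in> SA" obtains n where "n \<ge> N" "(F ^^ n) a = a"
proof -
  have "\<not> inj_on (\<lambda>n. (F ^^ n) a) (UNIV :: nat set)"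
  proof
    assume "inj_on (\<lambda>n. (F ^^ n) a) (UNIV :: nat set)"
    moreover have "range (\<lambda>n. (F ^^ n) a) \<subseteq> SA" using Fn_SA assms by blast
    ultimately show False using finite_SA finite_subset finite_imageD infinite_UNIV_nat by metis
  qed
  then obtain p q :: nat where pq: "p \<noteq> q" "(F ^^ p) a = (F ^^ q) a"
    unfolding inj_on_def by blast
  define i j where "i = min p q" and "j = max p q"
  have ij: "i < j" "(F ^^ i) a = (F ^^ j) a"
    using pq by (auto simp: i_def j_def min_def max_def)
  have "(F ^^ i) ((F ^^ (j - i)) a) = (F ^^ (i + (j - i))) a" by (simp only: funpow_add comp_apply)
  then have "(F ^^ i) ((F ^^ (j - i)) a) = (F ^^ i) a" using ij by simp
  then have 1: "(F ^^ (j - i)) a = a" using inj_onD[OF Fn_inj _ Fn_SA[OF assms] assms] by blast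
  have "(F ^^ ((j - i) * k)) a = a" for k
  proof (induction k)
    case (Suc k)
    have "(F ^^ ((j - i) * Suc k)) a = (F ^^ (j - i)) ((F ^^ ((j - i) * k)) a)" by (simp add: funpow_add)
    then show ?case using Suc 1 by simp
  qed simp
  moreover have "N \<le> (j - i) * N" using ij(1) by (cases "j - i") auto
  ultimately show ?thesis using that by blast
qed

lemma image_c:
  assumes "w \<in> orb" "A \<in> arms T w" "c \<in> A"
  shows "local_arm_image T f w A = arm (f w) (f c)"
proof -
  have "A = arm w c" using arms_mem_eq[OF assms(2,3)] .
  then show ?thesis using arm_f[OF orb_T[OF assms(1)] cT] orb_not_c[OF assms(1)] by (auto simp: sep_def)
qed

text \<open>Seen forwards: an arm containing \<open>c\<close> goes to the arm of the critical value,
  and an arm containing an orbit point \<open>v\<close> but not \<open>c\<close> goes to the arm of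
  the orbit point \<open>f v\<close>.\<close>

lemma pull_free:
  assumes w: "w \<in> orb" "A \<in> arms T w" and B: "local_arm_image T f w A \<inter> orb = {}"
    "local_arm_image T f w A \<noteq> arm (f w) (f c)"
  shows "A \<inter> orb = {} \<and> c \<notin> A"
proof -
  have cA: "c \<notin> A" using image_c[OF w] B(2) by blast
  have "v \<notin> A" if v: "v \<in> orb" for v
  proof
    assume vA: "v \<in> A"
    have A: "A = arm w v" using arms_mem_eq[OF w(2) vA] .
    have wv: "w \<in> T" "v \<in> T" using orb_T w(1) v by auto
    have vw: "v \<noteq> w" using vA arm_subset[of w v] A by blast
    have ns: "\<not> sep w v"
    proof
      assume "sep w v"
      then have "arm w c = arm w v" using arm_seg[of c w v] wv by (auto simp: sep_def)
      then show False using cA A arm_refl[OF cT] orb_not_c[OF w(1)] by metis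
    qed
    have "local_arm_image T f w A = arm (f w) (f v)" using arm_f[OF wv vw ns] A by simp
    moreover have "f v \<noteq> f w" using f_neq[OF wv ns] vw by metis
    ultimately have "f v \<in> local_arm_image T f w A" using arm_refl[OF fT[OF wv(2)]] by simp
    then show False using B(1) orb_f[OF v] by blast
  qed
  then show ?thesis using cA by blast
qed

text \<open>An orbit point farthest out from \<open>z\<close> can have other orbit points only in
  its arm back to \<open>z\<close>.\<close>

lemma hull_end: "\<exists>w\<in>orb. \<exists>B. \<forall>A\<in>arms T w. A \<noteq> B \<longrightarrow> A \<inter> orb = {}"
proof -
  obtain x where x: "x \<in> orb" "\<And>y. \<lbrakk>y \<in> orb; x \<in> seg z y\<rbrakk> \<Longrightarrow> y = x"
    using maximal_exists[OF finite_imp_closed[OF finite_orb] _ _ zT] orb_T z_orb by (metis empty_iff subsetI)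
  have xT: "x \<in> T" using orb_T x(1) .
  have "A \<inter> orb = {}" if A: "A \<in> arms T x" "A \<noteq> arm x z" for A
  proof (rule ccontr)
    assume "A \<inter> orb \<noteq> {}"
    then obtain v where v: "v \<in> A" "v \<in> orb" by blast
    have vT: "v \<in> T" using orb_T v(2) .
    have Av: "A = arm x v" using arms_mem_eq[OF A(1) v(1)] .
    have vx: "v \<noteq> x" using v(1) Av arm_subset[of x v] by blast
    have "x \<in> seg z v"
    proof (cases "x = z")
      case True then show ?thesis using seg_ends[OF zT vT] by simp
    next
      case False
      then show ?thesis using arm_eq_iff[OF xT zT vT] vx A(2) Av by auto
    qed
    then show False using x(2)[OF v(2)] vx by blast
  qed
  then show ?thesis using x(1) by blast
qed

text \<open>Free arms, i.e. arms without points of the orbit, are pulled back to free arms unless they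
  contain the critical value. Since no cycle of arms avoids the critical point, some free arm
  contains the critical value.\<close>

lemma char_exists:
  assumes two: "\<And>w. w \<in> orb \<Longrightarrow> card (arms T w) \<ge> 2"
    and H: "\<And>a. a \<in> SA \<Longrightarrow> \<exists>n. c \<in> snd ((F ^^ n) a) \<or> snd ((F ^^ n) a) \<inter> orb \<noteq> {}"
  obtains w where "w \<in> orb" "arm w (f c) \<inter> orb = {}"
proof -
  have "\<exists>w\<in>orb. arm w (f c) \<inter> orb = {}"
  proof (rule ccontr)
    assume "\<not> ?thesis"
    then have no: "arm w (f c) \<inter> orb \<noteq> {}" if "w \<in> orb" for w using that by blast
    \<comment> \<open>\<open>Fr\<close> are the free arms and \<open>Fr'\<close> the arms with free
      image. \<open>Fr'\<close> is contained in \<open>Fr\<close> and has as many elements, so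
      freeness is invariant and a free arm avoids \<open>c\<close> and the orbit forever, against
      \<open>H\<close>.\<close>
    define Fr where "Fr = {a \<in> SA. snd a \<inter> orb = {}}"
    define Fr' where "Fr' = {a \<in> SA. F a \<in> Fr}"
    have key: "a \<in> Fr \<and> c \<notin> snd a" if a: "a \<in> Fr'" for a
    proof -
      obtain w A where wA: "a = (w, A)" by fastforce
      have w: "w \<in> orb" "A \<in> arms T w" "local_arm_image T f w A \<inter> orb = {}"
        using a wA by (auto simp: Fr'_def Fr_def SA_iff F_arm)
      have "local_arm_image T f w A \<noteq> arm (f w) (f c)" using no[OF orb_f[OF w(1)]] w(3) by metis
      then show ?thesis using pull_free[OF w] w wA by (simp add: Fr_def SA_iff)
    qed
    have fin: "finite Fr" using finite_SA by (simp add: Fr_def)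
    have im: "F ` Fr' = Fr"
    proof
      show "F ` Fr' \<subseteq> Fr" by (auto simp: Fr'_def)
      show "Fr \<subseteq> F ` Fr'"
      proof
        fix b assume b: "b \<in> Fr"
        then have "b \<in> F ` SA" using F_onto by (simp add: Fr_def)
        then obtain a where "a \<in> SA" "b = F a" by blast
        then show "b \<in> F ` Fr'" using b by (auto simp: Fr'_def)
      qed
    qed
    have "Fr' \<subseteq> Fr" using key by blast
    moreover have "card Fr' = card Fr"
      using card_image[OF inj_on_subset[OF F_inj], of Fr'] im by (simp add: Fr'_def)
    ultimately have eq: "Fr' = Fr" using card_subset_eq[OF fin] by blast
    obtain w B where wB: "w \<in> orb" "\<And>A. \<lbrakk>A \<in> arms T w; A \<noteq> B\<rbrakk> \<Longrightarrow> A \<inter> orb = {}" using hull_end by blast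
    have "\<not> arms T w \<subseteq> {B}"
    proof
      assume "arms T w \<subseteq> {B}"
      then have "card (arms T w) \<le> card {B}" by (intro card_mono) auto
      then show False using two[OF wB(1)] by simp
    qed
    then obtain A where A: "A \<in> arms T w" "A \<noteq> B" by blast
    then have a: "(w, A) \<in> Fr" using wB by (auto simp: Fr_def SA_iff)
    have it: "(F ^^ n) (w, A) \<in> Fr" for n
    proof (induction n)
      case (Suc n) then show ?case using im eq by auto
    qed (use a in simp)
    have "(w, A) \<in> SA" using a by (simp add: Fr_def)
    from H[OF this] obtain n where "c \<in> snd ((F ^^ n) (w, A)) \<or> snd ((F ^^ n) (w, A)) \<inter> orb \<noteq> {}" ..
    moreover have "(F ^^ n) (w, A) \<in> Fr'" using it eq by simp
    ultimately show False using key[of "(F ^^ n) (w, A)"] by (auto simp: Fr_def)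
  qed
  then show ?thesis using that by blast
qed

text \<open>The arm contains an endpoint \<open>e\<close> of the tree, which is on the critical
  orbit and so has another itinerary than \<open>w\<close>. Until the first difference the arm
  follows \<open>e\<close>; at that time \<open>c\<close> lies between \<open>e\<close> and
  \<open>w\<close>.\<close>

lemma arm_hits_c:
  assumes b: "z \<in> branch_points T" and a: "a \<in> SA"
  shows "\<exists>n. c \<in> snd ((F ^^ n) a)"
proof -
  obtain w A where wA: "a = (w, A)" by fastforce
  have w: "w \<in> orb" "A \<in> arms T w" using a wA by (auto simp: SA_iff)
  have wT: "w \<in> T" using orb_T w(1) .
  obtain v where v: "v \<in> T" "v \<noteq> w" "A = arm w v" using w(2) arms_nonempty by blast
  obtain e where e: "e \<in> endpoints T" "e \<in> arm w v" using arm_has_endpoint[OF wT v(1,2)] .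
  have eV: "e \<in> V" using ends_crit e(1) by (auto simp: V_def)
  have eT: "e \<in> T" using V_T eV .
  have ew: "e \<noteq> w" using e(2) arm_subset[of w v] by blast
  have Ae: "A = arm w e" using arm_eq[OF e(2)] v(3) by simp
  have wV: "w \<in> V" using w(1) fp_branch[OF b] by (auto simp: orb_def V_def)
  have ex: "\<exists>n. sy ((f ^^ n) w) \<noteq> sy ((f ^^ n) e)" using expand[OF wV eV] ew by metis
  define n where "n = (LEAST n. sy ((f ^^ n) w) \<noteq> sy ((f ^^ n) e))"
  have n1: "sy ((f ^^ n) w) \<noteq> sy ((f ^^ n) e)" unfolding n_def using LeastI_ex[OF ex] .
  have n2: "sy ((f ^^ i) e) = itin w i" if "i < n" for i
    using not_less_Least[OF that[unfolded n_def]] by (simp add: itin_def)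
  have p: "ptr (itin w) e n = (f ^^ n) e" using ptr_follow n2 by blast
  have nw: "(f ^^ k) w \<noteq> c" for k using orb_nc[OF w(1)] .
  have Fn: "(F ^^ n) a = ((f ^^ n) w, arm ((f ^^ n) w) ((f ^^ n) e))" "(f ^^ n) e \<noteq> (f ^^ n) w"
    using F_ptr[OF wT nw eT ew, of n] ptr_neq[OF wT nw eT ew, of n] p wA Ae by auto
  have "c \<in> seg ((f ^^ n) w) ((f ^^ n) e)" using c_in_seg[OF fpT[OF wT] fpT[OF eT] n1] .
  then have "arm ((f ^^ n) w) c = arm ((f ^^ n) w) ((f ^^ n) e)"
    using arm_seg nw[of n] fpT[OF wT] fpT[OF eT] by metis
  moreover have "c \<in> arm ((f ^^ n) w) c" using arm_refl[OF cT] nw by metis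
  ultimately show ?thesis using Fn(1) by (metis snd_conv)
qed

end

section \<open>The first return map at a characteristic point\<close>

locale char_point = periodic_point T f c z m for T :: "'a::t2_space set" and f c z m +
  assumes free1: "arm z (f c) \<inter> orb = {}"
begin

abbreviation "G0 \<equiv> arm z c"
abbreviation "G1 \<equiv> arm z (f c)"

lemma z_c1: "z \<noteq> f c" using orb_not_c1 z_orb by blast

lemma z_c: "z \<noteq> c" using nc[of 0] by simp

lemma G0_arm: "G0 \<in> arms T z" using arm_in_arms[OF cT] z_c by metis
lemma G1_arm: "G1 \<in> arms T z" using arm_in_arms[OF fcT] z_c1 by metis

lemma z_in_seg: "w \<in> orb \<Longrightarrow> z \<in> seg w (f c)"
proof (cases "w = z")
  case False
  assume w: "w \<in> orb"
  have "w \<notin> G1" using free1 w by blast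
  then show ?thesis
    using mem_arm_iff[OF zT fcT, of w] False z_c1 orb_T[OF w] seg_sym[OF orb_T[OF w] fcT] by auto
qed (use seg_ends[OF zT fcT] in simp)

lemma free_c1_unique:
  assumes "w \<in> orb" "arm w (f c) \<inter> orb = {}" shows "w = z"
proof (rule ccontr)
  assume n: "w \<noteq> z"
  have wT: "w \<in> T" using orb_T assms by blast
  have "z \<notin> arm w (f c)" using assms(2) z_orb by blast
  then have "w \<in> seg (f c) z"
    using mem_arm_iff[OF wT fcT, of z] n zT orb_not_c1[OF assms(1)] by auto
  moreover have "z \<in> seg (f c) w" using z_in_seg[OF assms(1)] seg_sym[OF wT fcT] by simp
  ultimately show False using seg_antisym[of z "f c" w] fcT wT n by blast
qed

definition nf :: "'a \<Rightarrow> nat" where "nf w = card {A \<in> arms T w. A \<inter> orb \<noteq> {}}"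

text \<open>A non-free arm with free image would, by \<open>pull_free\<close>, be mapped to the arm
  of the critical value, and that arm is free only at \<open>z\<close>.\<close>

lemma nf_mono:
  assumes w: "w \<in> orb" "f w \<noteq> z" shows "nf w \<le> nf (f w)"
  unfolding nf_def
proof (rule card_inj_on_le)
  show "inj_on (local_arm_image T f w) {A \<in> arms T w. A \<inter> orb \<noteq> {}}"
    by (rule inj_on_subset[OF local_arm_image_inj[OF orb_T[OF w(1)] orb_not_c[OF w(1)]]]) auto
  show "local_arm_image T f w ` {A \<in> arms T w. A \<inter> orb \<noteq> {}} \<subseteq> {A \<in> arms T (f w). A \<inter> orb \<noteq> {}}"
  proof
    fix B assume "B \<in> local_arm_image T f w ` {A \<in> arms T w. A \<inter> orb \<noteq> {}}"
    then obtain A where A: "A \<in> arms T w" "A \<inter> orb \<noteq> {}" "B = local_arm_image T f w A" by blast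
    have B: "B \<in> arms T (f w)" using local_arm_image_arms[OF orb_T[OF w(1)] A(1)] A(3) by simp
    have "B \<inter> orb \<noteq> {}"
    proof
      assume e: "B \<inter> orb = {}"
      then have "B = arm (f w) (f c)" using pull_free[OF w(1) A(1)] A(2,3) by blast
      then show False using free_c1_unique[OF orb_f[OF w(1)]] e w(2) by simp
    qed
    then show "B \<in> {A \<in> arms T (f w). A \<inter> orb \<noteq> {}}" using B by blast
  qed
  show "finite {A \<in> arms T (f w). A \<inter> orb \<noteq> {}}" using finite_arms by simp
qed

text \<open>On the way from \<open>z\<close> to an extreme point of the orbit the number of non-free
  arms does not decrease, and at the extreme point it is at most one.\<close>

lemma nonfree_unique:
  assumes "A \<in> arms T z" "B \<in> arms T z" "A \<inter> orb \<noteq> {}" "B \<inter> orb \<noteq> {}"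
  shows "A = B"
proof -
  obtain w C where w: "w \<in> orb" "\<And>A. \<lbrakk>A \<in> arms T w; A \<noteq> C\<rbrakk> \<Longrightarrow> A \<inter> orb = {}" using hull_end by blast
  have "nf w \<le> card {C}" unfolding nf_def by (rule card_mono) (use w(2) in auto)
  moreover obtain n where n: "n < m" "w = (f ^^ n) z" using orb_reach[OF z_orb w(1)] .
  have "nf z \<le> nf ((f ^^ i) z)" if "i < m" for i
    using that
  proof (induction i)
    case (Suc i)
    have "nf ((f ^^ i) z) \<le> nf (f ((f ^^ i) z))"
      by (rule nf_mono[OF orbI]) (use exact_neq[of "Suc i"] Suc.prems in simp)
    then show ?case using Suc by simp
  qed simp
  ultimately have "nf z \<le> 1" using n by fastforce
  then have "card {A \<in> arms T z. A \<inter> orb \<noteq> {}} \<le> Suc 0" by (simp add: nf_def)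
  then show ?thesis using card_le_Suc0_iff_eq[of "{A \<in> arms T z. A \<inter> orb \<noteq> {}}"] finite_arms assms by auto
qed

text \<open>Otherwise \<open>c\<close> would separate \<open>z\<close> from no orbit point, all
  orbit points would have the same symbol, and the itinerary would have period 1.\<close>

lemma G0_nonfree:
  assumes "m \<ge> 2" shows "G0 \<inter> orb \<noteq> {}"
proof
  assume e: "G0 \<inter> orb = {}"
  have "sy u = sy z" if u: "u \<in> orb" for u
  proof (cases "u = z")
    case False
    have "u \<notin> G0" using e u by blast
    then have zc: "z \<in> seg c u" using mem_arm_iff[OF zT cT, of u] False z_c orb_T[OF u] by auto
    have "c \<notin> seg z u"
    proof
      assume "c \<in> seg z u"
      then have "c \<in> seg u z" "z \<in> seg u c" using zc seg_sym orb_T[OF u] zT cT by auto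
      then show False using seg_antisym[of c u z] orb_T[OF u] zT z_c by blast
    qed
    then show ?thesis using sym_eq_iff[of z u] zT orb_T[OF u] z_c orb_not_c[OF u] by simp
  qed simp
  then have "itin z n = sy z" for n using orbI by (simp add: itin_def)
  then have "itin ((f ^^ 1) z) = itin z" by (intro ext) (simp only: itin_shift)
  then show False using exact[of 1] assms by simp
qed

lemma others_free: "\<lbrakk>A \<in> arms T z; A \<noteq> G0\<rbrakk> \<Longrightarrow> A \<inter> orb = {}"
proof (cases "m \<ge> 2")
  case True
  assume "A \<in> arms T z" "A \<noteq> G0"
  then show ?thesis using nonfree_unique[OF _ G0_arm _ G0_nonfree[OF True]] by blast
next
  case False
  assume A: "A \<in> arms T z" "A \<noteq> G0"
  have m1: "m = 1" using False m by simp
  have "w = z" if w: "w \<in> orb" for w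
  proof -
    obtain k where "w = (f ^^ k) z" "k < m" using w by (auto simp: orb_def)
    then show ?thesis using m1 by simp
  qed
  moreover have "z \<notin> A" using A(1) arms_nonempty[OF A(1)] arm_subset by blast
  ultimately show ?thesis by blast
qed

definition ret :: "'a set \<Rightarrow> 'a set" where "ret A = snd ((F ^^ m) (z, A))"

lemma ret: "(F ^^ m) (z, A) = (z, ret A)"
  using fst_Fn[of m "(z, A)"] per by (simp add: ret_def prod_eq_iff)

lemma ret_arms: "A \<in> arms T z \<Longrightarrow> ret A \<in> arms T z"
  using Fn_SA[of "(z, A)" m] ret z_orb by (simp add: SA_iff)

lemma ret_inj: "\<lbrakk>A \<in> arms T z; B \<in> arms T z; ret A = ret B\<rbrakk> \<Longrightarrow> A = B"
  using inj_onD[OF Fn_inj, of m "(z, A)" "(z, B)"] ret z_orb by (simp add: SA_iff)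

lemma retn_arms: "A \<in> arms T z \<Longrightarrow> (ret ^^ i) A \<in> arms T z"
  by (induction i) (auto intro: ret_arms)

lemma Fmn: "(F ^^ (i * m)) (z, A) = (z, (ret ^^ i) A)"
proof (induction i)
  case (Suc i)
  have "(F ^^ (Suc i * m)) (z, A) = (F ^^ m) ((F ^^ (i * m)) (z, A))" by (simp add: funpow_add)
  then show ?case using Suc ret by simp
qed simp

text \<open>Going back from time \<open>m\<close>, the arm stays free and off \<open>c\<close> by
  \<open>pull_free\<close>. The only obstruction is a free arm of the critical value; it occurs only
  at \<open>z\<close>, hence only at time \<open>m\<close>, where \<open>ret A \<noteq> G1\<close>
  excludes it.\<close>

lemma pull_ret:
  assumes A: "A \<in> arms T z" "ret A \<noteq> G0" "ret A \<noteq> G1"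
  shows "A \<noteq> G0" "\<And>i. i < m \<Longrightarrow> c \<notin> snd ((F ^^ i) (z, A))"
proof -
  have zA: "(z, A) \<in> SA" using A z_orb by (simp add: SA_iff)
  have main: "i \<le> m \<Longrightarrow> snd ((F ^^ (m - i)) (z, A)) \<inter> orb = {} \<and> (0 < i \<longrightarrow> c \<notin> snd ((F ^^ (m - i)) (z, A)))" for i
  proof (induction i)
    case 0
    then show ?case using ret[of A] others_free[OF ret_arms[OF A(1)] A(2)] by simp
  next
    case (Suc i)
    define k where "k = m - Suc i"
    have k: "m - i = Suc k" using Suc.prems by (simp add: k_def)
    obtain B where B: "(F ^^ k) (z, A) = ((f ^^ k) z, B)"
      using fst_Fn[of k "(z, A)"] by (metis fst_conv prod.collapse)
    have BS: "(f ^^ k) z \<in> orb" "B \<in> arms T ((f ^^ k) z)" using Fn_SA[OF zA, of k] B by (auto simp: SA_iff)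
    have n: "(F ^^ (m - i)) (z, A) = ((f ^^ Suc k) z, local_arm_image T f ((f ^^ k) z) B)"
      by (simp add: k B F_arm)
    have fr: "local_arm_image T f ((f ^^ k) z) B \<inter> orb = {}" using Suc n by simp
    have "local_arm_image T f ((f ^^ k) z) B \<noteq> arm (f ((f ^^ k) z)) (f c)"
    proof
      assume e: "local_arm_image T f ((f ^^ k) z) B = arm (f ((f ^^ k) z)) (f c)"
      then have w: "(f ^^ Suc k) z = z" using free_c1_unique[OF orbI[of "Suc k"]] fr by simp
      have "i = 0"
      proof (rule ccontr)
        assume "i \<noteq> 0"
        then show False using exact_neq[of "Suc k"] w k m by simp
      qed
      then have "(z, ret A) = (z, G1)" using n e w ret[of A] by simp
      then show False using A(3) by simp
    qed
    then show ?case using pull_free[OF BS fr] B by (simp add: k_def)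
  qed
  have i: "c \<notin> snd ((F ^^ i) (z, A))" if "i < m" for i using main[of "m - i"] that by simp
  show "\<And>i. i < m \<Longrightarrow> c \<notin> snd ((F ^^ i) (z, A))" using i .
  have "c \<notin> A" using i[of 0] m by simp
  then show "A \<noteq> G0" using arm_refl[OF cT z_c[symmetric]] by blast
qed

lemma ret_G0: "ret G0 = G0 \<or> ret G0 = G1"
  using pull_ret(1)[OF G0_arm] by blast

lemma never_c:
  assumes A: "A \<in> arms T z" "\<And>i. (ret ^^ Suc i) A \<noteq> G0" "\<And>i. (ret ^^ Suc i) A \<noteq> G1"
  shows "c \<notin> snd ((F ^^ n) (z, A))"
proof -
  have "(F ^^ n) (z, A) = (F ^^ (n mod m + (n div m) * m)) (z, A)" by simp
  also have "\<dots> = (F ^^ (n mod m)) ((F ^^ ((n div m) * m)) (z, A))" by (simp only: funpow_add comp_apply)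
  also have "\<dots> = (F ^^ (n mod m)) (z, (ret ^^ (n div m)) A)" by (simp only: Fmn)
  finally have e: "(F ^^ n) (z, A) = (F ^^ (n mod m)) (z, (ret ^^ (n div m)) A)" .
  show ?thesis unfolding e
    by (rule pull_ret(2)[OF retn_arms[OF A(1)]]) (use A(2,3)[of "n div m"] m in auto)
qed

end

section \<open>Characteristic branch points: tame versus evil\<close>

locale char_branch = char_point T f c z m for T :: "'a::t2_space set" and f c z m +
  assumes branch: "z \<in> branch_points T"
begin

lemma three: "card (arms T z) \<ge> 3" using branch by (simp add: branch_points_def)

text \<open>In case of equality \<open>ret\<close> fixes \<open>G0\<close>, so any other arm is
  never mapped to it and, by \<open>never_c\<close>, never contains \<open>c\<close>, contrary to
  \<open>arm_hits_c\<close>.\<close>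

lemma G0_neq_G1: "G0 \<noteq> G1"
proof
  assume eq: "G0 = G1"
  then have r: "ret G0 = G0" using ret_G0 by metis
  have "\<not> arms T z \<subseteq> {G0}"
  proof
    assume "arms T z \<subseteq> {G0}"
    then have "card (arms T z) \<le> card {G0}" by (intro card_mono) auto
    then show False using three by simp
  qed
  then obtain B where B: "B \<in> arms T z" "B \<noteq> G0" by blast
  have n: "(ret ^^ i) B \<noteq> G0" for i
  proof (induction i)
    case (Suc i)
    then show ?case using ret_inj[OF retn_arms[OF B(1), of i] G0_arm] r by auto
  qed (use B in simp)
  have "c \<notin> snd ((F ^^ k) (z, B))" for k
    by (rule never_c[OF B(1)]) (use n eq in metis)+
  then show False using arm_hits_c[OF branch, of "(z, B)"] B(1) z_orb by (auto simp: SA_iff)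
qed

text \<open>By \<open>never_c\<close> no arm can miss both \<open>G0\<close> and \<open>G1\<close>
  forever. After \<open>G0\<close> comes \<open>G1\<close> unless \<open>G0\<close> is fixed, and
  then only \<open>G0\<close> itself is ever mapped to \<open>G0\<close>.\<close>

lemma returns_G1:
  assumes A: "A \<in> arms T z" and n: "ret G0 = G1 \<or> A \<noteq> G0"
  obtains i where "(ret ^^ Suc i) A = G1"
proof -
  have "\<exists>i. (ret ^^ Suc i) A = G1"
  proof (rule ccontr)
    assume no: "\<not> ?thesis"
    have "\<exists>i. (ret ^^ Suc i) A = G0"
    proof (rule ccontr)
      assume "\<nexists>i. (ret ^^ Suc i) A = G0"
      then have "c \<notin> snd ((F ^^ k) (z, A))" for k using no never_c[OF A] by blast
      then show False using arm_hits_c[OF branch, of "(z, A)"] A z_orb by (auto simp: SA_iff)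
    qed
    then obtain i where i: "(ret ^^ Suc i) A = G0" by blast
    show False
    proof (cases "ret G0 = G1")
      case True
      then have "(ret ^^ Suc (Suc i)) A = G1" using i by simp
      then show False using no by blast
    next
      case False
      then have r: "ret G0 = G0" using ret_G0 by blast
      have "(ret ^^ k) A \<noteq> G0" for k
      proof (induction k)
        case (Suc k)
        then show ?case using ret_inj[OF retn_arms[OF A, of k] G0_arm] r by auto
      qed (use n False in simp)
      then show False using i by blast
    qed
  qed
  then show ?thesis using that by blast
qed

text \<open>A fixed \<open>G0\<close> never reaches \<open>G1\<close>. Conversely all local arms of
  the orbit reach \<open>(z, G1)\<close>, and for a permutation of a finite set a common target
  means a common cycle.\<close>

lemma tame_iff: "tame T f orb \<longleftrightarrow> ret G0 = G1"
proof
  assume t: "tame T f orb"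
  show "ret G0 = G1"
  proof (rule ccontr)
    assume "ret G0 \<noteq> G1"
    then have r: "ret G0 = G0" using ret_G0 by blast
    have rn: "(ret ^^ i) G0 = G0" for i by (induction i) (use r in auto)
    obtain n where n: "(F ^^ n) (z, G0) = (z, G1)"
      using t G0_arm G1_arm z_orb unfolding tame_def by blast
    have "(f ^^ n) z = z" using fst_Fn[of n "(z, G0)"] n by simp
    then have "(f ^^ (n mod m)) z = z" using per_mod by metis
    then have "n mod m = 0" using exact_neq[of "n mod m"] m mod_less_divisor[of m n] by (cases "n mod m") auto
    then obtain i where "n = i * m" by (metis mod_0_imp_dvd dvd_def mult.commute)
    then have "G1 = G0" using n Fmn[of i G0] rn[of i] by simp
    then show False using G0_neq_G1 by simp
  qed
next
  assume r: "ret G0 = G1"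
  have reach: "\<exists>n. (F ^^ n) a = (z, G1)" if a: "a \<in> SA" for a
  proof -
    obtain w A where wA: "a = (w, A)" by fastforce
    then have w: "w \<in> orb" using a by (simp add: SA_iff)
    obtain j where j: "z = (f ^^ j) w" using orb_reach[OF w z_orb] by metis
    obtain B where B: "(F ^^ j) a = (z, B)" using fst_Fn[of j a] wA j by (metis fst_conv prod.collapse)
    then have "B \<in> arms T z" using Fn_SA[OF a, of j] by (simp add: SA_iff)
    then obtain i where "(ret ^^ Suc i) B = G1" using returns_G1 r by metis
    then have "(F ^^ (Suc i * m)) ((F ^^ j) a) = (z, G1)" using Fmn[of "Suc i" B] B by simp
    then show ?thesis by (metis comp_apply funpow_add)
  qed
  show "tame T f orb" unfolding tame_def
  proof (intro ballI)
    fix a b assume "a \<in> Sigma orb (arms T)" "b \<in> Sigma orb (arms T)"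
    then have ab: "a \<in> SA" "b \<in> SA" by (auto simp: SA_def)
    obtain i where i: "(F ^^ i) a = (z, G1)" using reach[OF ab(1)] by blast
    obtain j where j: "(F ^^ j) b = (z, G1)" using reach[OF ab(2)] by blast
    obtain n where n: "n \<ge> j" "(F ^^ n) b = b" using Fn_return[OF ab(2)] by metis
    have "(F ^^ (n - j)) (z, G1) = b"
      using n j by (metis comp_apply funpow_add le_add_diff_inverse2)
    then have "(F ^^ (n - j + i)) a = b" using i by (simp add: funpow_add)
    then show "\<exists>n. (F ^^ n) a = b" by blast
  qed
qed

lemma evil_iff: "\<not> tame T f orb \<longleftrightarrow> ret G0 = G0"
proof
  assume "\<not> tame T f orb"
  then have "ret G0 \<noteq> G1" using tame_iff by blast
  then show "ret G0 = G0" using ret_G0 by blast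
next
  assume "ret G0 = G0"
  then have "ret G0 \<noteq> G1" using G0_neq_G1 by simp
  then show "\<not> tame T f orb" using tame_iff by blast
qed

text \<open>If \<open>G1\<close> were fixed too, then every arm except \<open>G0\<close>, since it
  eventually arrives at \<open>G1\<close>, would equal \<open>G1\<close>, leaving at most two
  arms.\<close>

lemma evil_ret_G1:
  assumes "ret G0 = G0"
  shows "ret G1 \<noteq> G0" "ret G1 \<noteq> G1"
proof -
  show "ret G1 \<noteq> G0" using ret_inj[OF G1_arm G0_arm] assms G0_neq_G1 by auto
  show "ret G1 \<noteq> G1"
  proof
    assume r: "ret G1 = G1"
    have "A = G1" if A: "A \<in> arms T z" "A \<noteq> G0" for A
    proof -
      obtain i where i: "(ret ^^ Suc i) A = G1" using returns_G1 A by metis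
      have "(ret ^^ k) A = G1 \<Longrightarrow> A = G1" for k
      proof (induction k)
        case (Suc k)
        then show ?case using ret_inj[OF retn_arms[OF A(1), of k] G1_arm] r by auto
      qed simp
      then show ?thesis using i by blast
    qed
    then have "arms T z \<subseteq> {G0, G1}" by blast
    then have "card (arms T z) \<le> card {G0, G1}" by (intro card_mono) auto
    also have "\<dots> \<le> 2" by (simp add: card_insert_if)
    finally show False using three by simp
  qed
qed

end

section \<open>Evil orbits violate admissibility\<close>

lemma rho_cases:
  obtains (fin) k where "rho \<nu> n = enat k" "k > n" "\<nu> k \<noteq> \<nu> (k - n)" "\<And>j. \<lbrakk>n < j; j < k\<rbrakk> \<Longrightarrow> \<nu> j = \<nu> (j - n)"
  | (inf) "rho \<nu> n = \<infinity>" "\<And>j. n < j \<Longrightarrow> \<nu> j = \<nu> (j - n)"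
proof (cases "\<exists>k. k > n \<and> \<nu> k \<noteq> \<nu> (k - n)")
  case True
  define k where "k = (LEAST k. k > n \<and> \<nu> k \<noteq> \<nu> (k - n))"
  have k: "k > n \<and> \<nu> k \<noteq> \<nu> (k - n)" unfolding k_def using LeastI_ex[OF True] .
  have least: "k \<le> j" if "j > n \<and> \<nu> j \<noteq> \<nu> (j - n)" for j
    unfolding k_def using that by (rule Least_le)
  have "rho \<nu> n = enat k" unfolding rho_def
  proof (rule antisym)
    show "Inf (enat ` {k. k > n \<and> \<nu> k \<noteq> \<nu> (k - n)}) \<le> enat k"
      by (rule Inf_lower) (use k in blast)
    show "enat k \<le> Inf (enat ` {k. k > n \<and> \<nu> k \<noteq> \<nu> (k - n)})"
      by (rule Inf_greatest) (use least in auto)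
  qed
  moreover have "\<nu> j = \<nu> (j - n)" if "n < j" "j < k" for j
    using least[of j] that by auto
  ultimately show ?thesis using fin k by blast
next
  case False
  then have e: "{k. k > n \<and> \<nu> k \<noteq> \<nu> (k - n)} = {}" by blast
  have "rho \<nu> n = \<infinity>" unfolding rho_def e by (simp add: top_enat_def)
  then show ?thesis using inf False by blast
qed

lemma rho_enatD:
  assumes "rho \<nu> n = enat k"
  shows "k > n" "\<nu> k \<noteq> \<nu> (k - n)" "\<And>j. \<lbrakk>n < j; j < k\<rbrakk> \<Longrightarrow> \<nu> j = \<nu> (j - n)"
proof -
  have "k > n \<and> \<nu> k \<noteq> \<nu> (k - n) \<and> (\<forall>j. n < j \<longrightarrow> j < k \<longrightarrow> \<nu> j = \<nu> (j - n))"
  proof (cases rule: rho_cases[of \<nu> n])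
    case (fin k')
    then have "k' = k" using assms by simp
    then show ?thesis using fin(2,3,4) by blast
  next
    case inf
    have False using inf(1) assms by simp
    then show ?thesis ..
  qed
  then show "k > n" "\<nu> k \<noteq> \<nu> (k - n)" "\<And>j. \<lbrakk>n < j; j < k\<rbrakk> \<Longrightarrow> \<nu> j = \<nu> (j - n)" by blast+
qed

lemma rho_le_iff: "rho \<nu> n \<le> enat M \<longleftrightarrow> (\<exists>j. n < j \<and> j \<le> M \<and> \<nu> j \<noteq> \<nu> (j - n))"
proof (cases rule: rho_cases[of \<nu> n])
  case (fin k)
  show ?thesis
  proof
    assume "rho \<nu> n \<le> enat M" then show "\<exists>j. n < j \<and> j \<le> M \<and> \<nu> j \<noteq> \<nu> (j - n)"
      using fin(1-3) by auto
  next
    assume "\<exists>j. n < j \<and> j \<le> M \<and> \<nu> j \<noteq> \<nu> (j - n)"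
    then obtain j where j: "n < j" "j \<le> M" "\<nu> j \<noteq> \<nu> (j - n)" by blast
    then have "k \<le> j" using fin(4)[of j] by (meson not_le)
    then show "rho \<nu> n \<le> enat M" using fin(1) j by simp
  qed
next
  case inf
  have "\<not> rho \<nu> n \<le> enat M" using inf(1) by simp
  then show ?thesis using inf(2) by blast
qed

lemma rho_orbit_ge: "k \<in> rho_orbit \<nu> r \<Longrightarrow> r \<le> k"
proof (induction rule: rho_orbit.induct)
  case (step l l')
  then show ?case using rho_enatD(1)[OF step.hyps(2)] by simp
qed simp

text \<open>\<open>k\<close> is the largest orbit element below \<open>M\<close>; the agreement of
  entries expresses that its successor, if any, lies beyond \<open>M\<close>.\<close>

lemma rho_orbit_last:
  assumes "r \<le> M" "M \<notin> rho_orbit \<nu> r"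
  obtains k where "k \<in> rho_orbit \<nu> r" "r \<le> k" "k < M" "\<And>j. \<lbrakk>k < j; j \<le> M\<rbrakk> \<Longrightarrow> \<nu> j = \<nu> (j - k)"
proof -
  define S where "S = {k \<in> rho_orbit \<nu> r. k \<le> M}"
  have S: "finite S" "S \<noteq> {}" using assms rho_orbit.start[of r \<nu>] by (auto simp: S_def)
  define k where "k = Max S"
  have k: "k \<in> rho_orbit \<nu> r" "k \<le> M" using Max_in[OF S] by (auto simp: S_def k_def)
  have kM: "k < M" using k assms(2) by (metis le_neq_implies_less)
  have "\<nu> j = \<nu> (j - k)" if j: "k < j" "j \<le> M" for j
  proof (rule ccontr)
    assume "\<nu> j \<noteq> \<nu> (j - k)"
    then have "rho \<nu> k \<le> enat M" using rho_le_iff j by blast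
    then obtain l where l: "rho \<nu> k = enat l" "l \<le> M" by (metis enat_ile enat_ord_simps(1))
    then have "l \<in> S" using rho_orbit.step[OF k(1) l(1)] by (simp add: S_def)
    then have "l \<le> k" using Max_ge[OF S(1)] by (simp add: k_def)
    then show False using rho_enatD(1)[OF l(1)] by simp
  qed
  then show ?thesis using that[OF k(1) rho_orbit_ge[OF k(1)] kM] by blast
qed

context hubbard
begin

abbreviation "nu \<equiv> kneading T f c"

lemma nu_Suc: "nu (Suc j) = sy ((f ^^ j) (f c))"
  by (simp add: kneading_def itinerary_def)

text \<open>A pointer at the critical value follows the critical orbit until the next element of the
  \<open>\<rho>\<close>-orbit, where it is reset.\<close>

lemma ptr_rho_orbit:
  assumes \<tau>: "\<And>j. j < M \<Longrightarrow> \<tau> j = nu (Suc j)" and k: "k \<in> rho_orbit nu r" and M: "k \<le> M" "1 \<le> r"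
  shows "ptr (\<lambda>i. \<tau> (r + i)) (f c) (k - r) = f c \<and>
    (k \<noteq> r \<longrightarrow> sy (ptr (\<lambda>i. \<tau> (r + i)) (f c) (k - r - 1)) \<noteq> \<tau> (k - 1))"
  using k M(1)
proof (induction rule: rho_orbit.induct)
  case start
  then show ?case by simp
next
  case (step l l')
  note rl = rho_enatD[OF step.hyps(2)]
  have rl': "r \<le> l" using rho_orbit_ge[OF step.hyps(1)] .
  let ?p = "ptr (\<lambda>i. \<tau> (r + i)) (f c)"
  have l: "?p (l - r) = f c" using step rl(1) by simp
  have follow: "?p (l - r + i) = (f ^^ i) (f c)" if "l + i < l'" for i
    using that
  proof (induction i)
    case (Suc i)
    have "\<tau> (l + i) = nu (Suc (l + i))" using \<tau> Suc.prems step.prems by simp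
    also have "\<dots> = nu (Suc i)" using rl(3)[of "Suc (l + i)"] Suc.prems by simp
    also have "\<dots> = sy ((f ^^ i) (f c))" by (rule nu_Suc)
    finally show ?case using Suc rl' by (simp add: nxt_def)
  qed (use l in simp)
  \<comment> \<open>Positions in \<open>nu\<close> start at 1 and times at 0: the mismatch at entry
    \<open>l'\<close> is the disagreement at time \<open>l' - 1\<close>, and the reset is visible at
    time \<open>l'\<close>.\<close>
  define i where "i = l' - Suc l"
  have i: "l + i < l'" "l' = Suc (l + i)" using rl(1) by (auto simp: i_def)
  have e: "?p (l - r + i) = (f ^^ i) (f c)" using follow[OF i(1)] .
  have n: "sy ((f ^^ i) (f c)) \<noteq> \<tau> (l + i)"
    using rl(2) \<tau>[of "l + i"] step.prems i(2) nu_Suc[of i] by simp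
  have idx: "l' - r = Suc (l - r + i)" "l' - r - 1 = l - r + i" "r + (l - r + i) = l + i" "l' - 1 = l + i"
    using i(2) rl' by auto
  have "?p (Suc (l - r + i)) = nxt (\<tau> (l + i)) (?p (l - r + i))" by (simp only: ptr.simps idx(3))
  also have "\<dots> = f c" unfolding e nxt_def using n by simp
  finally have "?p (l' - r) = f c" unfolding idx(1) .
  moreover have "sy (?p (l' - r - 1)) \<noteq> \<tau> (l' - 1)" unfolding idx(2,4) e by (rule n)
  ultimately show ?case by blast
qed

end

section \<open>Pointers at a characteristic point compared with the kneading sequence\<close>

context char_point
begin

lemma itin_mod: "itin z n = itin z (n mod m)"
  using per_mod[of n] by (simp add: itin_def)

lemma itin_per: "itin z (n + m) = itin z n"
  using itin_mod[of "n + m"] itin_mod[of n] by simp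

lemma F_ptr_z:
  assumes "P \<in> T" "P \<noteq> z"
  shows "(F ^^ n) (z, arm z P) = ((f ^^ n) z, arm ((f ^^ n) z) (ptr (itin z) P n))"
  using F_ptr(1)[OF zT nc assms] .

text \<open>From \<open>(f ^^ k) z\<close> the critical value is seen through \<open>z\<close>, so
  \<open>z\<close> can serve as the pointer. It has the same next \<open>m - k\<close> symbols,
  hence is followed without reset and arrives at an orbit point different from \<open>z\<close>;
  such points lie in \<open>G0\<close>.\<close>

lemma push_to_G0:
  assumes agree: "\<And>j. j < m \<Longrightarrow> itin z j = nu (Suc j)" and k: "1 \<le> k" "k < m"
    and no_cut: "\<And>j. \<lbrakk>k < j; j \<le> m\<rbrakk> \<Longrightarrow> nu j = nu (j - k)"
  shows "(F ^^ (m - k)) ((f ^^ k) z, arm ((f ^^ k) z) (f c)) = (z, G0)"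
proof -
  define w where "w = (f ^^ k) z"
  have w: "w \<in> orb" "w \<in> T" "w \<noteq> z" using orbI exact_neq[OF k] orb_T by (auto simp: w_def)
  have nw: "(f ^^ n) w \<noteq> c" for n using orb_nc[OF w(1)] .
  have a: "arm w (f c) = arm w z" using arm_seg[OF z_in_seg[OF w(1)] w(3)[symmetric] w(2) fcT] by simp
  have "ptr (itin w) z (m - k) = (f ^^ (m - k)) z"
  proof (rule ptr_follow)
    fix i assume i: "i < m - k"
    have "itin w i = itin z (k + i)" by (simp add: w_def itin_shift)
    also have "\<dots> = nu (Suc (k + i))" using agree i by simp
    also have "\<dots> = nu (Suc i)" using no_cut[of "Suc (k + i)"] i by simp
    also have "\<dots> = itin z i" using agree i by simp
    finally show "sy ((f ^^ i) z) = itin w i" by (simp add: itin_def)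
  qed
  moreover have wm: "(f ^^ (m - k)) w = z"
  proof -
    have "(f ^^ (m - k)) w = (f ^^ (m - k + k)) z" unfolding w_def by (simp only: funpow_add comp_apply)
    then show ?thesis using per k by simp
  qed
  ultimately have e: "(F ^^ (m - k)) (w, arm w (f c)) = (z, arm z ((f ^^ (m - k)) z))"
    using F_ptr[OF w(2) nw zT w(3)[symmetric], of "m - k"] a by simp
  define u where "u = (f ^^ (m - k)) z"
  have u: "u \<in> orb" "u \<noteq> z" using orbI exact_neq[of "m - k"] k by (auto simp: u_def)
  have "u \<in> arm z u" using arm_refl[OF orb_T[OF u(1)] u(2)] .
  then have "arm z u \<inter> orb \<noteq> {}" using u(1) by blast
  then have "arm z u = G0" using others_free[OF arm_in_arms[OF orb_T[OF u(1)] u(2)]] by blast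
  then show ?thesis using e unfolding w_def u_def by simp
qed

text \<open>After one step the pointer \<open>c\<close> is at the critical value, and from then on
  it is reset at the entries of the internal address.\<close>

lemma G0_at:
  assumes agree: "\<And>j. j < m \<Longrightarrow> itin z j = nu (Suc j)" and k: "k \<in> rho_orbit nu 1" "k \<le> m"
  shows "(F ^^ k) (z, G0) = ((f ^^ k) z, arm ((f ^^ k) z) (f c))"
proof -
  have k1: "1 \<le> k" using rho_orbit_ge[OF k(1)] .
  have "ptr (itin z) c 1 = f c" by (simp add: nxt_def)
  then have "ptr (itin z) c (1 + (k - 1)) = ptr (\<lambda>i. itin z (1 + i)) (f c) (k - 1)" unfolding ptr_add by simp
  also have "\<dots> = f c" using ptr_rho_orbit[of m "itin z" k 1] agree k by blast
  finally have "ptr (itin z) c k = f c" using k1 by simp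
  then show ?thesis using F_ptr_z[OF cT z_c[symmetric], of k] by simp
qed

text \<open>At the last entry of the internal address below \<open>m\<close> the arm is that of the
  critical value, and \<open>push_to_G0\<close> carries it back to \<open>G0\<close>.\<close>

lemma ret_G0_from_address:
  assumes agree: "\<And>j. j < m \<Longrightarrow> itin z j = nu (Suc j)" and not: "m \<notin> rho_orbit nu 1"
  shows "ret G0 = G0"
proof -
  obtain k where k: "k \<in> rho_orbit nu 1" "1 \<le> k" "k < m" "\<And>j. \<lbrakk>k < j; j \<le> m\<rbrakk> \<Longrightarrow> nu j = nu (j - k)"
    using rho_orbit_last[OF m not] by metis
  have "(F ^^ (m - k)) ((F ^^ k) (z, G0)) = (z, G0)"
    using G0_at[OF agree k(1)] push_to_G0[OF agree k(2-4)] k(3) by simp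
  then have "(F ^^ (m - k + k)) (z, G0) = (z, G0)" by (simp only: funpow_add comp_apply)
  then have "(F ^^ m) (z, G0) = (z, G0)" using k(3) by simp
  then show ?thesis using ret[of G0] by simp
qed

end

context char_branch
begin

text \<open>With \<open>G0\<close> fixed, \<open>ret G1\<close> is neither \<open>G0\<close> nor
  \<open>G1\<close>. By \<open>pull_ret\<close> the images of \<open>G1\<close> then avoid
  \<open>c\<close> before time \<open>m\<close>, so \<open>c\<close> separates no image of
  \<open>z\<close> from that of the critical value.\<close>

lemma evil_agree:
  assumes evil: "ret G0 = G0" and j: "j < m"
  shows "itin z j = nu (Suc j)"
  using j
proof (induction j rule: less_induct)
  case (less j)
  have "ptr (itin z) (f c) j = (f ^^ j) (f c)"
    by (rule ptr_follow) (use less nu_Suc in simp)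
  then have Fj: "(F ^^ j) (z, G1) = ((f ^^ j) z, arm ((f ^^ j) z) ((f ^^ j) (f c)))"
    and ne: "(f ^^ j) (f c) \<noteq> (f ^^ j) z"
    using F_ptr_z[OF fcT z_c1[symmetric], of j] ptr_neq[OF zT nc fcT z_c1[symmetric], of j] by auto
  have nin: "c \<notin> snd ((F ^^ j) (z, G1))"
    using pull_ret(2)[OF G1_arm evil_ret_G1[OF evil] less.prems] .
  show ?case
  proof (rule ccontr)
    assume "itin z j \<noteq> nu (Suc j)"
    then have "sy ((f ^^ j) z) \<noteq> sy ((f ^^ j) (f c))" by (simp add: nu_Suc itin_def)
    then have "c \<in> seg ((f ^^ j) z) ((f ^^ j) (f c))" using c_in_seg[OF fpT[OF zT] fpT[OF fcT]] by blast
    then have "arm ((f ^^ j) z) c = arm ((f ^^ j) z) ((f ^^ j) (f c))"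
      using arm_seg[OF _ nc[of j, symmetric] fpT[OF zT] fpT[OF fcT]] by blast
    moreover have "c \<in> arm ((f ^^ j) z) c" using arm_refl[OF cT nc[of j, symmetric]] .
    ultimately show False using nin Fj by simp
  qed
qed

theorem evil_imp_fails:
  assumes evil: "ret G0 = G0"
  shows "fails_admissibility nu m"
proof -
  note agree = evil_agree[OF evil]
  have 1: "m \<notin> internal_address nu"
  proof
    assume "m \<in> internal_address nu"
    then have "(F ^^ m) (z, G0) = ((f ^^ m) z, arm ((f ^^ m) z) (f c))"
      using G0_at[OF agree] by (simp add: internal_address_def)
    then have "ret G0 = G1" using ret[of G0] per by simp
    then show False using evil G0_neq_G1 by simp
  qed
  \<comment> \<open>A violation would make the itinerary of \<open>z\<close> periodic with the
    proper divisor \<open>k\<close> of \<open>m\<close>.\<close>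
  have 2: "rho nu k \<le> enat m" if k: "1 \<le> k" "k < m" "k dvd m" for k
  proof (rule ccontr)
    assume "\<not> rho nu k \<le> enat m"
    then have eq: "nu j = nu (j - k)" if "k < j" "j \<le> m" for j using rho_le_iff that by blast
    have red: "j < m \<Longrightarrow> itin z j = itin z (j mod k)" for j
    proof (induction j rule: less_induct)
      case (less j)
      show ?case
      proof (cases "j < k")
        case False
        then have "itin z j = nu (Suc j)" using agree less.prems by simp
        also have "\<dots> = nu (Suc (j - k))" using eq[of "Suc j"] False less.prems by (simp add: Suc_diff_le)
        also have "\<dots> = itin z (j - k)" using agree less.prems by simp
        also have "\<dots> = itin z ((j - k) mod k)" by (rule less.IH) (use False less.prems k in auto)
        also have "(j - k) mod k = j mod k" using False by (simp add: le_mod_geq)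
        finally show ?thesis .
      qed simp
    qed
    have red': "itin z j = itin z (j mod k)" for j
      using itin_mod[of j] red[of "j mod m"] m k(3) by (simp add: mod_mod_cancel)
    have "itin ((f ^^ k) z) = itin z"
    proof
      fix n show "itin ((f ^^ k) z) n = itin z n"
        using red'[of "k + n"] red'[of n] by (simp add: itin_shift)
    qed
    then show False using exact[OF k(1,2)] by blast
  qed
  have 3: "\<exists>n. rho nu m = enat n \<and> (\<forall>r\<in>{1..m}. r mod m = n mod m \<longrightarrow> m \<in> rho_orbit nu r)"
  proof (cases rule: rho_cases[of nu m])
    case inf
    have "itin z j = nu (Suc j)" for j
    proof (induction j rule: less_induct)
      case (less j)
      show ?case
      proof (cases "j < m")
        case False
        then have "itin z j = itin z (j - m)" using itin_per[of "j - m"] by simp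
        also have "\<dots> = nu (Suc (j - m))" using less False m by simp
        also have "\<dots> = nu (Suc j)" using inf(2)[of "Suc j"] False by (simp add: Suc_diff_le)
        finally show ?thesis .
      qed (use agree in simp)
    qed
    then have "sy ((f ^^ n) z) = sy ((f ^^ n) (f c))" for n by (simp add: nu_Suc itin_def)
    moreover have "z \<in> V" "f c \<in> V" using branch crit_V[of 1] by (auto simp: V_def)
    ultimately show ?thesis using expand z_c1 by blast
  next
    case (fin n)
    have pre: "j < n - 1 \<Longrightarrow> itin z j = nu (Suc j)" for j
    proof (induction j rule: less_induct)
      case (less j)
      show ?case
      proof (cases "j < m")
        case False
        then have "itin z j = itin z (j - m)" using itin_per[of "j - m"] by simp
        also have "\<dots> = nu (Suc (j - m))" using less False m by simp
        also have "\<dots> = nu (Suc j)" using fin(4)[of "Suc j"] False less.prems by (simp add: Suc_diff_le)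
        finally show ?thesis .
      qed (use agree in simp)
    qed
    have n1: "itin z (n - 1) \<noteq> nu n"
    proof -
      have "itin z (n - 1) = itin z (n - 1 - m)" using itin_per[of "n - 1 - m"] fin(2) by simp
      also have "\<dots> = nu (Suc (n - 1 - m))" using pre[of "n - 1 - m"] fin(2) m by simp
      also have "Suc (n - 1 - m) = n - m" using fin(2) by simp
      finally show ?thesis using fin(3) by simp
    qed
    \<comment> \<open>The pointer of \<open>G1\<close> follows the critical orbit up to its first
      disagreement at entry \<open>n\<close>. The steering word being periodic, only the residue of
      \<open>n\<close> matters for the later resets.\<close>
    have reset: "ptr (itin z) (f c) n = f c"
    proof -
      obtain n' where n': "n = Suc n'" using fin(2) by (cases n) auto
      have "ptr (itin z) (f c) n' = (f ^^ n') (f c)"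
        by (rule ptr_follow) (use pre nu_Suc n' in simp)
      then show ?thesis using n1 n' nu_Suc[of n'] by (simp add: nxt_def)
    qed
    \<comment> \<open>If the orbit of \<open>r\<close> missed \<open>m\<close>, then
      \<open>push_to_G0\<close> would show that a power of \<open>ret\<close> sends
      \<open>G1\<close> to \<open>G0\<close>. This is impossible since \<open>ret\<close> is
      injective and fixes \<open>G0\<close>.\<close>
    have "m \<in> rho_orbit nu r" if r: "r \<in> {1..m}" "r mod m = n mod m" for r
    proof (rule ccontr)
      assume not: "m \<notin> rho_orbit nu r"
      then have rm: "1 \<le> r" "r \<le> m" "r < m" using r rho_orbit.start[of m nu] by (auto simp: le_less)
      obtain k where k: "k \<in> rho_orbit nu r" "r \<le> k" "k < m" "\<And>j. \<lbrakk>k < j; j \<le> m\<rbrakk> \<Longrightarrow> nu j = nu (j - k)"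
        using rho_orbit_last[OF rm(2) not] by metis
      obtain t where t: "n = r + t * m"
      proof -
        have "n = n mod m + (n div m) * m" by simp
        moreover have "n mod m = r" using r rm by simp
        ultimately show ?thesis using that by metis
      qed
      have sh: "itin z (n + i) = itin z (r + i)" for i
      proof -
        have "n + i = r + i + t * m" unfolding t by simp
        then have "(n + i) mod m = (r + i) mod m" by (simp only: mod_mult_self1)
        then show ?thesis using itin_mod[of "n + i"] itin_mod[of "r + i"] by simp
      qed
      have "ptr (itin z) (f c) (n + (k - r)) = ptr (\<lambda>i. itin z (r + i)) (f c) (k - r)"
        unfolding ptr_add reset sh by simp
      also have "\<dots> = f c" using ptr_rho_orbit[of m "itin z" k r] agree k rm by simp
      finally have p: "ptr (itin z) (f c) (n + (k - r)) = f c" .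
      have "(f ^^ (n + (k - r))) z = (f ^^ k) z"
      proof -
        have "n + (k - r) = k + t * m" unfolding t using k(2) by simp
        then have "(n + (k - r)) mod m = k mod m" by (simp only: mod_mult_self1)
        then show ?thesis using per_mod[of "n + (k - r)"] per_mod[of k] by simp
      qed
      then have "(F ^^ (n + (k - r))) (z, G1) = ((f ^^ k) z, arm ((f ^^ k) z) (f c))"
        using F_ptr_z[OF fcT z_c1[symmetric], of "n + (k - r)"] p by simp
      then have "(F ^^ (m - k)) ((F ^^ (n + (k - r))) (z, G1)) = (z, G0)"
        using push_to_G0[OF agree _ k(3,4)] k(2) rm by simp
      then have "(F ^^ (m - k + (n + (k - r)))) (z, G1) = (z, G0)" by (simp only: funpow_add comp_apply)
      moreover have "m - k + (n + (k - r)) = Suc t * m" using k rm unfolding t by simp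
      ultimately have "(ret ^^ Suc t) G1 = G0" using Fmn[of "Suc t" G1] by simp
      moreover have "(ret ^^ i) G1 \<noteq> G0" for i
      proof (induction i)
        case (Suc i)
        then show ?case using ret_inj[OF retn_arms[OF G1_arm, of i] G0_arm] evil by auto
      qed (use G0_neq_G1 in simp)
      ultimately show False by blast
    qed
    then show ?thesis using fin(1) by blast
  qed
  show ?thesis unfolding fails_admissibility_def using 1 2 3 by blast
qed

end

section \<open>From an arbitrary orbit to its characteristic point\<close>

context periodic_point
begin

lemma orbit_point:
  assumes w: "w \<in> orb"
  shows "periodic_point T f c w m" "periodic_point.orb f w m = orb"
proof -
  show pp: "periodic_point T f c w m"
  proof
    show "w \<in> T" using orb_T w .
    show "m \<ge> 1" using m .
    show "(f ^^ m) w = w" using orb_per w .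
    show "(f ^^ n) w \<noteq> c" for n using orb_nc w .
    show "itin ((f ^^ k) w) \<noteq> itin w" if k: "1 \<le> k" "k < m" for k
    proof
      assume "itin ((f ^^ k) w) = itin w"
      then have e: "(f ^^ k) w = w" using orb_itin_inj orb_fp w by blast
      obtain i where i: "i < m" "z = (f ^^ i) w" using orb_reach[OF w z_orb] .
      have "(f ^^ k) z = (f ^^ (k + i)) w" unfolding i(2) by (simp add: funpow_add)
      also have "\<dots> = (f ^^ (i + k)) w" by (simp only: add.commute)
      also have "\<dots> = z" unfolding i(2) using e by (simp add: funpow_add)
      finally show False using exact_neq[OF k] by blast
    qed
  qed
  interpret w: periodic_point T f c w m by (rule pp)
  show "w.orb = orb"
  proof
    show "w.orb \<subseteq> orb" using orb_fp[OF w] by (auto simp: w.orb_def)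
    show "orb \<subseteq> w.orb"
    proof
      fix v assume "v \<in> orb"
      then obtain n where "n < m" "v = (f ^^ n) w" using orb_reach[OF w] by metis
      then show "v \<in> w.orb" by (auto simp: w.orb_def)
    qed
  qed
qed

lemma char_pointI:
  assumes "w \<in> orb" "arm w (f c) \<inter> orb = {}"
  shows "char_point T f c w m"
  unfolding char_point_def char_point_axioms_def using orbit_point[OF assms(1)] assms(2) by simp

lemma char_branch_exists:
  assumes b: "z \<in> branch_points T"
  obtains w where "w \<in> orb" "char_branch T f c w m"
proof -
  have br: "w \<in> branch_points T" if "w \<in> orb" for w using that fp_branch[OF b] by (auto simp: orb_def)
  have two: "card (arms T w) \<ge> 2" if "w \<in> orb" for w using br[OF that] by (simp add: branch_points_def)
  obtain w where w: "w \<in> orb" "arm w (f c) \<inter> orb = {}"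
    using char_exists[OF two] arm_hits_c[OF b] by metis
  have "char_branch T f c w m"
    unfolding char_branch_def char_branch_axioms_def using char_pointI[OF w] br[OF w(1)] by blast
  then show ?thesis using that w by blast
qed

end

context hubbard
begin

lemma branch_periodic_pointI:
  assumes x: "x \<in> branch_points T" and m: "m \<ge> 1" "(f ^^ m) x = x"
    and least: "\<And>k. \<lbrakk>1 \<le> k; k < m\<rbrakk> \<Longrightarrow> (f ^^ k) x \<noteq> x"
  shows "periodic_point T f c x m"
proof
  show "x \<in> T" using branch_T x .
  show "m \<ge> 1" "(f ^^ m) x = x" using m by auto
  show "(f ^^ n) x \<noteq> c" for n using fp_branch[OF x] c_not_branch by metis
  show "itin ((f ^^ k) x) \<noteq> itin x" if k: "1 \<le> k" "k < m" for k
  proof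
    assume e: "itin ((f ^^ k) x) = itin x"
    have "(f ^^ k) x \<in> V" "x \<in> V" using x fp_branch[OF x] by (auto simp: V_def)
    then obtain n where "sy ((f ^^ n) ((f ^^ k) x)) \<noteq> sy ((f ^^ n) x)"
      using expand least[OF k] by blast
    then show False using fun_cong[OF e, of n] by (simp add: itin_def)
  qed
qed

lemma evil_orbitE:
  assumes "has_evil_orbit T f m"
  obtains w where "char_branch T f c w m" "(F ^^ m) (w, arm w c) = (w, arm w c)"
proof -
  obtain P where P: "branch_orbit T f m P" "\<not> tame T f P" using assms by (auto simp: has_evil_orbit_def)
  obtain x where x: "m \<ge> 1" "P = {(f ^^ k) x | k. k < m}" "(f ^^ m) x = x"
    "\<And>k. \<lbrakk>1 \<le> k; k < m\<rbrakk> \<Longrightarrow> (f ^^ k) x \<noteq> x"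
    using P(1) unfolding branch_orbit_def periodic_orbit_def by blast
  have "x \<in> P" unfolding x(2) using x(1) by (auto intro: exI[of _ 0])
  then have xb: "x \<in> branch_points T" using P(1) by (auto simp: branch_orbit_def)
  interpret periodic_point T f c x m
    by (rule branch_periodic_pointI[OF xb x(1,3,4)])
  have PO: "P = orb" using x(2) by (simp add: orb_def)
  obtain w where w: "w \<in> orb" "char_branch T f c w m" using char_branch_exists[OF xb] .
  interpret w: char_branch T f c w m by (rule w(2))
  have "w.orb = orb" using orbit_point(2)[OF w(1)] .
  then have "\<not> tame T f w.orb" using P(2) PO by simp
  then have "w.ret w.G0 = w.G0" using w.evil_iff by blast
  then show ?thesis using that[OF w(2)] w.ret[of w.G0] by simp
qed

theorem has_evil_imp_fails:
  assumes "has_evil_orbit T f m" shows "fails_admissibility nu m"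
proof -
  obtain w where w: "char_branch T f c w m" "(F ^^ m) (w, arm w c) = (w, arm w c)"
    using evil_orbitE[OF assms] .
  interpret w: char_branch T f c w m by (rule w(1))
  show ?thesis by (rule w.evil_imp_fails) (use w.ret[of w.G0] w(2) in simp)
qed

end

section \<open>Violation of admissibility forces evil orbits\<close>

context hubbard
begin

lemma nu_Star_iff: "nu (Suc j) = Star \<longleftrightarrow> (f ^^ Suc j) c = c"
  using nu_Suc[of j] by (simp add: funpow_swap1)

text \<open>A star in the first \<open>m\<close> entries would force the \<open>\<rho>\<close>-orbits to stop at multiples of the
  period of the critical point.\<close>

lemma fails_no_star:
  assumes m: "m \<ge> 1" and fails: "fails_admissibility nu m" and j: "j < m"
  shows "nu (Suc j) \<noteq> Star"
proof
  assume "nu (Suc j) = Star"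
  then have ex: "\<exists>p. nu (Suc p) = Star" by blast
  define p where "p = (LEAST p. nu (Suc p) = Star)"
  have p: "nu (Suc p) = Star" unfolding p_def using LeastI_ex[OF ex] .
  have least: "nu (Suc i) \<noteq> Star" if "i < p" for i using not_less_Least that unfolding p_def by blast
  have "p \<le> j" using least \<open>nu (Suc j) = Star\<close> by (metis not_le)
  then have nm: "Suc p \<le> m" using j by simp
  \<comment> \<open>The position of the first star is a period of \<open>c\<close>, hence of the
    kneading sequence.\<close>
  define n where "n = Suc p"
  have n: "n \<ge> 1" "n \<le> m" "nu n = Star" using p nm by (auto simp: n_def)
  have nz: "nu i \<noteq> Star" if "1 \<le> i" "i < n" for i using least[of "i - 1"] that by (simp add: n_def)
  have cn: "(f ^^ n) c = c" using p nu_Star_iff[of p] by (simp add: n_def)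
  have per: "nu (Suc i + n) = nu (Suc i)" for i
  proof -
    have "(f ^^ (i + n)) (f c) = (f ^^ i) (f ((f ^^ n) c))"
      by (simp add: funpow_add funpow_swap1)
    then have "(f ^^ (i + n)) (f c) = (f ^^ i) (f c)" using cn by simp
    then show ?thesis using nu_Suc[of "i + n"] nu_Suc[of i] by simp
  qed
  have per': "nu (i + n) = nu i" if "1 \<le> i" for i using per[of "i - 1"] that by simp
  \<comment> \<open>An orbit starting at or below \<open>n\<close> cannot jump over the star at
    \<open>n\<close>, as no earlier entry is a star, and it stops at \<open>n\<close> because
    \<open>n\<close> is a period of \<open>nu\<close>.\<close>
  have bound: "k \<le> n" if "k \<in> rho_orbit nu r" "r \<le> n" "1 \<le> r" for k r
    using that
  proof (induction rule: rho_orbit.induct)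
    case (step l l')
    note rl = rho_enatD[OF step.hyps(2)]
    have ln: "l \<le> n" "1 \<le> l" using step rho_orbit_ge[OF step.hyps(1)] by auto
    show ?case
    proof (cases "l = n")
      case True
      have "nu (l' - n + n) = nu (l' - n)" by (rule per') (use rl(1) True in simp)
      moreover have "l' - n + n = l'" using rl(1) True by simp
      ultimately show ?thesis using rl(2) True by simp
    next
      case False
      have "nu (n - l) \<noteq> Star" by (rule nz) (use ln False in auto)
      then have "nu n \<noteq> nu (n - l)" using n(3) by simp
      then show ?thesis using rl(3)[of n] ln False by (metis le_neq_implies_less not_le)
    qed
  qed
  have n_in: "n \<in> rho_orbit nu 1"
  proof (rule ccontr)
    assume "n \<notin> rho_orbit nu 1"
    then obtain k where k: "1 \<le> k" "k < n" "\<And>j. \<lbrakk>k < j; j \<le> n\<rbrakk> \<Longrightarrow> nu j = nu (j - k)"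
      using rho_orbit_last[OF n(1)] by metis
    then have "nu (n - k) \<noteq> Star" by (intro nz) auto
    then show False using k(3)[of n] k(2) n(3) by simp
  qed
  have "n \<noteq> m" using n_in fails by (auto simp: fails_admissibility_def internal_address_def)
  then have nm: "n < m" using n by simp
  show False
  proof (cases "n dvd m")
    case True
    then have "rho nu n \<le> enat m" using fails n nm by (auto simp: fails_admissibility_def)
    then obtain j where j: "n < j" "nu j \<noteq> nu (j - n)" using rho_le_iff by blast
    then have "nu (j - n + n) = nu (j - n)" by (intro per') auto
    then show False using j by simp
  next
    case False
    define a b where "a = m div n" and "b = m mod n"
    have mab: "m = a * n + b" "0 < b" "b < n" using False n(1) by (auto simp: a_def b_def dvd_eq_mod_eq_0)
    have star: "nu (Suc i * n) = Star" for i
    proof (induction i)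
      case (Suc i)
      have "nu (Suc i * n + n) = nu (Suc i * n)" by (rule per') (use n(1) in simp)
      then show ?case using Suc by (simp add: add.commute)
    qed (use n in simp)
    \<comment> \<open>\<open>s\<close> is the first multiple of \<open>n\<close> beyond
      \<open>m\<close>. Entry \<open>s\<close> is a star and entry \<open>s - m\<close> is not, so
      rho(m) is at most \<open>s\<close> and its residue at most \<open>n\<close>, too small for its
      orbit to reach \<open>m\<close>.\<close>
    define s where "s = Suc a * n"
    have s: "m < s" "s - m = n - b" "s \<le> m + n" using mab by (auto simp: s_def)
    have "nu (n - b) \<noteq> Star" by (rule nz) (use mab in auto)
    then have "nu s \<noteq> nu (s - m)" using star[of a] s(2) by (simp add: s_def)
    then have "rho nu m \<le> enat s" using rho_le_iff s(1) by blast
    moreover obtain k where k: "rho nu m = enat k"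
      "\<And>r. \<lbrakk>r \<in> {1..m}; r mod m = k mod m\<rbrakk> \<Longrightarrow> m \<in> rho_orbit nu r"
      using fails by (auto simp: fails_admissibility_def)
    ultimately have ks: "k \<le> s" by simp
    have km: "m < k" using rho_enatD(1)[OF k(1)] .
    have r: "k - m \<in> {1..m}" "k - m \<le> n" using ks km s nm mab by auto
    have "(k - m) mod m = k mod m" using km by (simp add: le_mod_geq)
    then have "m \<in> rho_orbit nu (k - m)" using k(2) r by blast
    then have "m \<le> n" using bound r by simp
    then show False using nm by simp
  qed
qed

end

section \<open>The periodic word and the reset times of a failing period\<close>

locale failing = hubbard T f c for T :: "'a::t2_space set" and f c +
  fixes m :: nat
  assumes m: "m \<ge> 1" and fails: "fails_admissibility nu m"
begin

text \<open>Indexed from 0 like \<open>itin\<close>, whereas \<open>nu\<close> is indexed from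
  1.\<close>

definition W :: "nat \<Rightarrow> symbol" where "W n = nu (Suc (n mod m))"

lemma W_nu: "j < m \<Longrightarrow> W j = nu (Suc j)" by (simp add: W_def)

lemma W_per: "W (n + m) = W n" by (simp add: W_def)

lemma W_per_mult: "W (n + k * m) = W n" by (simp add: W_def)

lemma W_mod: "W (n mod m) = W n" by (simp add: W_def)

lemma W_not_Star: "W n \<noteq> Star"
  using fails_no_star[OF m fails, of "n mod m"] m by (simp add: W_def)

lemma m_address: "m \<notin> rho_orbit nu 1"
  using fails by (simp add: fails_admissibility_def internal_address_def)

lemma m2: "m \<ge> 2"
  using m m_address rho_orbit.start[of 1 nu] by (cases "m = 1") auto

text \<open>By Bezout a period \<open>k\<close> would produce the period \<open>gcd k m\<close>, a
  proper divisor of \<open>m\<close>, against the second condition of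
  \<open>fails_admissibility\<close>.\<close>

lemma W_exact:
  assumes k: "1 \<le> k" "k < m" shows "\<exists>n. W (k + n) \<noteq> W n"
proof (rule ccontr)
  assume "\<not> ?thesis"
  then have eq: "W (k + n) = W n" for n by blast
  have eqx: "W (n + k * x) = W n" for n x
  proof (induction x)
    case (Suc x)
    have "W (n + k * Suc x) = W (k + (n + k * x))" by (simp add: ac_simps)
    then show ?case using eq Suc by simp
  qed simp
  define g where "g = gcd k m"
  have g: "1 \<le> g" "g < m" "g dvd m"
  proof -
    have "gcd k m \<le> k" by (rule gcd_le1_nat) (use k in simp)
    then show "g < m" unfolding g_def using k(2) by (rule le_less_trans)
    show "1 \<le> g" "g dvd m" using k by (auto simp: g_def Suc_le_eq)
  qed
  obtain x y where xy: "k * x = m * y + g" using bezout_nat[of k m] k unfolding g_def by auto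
  have eqg: "W (n + g) = W n" for n
  proof -
    have "W (n + g) = W (n + g + y * m)" using W_per_mult by simp
    also have "n + g + y * m = n + k * x" using xy by (simp add: ac_simps)
    finally show ?thesis using eqx by simp
  qed
  have "rho nu g \<le> enat m" using fails g by (auto simp: fails_admissibility_def)
  then obtain j where j: "g < j" "j \<le> m" "nu j \<noteq> nu (j - g)" using rho_le_iff by blast
  have "Suc (j - 1) = j" "Suc (j - g - 1) = j - g" using j by auto
  then have "nu j = W (j - 1)" "nu (j - g) = W (j - g - 1)"
    using W_nu[of "j - 1"] W_nu[of "j - g - 1"] j(1,2) by auto
  moreover have "W (j - g - 1 + g) = W (j - g - 1)" by (rule eqg)
  moreover have "j - g - 1 + g = j - 1" using j by simp
  ultimately show False using j(3) by simp
qed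

definition n0 :: nat where "n0 = (THE k. rho nu m = enat k)"

lemma rho_m: "rho nu m = enat n0"
  using fails by (auto simp: fails_admissibility_def n0_def)

lemmas n0_gt = rho_enatD(1)[OF rho_m]

lemma W_nu_pre: "Suc j < n0 \<Longrightarrow> W j = nu (Suc j)"
proof (induction j rule: less_induct)
  case (less j)
  show ?case
  proof (cases "j < m")
    case False
    then have "W j = W (j - m)" using W_per[of "j - m"] by simp
    also have "\<dots> = nu (Suc (j - m))" using less False m by simp
    also have "\<dots> = nu (Suc j)"
      using rho_enatD(3)[OF rho_m, of "Suc j"] False less.prems by (simp add: Suc_diff_le)
    finally show ?thesis .
  qed (rule W_nu)
qed

lemma W_n0: "W (n0 - 1) \<noteq> nu n0"
proof -
  have "W (n0 - 1) = W (n0 - 1 - m)" using W_per[of "n0 - 1 - m"] n0_gt by simp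
  also have "\<dots> = nu (Suc (n0 - 1 - m))" using W_nu_pre[of "n0 - 1 - m"] n0_gt m by simp
  also have "Suc (n0 - 1 - m) = n0 - m" using n0_gt by simp
  finally show ?thesis using rho_enatD(2)[OF rho_m] by simp
qed

text \<open>Dividing \<open>n0 - 1\<close> and not \<open>n0\<close> places \<open>r\<close> in
  \<open>{1..m}\<close>, the range of residues in \<open>fails_admissibility\<close>.\<close>

definition t :: nat where "t = (n0 - 1) div m"
definition r :: nat where "r = Suc ((n0 - 1) mod m)"

lemma n0_tr: "n0 = t * m + r" using n0_gt by (simp add: t_def r_def)

lemma r_bounds: "1 \<le> r" "r \<le> m"
  using m mod_less_divisor[of m "n0 - 1"] by (simp_all add: r_def Suc_le_eq)

lemma t_ge: "t \<ge> 1"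
  unfolding t_def using div_le_mono[of m "n0 - 1" m] n0_gt m by simp

lemma r_orbit: "m \<in> rho_orbit nu r"
proof -
  have "r mod m = n0 mod m" unfolding n0_tr by simp
  moreover have "\<exists>n. rho nu m = enat n \<and> (\<forall>r\<in>{1..m}. r mod m = n mod m \<longrightarrow> m \<in> rho_orbit nu r)"
    using fails by (simp add: fails_admissibility_def)
  ultimately show ?thesis using r_bounds rho_m by auto
qed

text \<open>The pointer started at the critical value and steered by \<open>W\<close> is reset at time \<open>n0\<close> and back at
  the critical value at time \<open>(t + 1) m\<close>; \<open>v\<close> is its position at time \<open>t m\<close>.\<close>

definition v :: 'a where "v = (f ^^ (t * m)) (f c)"

abbreviation "P \<equiv> ptr W v"

lemma vT: "v \<in> T" unfolding v_def using fpT[OF fcT] .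

lemma PT: "P n \<in> T" using ptr_T[OF vT] .

lemma P_follow: "n < r \<Longrightarrow> P n = (f ^^ n) v"
proof (rule ptr_follow)
  fix i assume i: "n < r" "i < n"
  have "sy ((f ^^ i) v) = nu (Suc (i + t * m))" by (simp add: v_def nu_Suc funpow_add)
  also have "\<dots> = W (i + t * m)" using W_nu_pre[of "i + t * m"] i n0_tr by simp
  finally show "sy ((f ^^ i) v) = W i" using W_per_mult by simp
qed

lemma P_reset: "P r = f c" "sy (P (r - 1)) \<noteq> W (r - 1)"
proof -
  obtain r' where r': "r = Suc r'" using r_bounds by (cases r) auto
  have "sy (P r') = nu (Suc (r' + t * m))" using P_follow[of r'] r' by (simp add: v_def nu_Suc funpow_add)
  also have "Suc (r' + t * m) = n0" using n0_tr r' by simp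
  finally have 1: "sy (P r') = nu n0" .
  have "n0 - 1 = r' + t * m" using n0_tr r' by simp
  then have "W (n0 - 1) = W r'" using W_per_mult by simp
  then have "sy (P r') \<noteq> W r'" using W_n0 1 by simp
  then show "P r = f c" "sy (P (r - 1)) \<noteq> W (r - 1)" using r' by (auto simp: nxt_def)
qed

text \<open>The last condition of \<open>fails_admissibility\<close> puts \<open>m\<close> among the
  reset times after \<open>r\<close>. That this arrival is a reset, with a disagreement one step
  before, is what \<open>no_reset\<close> plays against.\<close>

lemma P_m: "P m = f c" "sy (P (m - 1)) \<noteq> W (m - 1)"
proof -
  have P: "P (r + i) = ptr (\<lambda>i. W (r + i)) (f c) i" for i
    unfolding ptr_add P_reset(1) ..
  have key: "ptr (\<lambda>i. W (r + i)) (f c) (m - r) = f c \<and>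
      (m \<noteq> r \<longrightarrow> sy (ptr (\<lambda>i. W (r + i)) (f c) (m - r - 1)) \<noteq> W (m - 1))"
    using ptr_rho_orbit[OF W_nu r_orbit order_refl r_bounds(1)] by blast
  show "P m = f c" using P[of "m - r"] key r_bounds by simp
  show "sy (P (m - 1)) \<noteq> W (m - 1)"
  proof (cases "m = r")
    case False
    then have "r + (m - r - 1) = m - 1" using r_bounds by simp
    then show ?thesis using P[of "m - r - 1"] key False by simp
  qed (use P_reset in simp)
qed

section \<open>Points sharing the first m symbols\<close>

definition K :: "'a set" where "K = {x \<in> T. \<forall>i<m. (f ^^ i) x \<in> side (W i)}"

text \<open>\<open>U\<close> is open in \<open>T\<close> and \<open>K\<close> closed. A point of
  \<open>K\<close> outside \<open>U\<close> passes through \<open>c\<close> before time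
  \<open>m\<close>; the gate point may be of this kind.\<close>

definition U :: "'a set" where "U = {x \<in> T. \<forall>i<m. itin x i = W i}"

lemma K_T: "x \<in> K \<Longrightarrow> x \<in> T" by (simp add: K_def)

lemma U_K: "x \<in> U \<Longrightarrow> x \<in> K" using fpT by (auto simp: K_def U_def side_def itin_def)

lemma cont_fp: "continuous_on T (f ^^ n)"
proof (induction n)
  case 0 then show ?case by (simp add: continuous_on_id' id_def)
next
  case (Suc n)
  have "continuous_on T (f \<circ> (f ^^ n))"
    by (rule continuous_on_compose[OF Suc continuous_on_subset[OF cont_f]]) (use fpT in auto)
  then show ?case by simp
qed

lemma closed_K: "closed K"
proof -
  have cl: "closed {x \<in> T. (f ^^ i) x \<in> side (W i)}" for i
  proof -
    have "closed (T \<inter> (f ^^ i) -` side (W i))"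
      by (rule continuous_closed_preimage[OF cont_fp closed_T closed_side[OF W_not_Star]])
    moreover have "T \<inter> (f ^^ i) -` side (W i) = {x \<in> T. (f ^^ i) x \<in> side (W i)}" by blast
    ultimately show ?thesis by simp
  qed
  have "K = T \<inter> (\<Inter>i\<in>{..<m}. {x \<in> T. (f ^^ i) x \<in> side (W i)})" by (auto simp: K_def)
  then show ?thesis using closed_T cl by (simp add: closed_Int closed_INT)
qed

lemma K_side: "\<lbrakk>x \<in> K; i < m\<rbrakk> \<Longrightarrow> (f ^^ i) x \<in> side (W i)" by (simp add: K_def)

lemma K_seg:
  assumes "x \<in> K" "y \<in> K" "w \<in> seg x y" "i \<le> m"
  shows "(f ^^ i) w \<in> seg ((f ^^ i) x) ((f ^^ i) y)"
  using assms(4)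
proof (induction i)
  case (Suc i)
  have "\<not> sep ((f ^^ i) x) ((f ^^ i) y)" by (rule side_sep[OF K_side K_side]) (use assms Suc.prems in auto)
  then show ?case
    using f_mem[OF fpT[OF K_T[OF assms(1)]] fpT[OF K_T[OF assms(2)]]] Suc by simp
qed (use assms in simp)

lemma K_convex: "\<lbrakk>x \<in> K; y \<in> K\<rbrakk> \<Longrightarrow> seg x y \<subseteq> K"
proof
  fix w assume a: "x \<in> K" "y \<in> K" "w \<in> seg x y"
  have "(f ^^ i) w \<in> side (W i)" if "i < m" for i
    using side_convex[OF K_side K_side K_seg] a that by simp
  moreover have "w \<in> T" using seg_in[OF a(3) K_T[OF a(1)] K_T[OF a(2)]] .
  ultimately show "w \<in> K" unfolding K_def by blast
qed

lemma U_open: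
  assumes "x \<in> U"
  obtains A where "open A" "x \<in> A" "\<And>y. \<lbrakk>y \<in> T; y \<in> A\<rbrakk> \<Longrightarrow> y \<in> U"
proof -
  have xT: "x \<in> T" using assms by (simp add: U_def)
  have "\<exists>A. open A \<and> x \<in> A \<and> (\<forall>y\<in>T. y \<in> A \<longrightarrow> itin y i = W i)" if i: "i < m" for i
  proof -
    have s: "sy ((f ^^ i) x) = W i" using assms i by (simp add: U_def itin_def)
    then have "(f ^^ i) x \<noteq> c" using W_not_Star[of i] sym_Star by metis
    then obtain B where B: "open B" "(f ^^ i) x \<in> B" "\<And>y. \<lbrakk>y \<in> T; y \<in> B\<rbrakk> \<Longrightarrow> sy y = sy ((f ^^ i) x)"
      using sym_open[OF fpT[OF xT]] by metis
    obtain A where A: "open A" "A \<inter> T = (f ^^ i) -` B \<inter> T"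
      using cont_fp B(1) continuous_on_open_invariant by metis
    have m: "y \<in> A \<longleftrightarrow> (f ^^ i) y \<in> B" if "y \<in> T" for y
    proof -
      have "y \<in> A \<inter> T \<longleftrightarrow> y \<in> (f ^^ i) -` B \<inter> T" using A(2) by simp
      then show ?thesis using that by simp
    qed
    have "itin y i = W i" if "y \<in> T" "y \<in> A" for y
      using B(3)[OF fpT[OF that(1)]] m[OF that(1)] that(2) s by (simp add: itin_def)
    then show ?thesis using A(1) m[OF xT] B(2) by blast
  qed
  then obtain A where A: "\<And>i. i < m \<Longrightarrow> open (A i) \<and> x \<in> A i \<and> (\<forall>y\<in>T. y \<in> A i \<longrightarrow> itin y i = W i)"
    by metis
  have "open (\<Inter>i\<in>{..<m}. A i)" using A by (intro open_INT) auto
  moreover have "x \<in> (\<Inter>i\<in>{..<m}. A i)" using A by blast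
  moreover have "y \<in> U" if "y \<in> T" "y \<in> (\<Inter>i\<in>{..<m}. A i)" for y
    using that A by (simp add: U_def)
  ultimately show ?thesis using that by blast
qed

definition a :: "nat \<Rightarrow> 'a" where "a i = (f ^^ (i * m)) (f c)"

lemma a0: "a 0 = f c" and a_t: "a t = v" by (simp_all add: a_def v_def)

lemma aT: "a i \<in> T" unfolding a_def using fpT[OF fcT] .

lemma a_Suc: "(f ^^ m) (a i) = a (Suc i)"
  by (simp add: a_def funpow_add)

lemma itin_a: "itin (a i) j = nu (Suc (i * m + j))"
  unfolding a_def itin_shift by (simp add: itin_def nu_Suc)

lemma a_U: "i < t \<Longrightarrow> a i \<in> U"
proof -
  assume i: "i < t"
  have "itin (a i) j = W j" if j: "j < m" for j
  proof -
    have "Suc i * m \<le> t * m" using mult_le_mono1[OF Suc_leI[OF i], of m] .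
    then have "Suc (i * m + j) < n0" using j n0_tr r_bounds by simp
    then have "nu (Suc (i * m + j)) = W (i * m + j)" using W_nu_pre by simp
    then show ?thesis using itin_a W_per_mult[of j i] by (simp add: add.commute)
  qed
  then show ?thesis using aT by (simp add: U_def)
qed

lemma c1_U: "f c \<in> U" using a_U[of 0] t_ge a0 by simp

end

lemma (in top_tree) median_branch:
  assumes w: "w \<in> seg x y" "w \<in> seg y z" "w \<in> seg x z" and ne: "w \<noteq> x" "w \<noteq> y" "w \<noteq> z"
    and T: "x \<in> T" "y \<in> T" "z \<in> T"
  shows "w \<in> branch_points T"
proof -
  have wT: "w \<in> T" using seg_in[OF w(1) T(1,2)] .
  have "arm w x \<noteq> arm w y" "arm w y \<noteq> arm w z" "arm w x \<noteq> arm w z"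
    using arm_eq_iff[OF wT T(1,2)] arm_eq_iff[OF wT T(2,3)] arm_eq_iff[OF wT T(1,3)] w ne by auto
  then have "card {arm w x, arm w y, arm w z} = 3" by simp
  moreover have "card {arm w x, arm w y, arm w z} \<le> card (arms T w)"
    by (rule card_mono[OF finite_arms]) (use arm_in_arms T ne in auto)
  ultimately show ?thesis using wT by (simp add: branch_points_def)
qed

text \<open>The median of \<open>p\<close>, \<open>x\<close> and \<open>y\<close> lies on the
  segments from \<open>q\<close> as well, so uniqueness of medians identifies it with
  \<open>w\<close>. This is how an image of the gate is replaced by the gate.\<close>

lemma (in top_tree) median_gate:
  assumes w: "w \<in> seg q x" "w \<in> seg x y" "w \<in> seg q y" and p: "p \<in> seg x q" "p \<in> seg y q"
    and T: "x \<in> T" "y \<in> T" "q \<in> T"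
  shows "w \<in> seg p x" "w \<in> seg p y"
proof -
  have pT: "p \<in> T" using seg_in[OF p(1) T(1,3)] .
  have p': "p \<in> seg q x" "p \<in> seg q y" using p seg_sym T by auto
  obtain u where u: "u \<in> seg p x" "u \<in> seg x y" "u \<in> seg p y" using median_exists[OF pT T(1,2)] .
  have "u \<in> seg q x" "u \<in> seg q y"
    using seg_sub2[OF u(1) p'(1) T(3,1)] seg_sub2[OF u(3) p'(2) T(3,2)] by auto
  then have "w = u" using median_unique[of u q x y w] u(2) w T by blast
  then show "w \<in> seg p x" "w \<in> seg p y" using u by auto
qed

section \<open>The gate point and the majority vote\<close>

locale failing_gate = failing T f c m for T :: "'a::t2_space set" and f c m +
  fixes p :: 'a
  assumes pK: "p \<in> K" and p_seg: "p \<in> seg (f c) ((f ^^ m) p)" and p_gate: "seg p ((f ^^ m) p) \<inter> K = {p}"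
begin

abbreviation "q \<equiv> (f ^^ m) p"

lemma sy_W: "sy x = W n \<Longrightarrow> x \<noteq> c"
  using W_not_Star[of n] sym_Star[of x] by metis

lemma pT: "p \<in> T" using K_T pK .
lemma qT: "q \<in> T" using fpT pT .

text \<open>The median of \<open>x\<close>, \<open>p\<close> and \<open>q\<close> is in
  \<open>K\<close> by convexity and on \<open>seg p q\<close>, where \<open>p\<close> is the only
  point of \<open>K\<close>.\<close>

lemma K_gate: assumes x: "x \<in> K" shows "p \<in> seg x q"
proof -
  obtain w where w: "w \<in> seg x p" "w \<in> seg p q" "w \<in> seg x q"
    using median_exists[OF K_T[OF x] pT qT] .
  have "w \<in> seg p q \<inter> K" using w(1,2) K_convex[OF x pK] by blast
  then have "w = p" using p_gate by simp
  then show ?thesis using w(3) by simp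
qed

lemma sy_c1: "n < m \<Longrightarrow> sy ((f ^^ n) (f c)) = W n"
  using W_nu nu_Suc by simp

text \<open>A disagreement at time \<open>n\<close> would reset the pointer to the critical value
  just when \<open>p\<close> arrives there. From then on both move together with the prescribed
  symbols, and the disagreement at time \<open>m - 1\<close> known from \<open>P_m\<close> could not
  occur.\<close>

lemma no_reset:
  assumes n: "n < m" "(f ^^ n) p = c" shows "sy (P n) = W n"
proof (rule ccontr)
  assume "sy (P n) \<noteq> W n"
  then have Pk: "P (Suc n) = f c" by (simp add: nxt_def)
  have fk: "(f ^^ Suc n) p = f c" using n(2) by simp
  show False
  proof (cases "Suc n = m")
    case True
    \<comment> \<open>Here \<open>p_seg\<close> collapses and forces \<open>p = f c\<close>; but the
      critical value does not meet \<open>c\<close> before time \<open>m\<close>.\<close>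
    then have "q = f c" using fk by simp
    then have "p = f c" using p_seg by simp
    then have "sy c = W n" using sy_c1[OF n(1)] n(2) by simp
    then show False using sy_W by blast
  next
    case False
    define k where "k = Suc n"
    have k: "k < m" using n(1) False by (simp add: k_def)
    define i where "i = m - 1 - k"
    have P: "P (k + i) = ptr (\<lambda>j. W (k + j)) (f c) i" unfolding ptr_add using Pk by (simp add: k_def)
    have sy: "sy ((f ^^ j) (f c)) = W (k + j)" if j: "j < m - k" for j
    proof -
      have "(f ^^ (k + j)) p = (f ^^ (j + k)) p" by (simp only: add.commute)
      also have "\<dots> = (f ^^ j) (f c)" unfolding funpow_add comp_apply k_def fk ..
      finally have "(f ^^ j) (f c) \<in> side (W (k + j))" using K_side[OF pK, of "k + j"] j by simp
      moreover have "(f ^^ j) (f c) \<noteq> c" using sy_W[OF sy_c1, of j] j by simp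
      ultimately show ?thesis by (simp add: side_def)
    qed
    have "ptr (\<lambda>j. W (k + j)) (f c) i = (f ^^ i) (f c)"
      by (rule ptr_follow) (use sy k in \<open>simp add: i_def\<close>)
    then have "sy (P (k + i)) = W (k + i)" using P sy[of i] k by (simp add: i_def)
    moreover have "k + i = m - 1" using k by (simp add: i_def)
    ultimately show False using P_m(2) by simp
  qed
qed

text \<open>Off \<open>c\<close> the prescribed symbols form an open condition, so
  \<open>seg p q\<close> would stay in \<open>K\<close> near \<open>p\<close>, contrary to the gate
  property.\<close>

lemma q_neq_p:
  assumes "q \<noteq> p" shows "\<exists>n<m. (f ^^ n) p = c"
proof (rule ccontr)
  assume no: "\<not> ?thesis"
  have "itin p i = W i" if "i < m" for i
    using K_side[OF pK that] no that by (auto simp: side_def itin_def)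
  then have "p \<in> U" using pT by (simp add: U_def)
  then obtain A where A: "open A" "p \<in> A" "\<And>y. \<lbrakk>y \<in> T; y \<in> A\<rbrakk> \<Longrightarrow> y \<in> U" using U_open by metis
  obtain y where y: "y \<in> seg p q" "y \<noteq> p" "seg p y \<subseteq> A"
    using seg_initial[OF pT qT assms[symmetric] A(1,2)] by metis
  have yT: "y \<in> T" using seg_in[OF y(1) pT qT] .
  have "y \<in> A" using y(3) seg_ends(2)[OF pT yT] by blast
  then have "y \<in> K" using A(3)[OF yT] U_K by blast
  then have "y \<in> seg p q \<inter> K" using y(1) by blast
  then show False using p_gate y(2) by simp
qed

text \<open>For the resets: the segment to the old pointer can be cut at \<open>c\<close> without
  losing \<open>y\<close>.\<close>

lemma seg_upto_c:
  assumes T: "x \<in> T" "u \<in> T" "y \<in> T" and c: "c \<in> seg x u" and y: "y \<in> seg x u"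
    and s: "sy y = sy x" "x \<noteq> c" "y \<noteq> c"
  shows "y \<in> seg x c"
proof (rule ccontr)
  assume n: "y \<notin> seg x c"
  then have "y \<in> seg c u" using seg_split(1)[OF c T(1,2)] y by blast
  then have "y \<in> seg u c" "c \<in> seg u x" using c seg_sym cT T by auto
  then have "c \<in> seg y x" using seg_mid[of y u c x] T by blast
  then show False using sym_eq_iff[OF T(3,1) s(3,2)] s(1) by simp
qed

text \<open>Otherwise \<open>p\<close> lies between the critical value and \<open>v\<close>. This
  persists along the pointer until \<open>p\<close> first meets \<open>c\<close>; at that time both
  ends have symbol \<open>W n\<close>, the pointer by \<open>no_reset\<close>, so \<open>c\<close>
  cannot lie between them.\<close>

lemma v_gate: "p \<in> seg v q"
proof (cases "q = p")
  case True then show ?thesis using seg_ends[OF vT pT] by simp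
next
  case False
  then have ex: "\<exists>n. n < m \<and> (f ^^ n) p = c" using q_neq_p by blast
  define n where "n = (LEAST n. n < m \<and> (f ^^ n) p = c)"
  have n: "n < m" "(f ^^ n) p = c" using LeastI_ex[OF ex] unfolding n_def by auto
  have least: "(f ^^ i) p \<noteq> c" if "i < n" for i
    using not_less_Least[OF that[unfolded n_def]] that n(1) by auto
  show ?thesis
  proof (rule ccontr)
    assume "p \<notin> seg v q"
    then have start: "p \<in> seg (f c) v" using seg_trans[OF p_seg fcT qT vT] by blast
    have "j \<le> n \<Longrightarrow> (f ^^ j) p \<in> seg ((f ^^ j) (f c)) (P j)" for j
    proof (induction j)
      case (Suc j)
      then have j: "j < n" "j < m" using n(1) by auto
      define x y u where xyu: "x = (f ^^ j) (f c)" "y = (f ^^ j) p" "u = P j"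
      have T: "x \<in> T" "u \<in> T" "y \<in> T" using fpT[OF fcT] fpT[OF pT] PT by (simp_all add: xyu)
      have IH: "y \<in> seg x u" using Suc by (simp add: xyu)
      have y: "sy y = W j" "y \<noteq> c" using K_side[OF pK j(2)] least[OF j(1)] by (auto simp: xyu side_def)
      have x: "sy x = W j" using sy_c1[OF j(2)] by (simp add: xyu)
      then have xc: "x \<noteq> c" by (rule sy_W)
      have "f y \<in> seg (f x) (nxt (W j) u)"
      proof (cases "sy u = W j")
        case True
        then have "\<not> sep x u" using sep_iff[OF T(1,2)] x by simp
        then show ?thesis using f_mem[OF T(1,2) _ IH] True by (simp add: nxt_def)
      next
        case False
        have "c \<in> seg x u" by (rule c_in_seg) (use T x False in auto)
        then have "y \<in> seg x c" using seg_upto_c[OF T _ IH] x y xc by simp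
        then have "f y \<in> seg (f x) (f c)" using f_mem[OF T(1) cT] by (simp add: sep_def)
        then show ?thesis using False by (simp add: nxt_def)
      qed
      then show ?case by (simp add: xyu)
    qed (use start in simp)
    from this[of n] have cs: "c \<in> seg ((f ^^ n) (f c)) (P n)" using n(2) by simp
    have x: "sy ((f ^^ n) (f c)) = W n" using sy_c1[OF n(1)] .
    have "sy (P n) = W n" using no_reset[OF n] .
    then have "(f ^^ n) (f c) \<noteq> c" "P n \<noteq> c" using sy_W x by blast+
    then show False
      using sym_eq_iff[of "(f ^^ n) (f c)" "P n"] fpT[OF fcT] PT x \<open>sy (P n) = W n\<close> cs by simp
  qed
qed

lemma a_gate: "i \<le> t \<Longrightarrow> p \<in> seg (a i) q"
  using v_gate a_t K_gate[OF U_K[OF a_U[of i]]] by (cases "i = t") auto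

definition med :: "'a \<Rightarrow> 'a \<Rightarrow> 'a \<Rightarrow> 'a \<Rightarrow> bool" where
  "med p' y x u \<longleftrightarrow> y \<in> seg p' x \<and> y \<in> seg x u \<and> y \<in> seg p' u"

text \<open>At every time at most one of the three pointers disagrees with \<open>W\<close>, so the median follows
  the majority.\<close>

lemma med_step:
  assumes x: "x \<in> U" and u: "u \<in> T" and good: "\<And>n. \<lbrakk>n < m; (f ^^ n) p = c\<rbrakk> \<Longrightarrow> sy (ptr W u n) = W n"
    and y: "med p y x u"
  shows "n \<le> m \<Longrightarrow> med ((f ^^ n) p) ((f ^^ n) y) ((f ^^ n) x) (ptr W u n) \<and> (\<forall>i<n. sy ((f ^^ i) y) = W i)"
proof (induction n)
  case (Suc n)
  then have n: "n < m" by simp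
  define p' x' y' u' where d: "p' = (f ^^ n) p" "x' = (f ^^ n) x" "y' = (f ^^ n) y" "u' = ptr W u n"
  have xT: "x \<in> T" using x by (simp add: U_def)
  have yT: "y \<in> T" using y seg_in pT xT unfolding med_def by blast
  have T: "p' \<in> T" "x' \<in> T" "y' \<in> T" "u' \<in> T"
    using fpT[OF pT] fpT[OF xT] fpT[OF yT] ptr_T[OF u] by (simp_all add: d)
  have IH: "y' \<in> seg p' x'" "y' \<in> seg x' u'" "y' \<in> seg p' u'" "\<forall>i<n. sy ((f ^^ i) y) = W i"
    using Suc n by (auto simp: med_def d)
  have sx: "sy x' = W n" using x n by (simp add: U_def d itin_def)
  then have xc: "x' \<noteq> c" by (rule sy_W)
  have xs: "x' \<in> side (W n)" using sx T by (simp add: side_def)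
  have ps: "p' \<in> side (W n)" using K_side[OF pK n] by (simp add: d)
  have px: "\<not> sep p' x'" using side_sep[OF ps xs] .
  have ys: "y' \<in> side (W n)" using side_convex[OF ps xs IH(1)] .
  have "sy y' = W n \<and> f y' \<in> seg (f x') (nxt (W n) u') \<and> f y' \<in> seg (f p') (nxt (W n) u')"
  proof (cases "sy u' = W n")
    case True
    then have us: "u' \<in> side (W n)" using T by (simp add: side_def)
    have uc: "u' \<noteq> c" using True by (rule sy_W)
    have "c \<notin> seg x' u'" using sym_eq_iff[OF T(2,4) xc uc] sx True by simp
    then have "y' \<noteq> c" using IH(2) by auto
    then have "sy y' = W n" using ys by (simp add: side_def)
    moreover have "f y' \<in> seg (f x') (f u')" "f y' \<in> seg (f p') (f u')"
      using f_mem[OF T(2,4) side_sep[OF xs us] IH(2)] f_mem[OF T(1,4) side_sep[OF ps us] IH(3)] by auto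
    ultimately show ?thesis using True by (simp add: nxt_def)
  next
    case False
    then have "p' \<noteq> c" using good[OF n] by (auto simp: d)
    then have sp: "sy p' = W n" using ps by (simp add: side_def)
    have "c \<notin> seg p' x'" using sym_eq_iff[OF T(1,2) \<open>p' \<noteq> c\<close> xc] sp sx by simp
    then have yc: "y' \<noteq> c" using IH(1) by auto
    then have sy': "sy y' = W n" using ys by (simp add: side_def)
    have "c \<in> seg x' u'" "c \<in> seg p' u'" using c_in_seg[OF T(2,4)] c_in_seg[OF T(1,4)] sx sp False by auto
    then have "y' \<in> seg x' c" "y' \<in> seg p' c"
      using seg_upto_c[OF T(2,4,3) _ IH(2)] seg_upto_c[OF T(1,4,3) _ IH(3)] sy' sx sp xc yc \<open>p' \<noteq> c\<close> by auto
    then have "f y' \<in> seg (f x') (f c)" "f y' \<in> seg (f p') (f c)"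
      using f_mem[OF T(2) cT] f_mem[OF T(1) cT] by (auto simp: sep_def)
    then show ?thesis using sy' False by (simp add: nxt_def)
  qed
  moreover have "f y' \<in> seg (f p') (f x')" using f_mem[OF T(1,2) px IH(1)] .
  ultimately show ?case using IH(4) by (auto simp: med_def d less_Suc_eq)
qed (use y in simp)

text \<open>Consecutive points of \<open>a 0\<close>, ..., \<open>a t\<close>, closed up by the pair
  of \<open>a 0\<close> and \<open>v = a t\<close>. Up to order, one period maps a pair to the next
  one, because the pointer of \<open>v\<close> returns to \<open>a 0\<close>. The first member is
  never \<open>v\<close>, so it lies in \<open>U\<close>.\<close>

definition PR :: "'a \<Rightarrow> 'a \<Rightarrow> bool" where
  "PR x u \<longleftrightarrow> (\<exists>i<t. x = a i \<and> u = a (Suc i)) \<or> (x = a 0 \<and> u = v)"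

lemma med_sym: "\<lbrakk>x \<in> T; u \<in> T\<rbrakk> \<Longrightarrow> med p y x u \<longleftrightarrow> med p y u x"
  unfolding med_def using seg_sym[of x u] by auto

lemma PR_T: "PR x u \<Longrightarrow> x \<in> T \<and> u \<in> T"
  using aT vT by (auto simp: PR_def)

lemma ptr_U: "\<lbrakk>u \<in> U; n \<le> m\<rbrakk> \<Longrightarrow> ptr W u n = (f ^^ n) u"
  by (rule ptr_follow) (auto simp: U_def itin_def)

lemma ptr_v_m: "ptr W v m = a 0" using P_m(1) a0 by simp

lemma PR_next:
  assumes PR: "PR x u" and y: "med p y x u"
  shows "y \<in> U \<and> (\<exists>x' u'. PR x' u' \<and> med p ((f ^^ m) y) x' u')"
proof -
  have xu: "x \<in> T" "u \<in> T" using PR_T[OF PR] by auto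
  have yT: "y \<in> T" using y seg_in[OF _ pT xu(1)] by (auto simp: med_def)
  have good_a: "sy (ptr W (a i) n) = W n" if i: "i \<le> t" and n: "n < m" "(f ^^ n) p = c" for i n
  proof (cases "i = t")
    case True then show ?thesis using no_reset[OF n] a_t by simp
  next
    case False
    then have "a i \<in> U" using a_U i by simp
    then show ?thesis using ptr_U[of "a i" n] n(1) by (simp add: U_def itin_def)
  qed
  have *: "y \<in> U \<and> med p ((f ^^ m) y) (a (Suc i)) (ptr W (a j) m)"
    if i: "i < t" "x = a i" and j: "j \<le> t" "u = a j" and k: "k \<le> t" "ptr W (a j) m = a k" for i j k
  proof -
    have M: "med q ((f ^^ m) y) ((f ^^ m) x) (ptr W u m) \<and> (\<forall>i<m. sy ((f ^^ i) y) = W i)"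
      by (rule med_step[OF _ xu(2) _ y order_refl]) (use i j a_U good_a in auto)
    have e: "(f ^^ m) x = a (Suc i)" "ptr W u m = a k" using a_Suc i j k by auto
    have M': "(f ^^ m) y \<in> seg q (a (Suc i))" "(f ^^ m) y \<in> seg (a (Suc i)) (a k)" "(f ^^ m) y \<in> seg q (a k)"
      using M by (auto simp: med_def e)
    have "(f ^^ m) y \<in> seg p (a (Suc i))" "(f ^^ m) y \<in> seg p (a k)"
      using median_gate[OF M' a_gate a_gate aT aT qT] i k by auto
    then have "med p ((f ^^ m) y) (a (Suc i)) (a k)" using M'(2) by (simp add: med_def)
    moreover have "y \<in> U" using M yT by (simp add: U_def itin_def)
    ultimately show ?thesis using k(2) by simp
  qed
  have pm: "ptr W (a j) m = a (Suc j)" if "j < t" for j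
    using ptr_U[OF a_U[OF that]] a_Suc by simp
  have pt: "ptr W (a t) m = a 0" using ptr_v_m a_t by simp
  from PR consider (1) i where "i < t" "x = a i" "u = a (Suc i)" | (2) "x = a 0" "u = a t"
    using a_t by (auto simp: PR_def)
  then show ?thesis
  proof cases
    case 1
    show ?thesis
    proof (cases "Suc i = t")
      case True
      have "y \<in> U \<and> med p ((f ^^ m) y) (a (Suc i)) (a 0)"
        using *[of i t 0] 1 True pt t_ge by simp
      then have "y \<in> U" "med p ((f ^^ m) y) (a 0) v"
        using med_sym[OF aT aT, of _ "Suc i" 0] True a_t by auto
      then show ?thesis by (auto simp: PR_def)
    next
      case False
      then have i: "Suc i < t" using 1 by simp
      have "y \<in> U \<and> med p ((f ^^ m) y) (a (Suc i)) (a (Suc (Suc i)))"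
        using *[of i "Suc i" "Suc (Suc i)"] 1 i pm by simp
      then show ?thesis using i unfolding PR_def by blast
    qed
  next
    case 2
    have "y \<in> U \<and> med p ((f ^^ m) y) (a (Suc 0)) (a 0)"
      using *[of 0 t 0] 2 pt t_ge by simp
    then have "y \<in> U" "med p ((f ^^ m) y) (a 0) (a (Suc 0))" using med_sym[OF aT aT] by auto
    then show ?thesis using t_ge unfolding PR_def by (metis One_nat_def less_eq_Suc_le)
  qed
qed

lemma PR_itin:
  assumes PR: "PR x u" and y: "med p y x u"
  shows "itin y = W"
proof
  fix n
  have "\<exists>x u. PR x u \<and> med p ((f ^^ (i * m)) y) x u" for i
  proof (induction i)
    case (Suc i)
    then obtain x u where "PR x u" "med p ((f ^^ (i * m)) y) x u" by blast
    from PR_next[OF this] show ?case by (simp add: funpow_add)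
  qed (use assms in auto)
  then have "(f ^^ (n div m * m)) y \<in> U" using PR_next by blast
  moreover have "n mod m < m" using m by simp
  ultimately have "itin ((f ^^ (n div m * m)) y) (n mod m) = W (n mod m)" by (simp add: U_def)
  then show "itin y n = W n" unfolding itin_shift W_mod by simp
qed

end

section \<open>From the median to an evil branch point\<close>

context failing
begin

text \<open>Both itineraries pass the entry \<open>n0\<close> of \<open>nu\<close>, where it differs
  from \<open>W\<close>; so the median cannot coincide with either point.\<close>

lemma a_itin_neq: "itin (a 0) \<noteq> W" "itin (a 1) \<noteq> W"
proof -
  have n: "Suc (n0 - 1) = n0" "Suc (m + (n0 - 1 - m)) = n0" using n0_gt by auto
  have "itin (a 0) (n0 - 1) = nu n0" using itin_a[of 0 "n0 - 1"] n by simp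
  then show "itin (a 0) \<noteq> W" using W_n0 by metis
  have "itin (a 1) (n0 - 1 - m) = nu n0" using itin_a[of 1 "n0 - 1 - m"] n by simp
  moreover have "W (n0 - 1 - m) = W (n0 - 1)" using W_per[of "n0 - 1 - m"] n0_gt by simp
  ultimately show "itin (a 1) \<noteq> W" using W_n0 by metis
qed

lemma periodic_pointI:
  assumes "y \<in> T" "itin y = W" "(f ^^ m) y = y"
  shows "periodic_point T f c y m"
proof
  show "y \<in> T" "m \<ge> 1" "(f ^^ m) y = y" using assms m by auto
  show "(f ^^ n) y \<noteq> c" for n
    using fun_cong[OF assms(2), of n] W_not_Star[of n] sym_Star[of "(f ^^ n) y"] by (metis itin_def)
  show "itin ((f ^^ k) y) \<noteq> itin y" if k: "1 \<le> k" "k < m" for k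
  proof
    assume e: "itin ((f ^^ k) y) = itin y"
    have "W (k + n) = W n" for n using fun_cong[OF e, of n] by (simp add: itin_shift assms(2))
    then show False using W_exact[OF k] by blast
  qed
qed

text \<open>The characteristic point of the orbit of \<open>y\<close> lies in \<open>[y, c\<^sub>1]\<close> and hence shares
  the first \<open>m\<close> symbols of \<open>y\<close>.\<close>

lemma char_pointI':
  assumes pp: "periodic_point T f c y m" and y: "itin y = W"
    and two: "\<And>w. w \<in> periodic_point.orb f y m \<Longrightarrow> card (arms T w) \<ge> 2"
    and H: "\<And>b. b \<in> periodic_point.SA T f y m \<Longrightarrow>
      \<exists>n. c \<in> snd ((F ^^ n) b) \<or> snd ((F ^^ n) b) \<inter> periodic_point.orb f y m \<noteq> {}"
  shows "char_point T f c y m"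
proof -
  interpret y: periodic_point T f c y m by (rule pp)
  obtain z where z: "z \<in> y.orb" "arm z (f c) \<inter> y.orb = {}" using y.char_exists[OF two H] .
  interpret z: char_point T f c z m by (rule y.char_pointI[OF z])
  have "y \<in> z.orb" using y.orbit_point(2)[OF z(1)] y.z_orb by simp
  then have zs: "z \<in> seg y (f c)" by (rule z.z_in_seg)
  have "y \<in> U" using y.zT by (simp add: U_def y)
  then have zK: "z \<in> K" using K_convex[OF U_K U_K[OF c1_U]] zs by blast
  have zW: "itin z i = W i" if "i < m" for i
    using K_side[OF zK that] z.nc[of i] by (auto simp: side_def itin_def)
  obtain j where j: "j < m" "z = (f ^^ j) y" using z(1) by (auto simp: y.orb_def)
  have "W (j + n) = W n" for n
  proof -
    have "W (j + n) = W (j + n mod m)" by (simp add: W_def mod_add_right_eq)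
    also have "\<dots> = itin z (n mod m)" by (simp add: j(2) itin_shift y)
    also have "\<dots> = W n" using zW[of "n mod m"] m W_mod by simp
    finally show ?thesis .
  qed
  then have "j = 0" using W_exact[of j] j(1) by (cases j) auto
  then show ?thesis using j(2) z.char_point_axioms by simp
qed

lemma ret_G0':
  assumes cp: "char_point T f c y m" and y: "itin y = W"
  shows "(F ^^ m) (y, arm y c) = (y, arm y c)"
proof -
  interpret y: char_point T f c y m by (rule cp)
  have "y.ret (arm y c) = arm y c"
    by (rule y.ret_G0_from_address) (use W_nu m_address in \<open>simp_all add: y\<close>)
  then show ?thesis using y.ret by simp
qed

text \<open>\<open>y\<close> is the characteristic point of its orbit, and since \<open>m\<close> is
  not in the internal address the return map fixes the arm of \<open>c\<close>.\<close>

lemma evil_at_branch: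
  assumes yb: "y \<in> branch_points T" and y: "itin y = W" "(f ^^ m) y = y"
  shows "has_evil_orbit T f m"
proof -
  have pp: "periodic_point T f c y m" using periodic_pointI[OF branch_T[OF yb] y] .
  interpret y: periodic_point T f c y m by (rule pp)
  have br: "w \<in> branch_points T" if "w \<in> y.orb" for w using that fp_branch[OF yb] by (auto simp: y.orb_def)
  have two: "card (arms T w) \<ge> 2" if "w \<in> y.orb" for w using br[OF that] by (simp add: branch_points_def)
  have cp: "char_point T f c y m"
    using char_pointI'[OF pp y(1) two] y.arm_hits_c[OF yb] by blast
  interpret y: char_branch T f c y m
    unfolding char_branch_def char_branch_axioms_def using cp yb by blast
  have "y.ret y.G0 = y.G0" using ret_G0'[OF cp y(1)] y.ret by simp
  then have "\<not> tame T f y.orb" using y.evil_iff by blast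
  moreover have "branch_orbit T f m y.orb"
    unfolding branch_orbit_def periodic_orbit_def
    using m br y.per y.exact_neq by (auto simp: y.orb_def)
  ultimately show ?thesis by (auto simp: has_evil_orbit_def)
qed

text \<open>If only two arms meet at \<open>p\<close>, then \<open>f\<^sup>m\<close> interchanges them, but the arm
  towards \<open>c\<close> is fixed.\<close>

lemma three_arms:
  assumes p: "p \<in> T" "itin p = W" "(f ^^ m) p = p" "p \<in> seg (a 0) (a 1)"
  shows "card (arms T p) \<ge> 3"
proof (rule ccontr)
  assume n3: "\<not> card (arms T p) \<ge> 3"
  have pp: "periodic_point T f c p m" using periodic_pointI[OF p(1-3)] .
  interpret p: periodic_point T f c p m by (rule pp)
  have ne: "a 0 \<noteq> p" "a 1 \<noteq> p" using a_itin_neq p(2) by auto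
  define A0 A1 where A: "A0 = arm p (a 0)" "A1 = arm p (a 1)"
  have A_in: "A0 \<in> arms T p" "A1 \<in> arms T p" using arm_in_arms[OF aT] ne by (auto simp: A)
  have A_ne: "A0 \<noteq> A1" using arm_eq_iff[OF p(1) aT aT ne] p(4) by (simp add: A)
  have A_all: "B = A0 \<or> B = A1" if B: "B \<in> arms T p" for B
  proof (rule ccontr)
    assume "\<not> (B = A0 \<or> B = A1)"
    then have "card {B, A0, A1} = 3" using A_ne by simp
    moreover have "card {B, A0, A1} \<le> card (arms T p)"
      by (rule card_mono[OF finite_arms]) (use A_in B in auto)
    ultimately show False using n3 by simp
  qed
  have c2: "card (arms T p) \<ge> 2"
  proof -
    have "card {A0, A1} \<le> card (arms T p)" by (rule card_mono[OF finite_arms]) (use A_in in auto)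
    then show ?thesis using A_ne by simp
  qed
  have "card (arms T ((f ^^ i) p)) \<ge> 2" for i
  proof (induction i)
    case (Suc i)
    then show ?case using card_arms_le[OF fpT[OF p(1)] p.nc, of i] by simp
  qed (use c2 in simp)
  then have two: "card (arms T w) \<ge> 2" if "w \<in> p.orb" for w using that by (auto simp: p.orb_def)
  have "ptr W (f c) m = (f ^^ m) (f c)"
    by (rule ptr_follow) (use c1_U in \<open>simp add: U_def itin_def\<close>)
  then have "ptr (itin p) (a 0) m = a 1" using a_Suc[of 0] a0 p(2) by simp
  then have F0: "(F ^^ m) (p, A0) = (p, A1)"
    using F_ptr(1)[OF p(1) p.nc aT ne(1), of m] p(3) by (simp add: A)
  have SA: "(p, A0) \<in> p.SA" "(p, A1) \<in> p.SA" using A_in p.z_orb by (auto simp: p.SA_iff)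
  have F1: "(F ^^ m) (p, A1) = (p, A0)"
  proof -
    obtain B where B: "(F ^^ m) (p, A1) = (p, B)"
      using fst_Fn[of m "(p, A1)"] p(3) by (metis fst_conv prod.collapse)
    then have "B \<in> arms T p" using p.Fn_SA[OF SA(2), of m] by (simp add: p.SA_iff)
    moreover have "B \<noteq> A1"
    proof
      assume "B = A1"
      then have "(F ^^ m) (p, A1) = (F ^^ m) (p, A0)" using F0 B by simp
      then have "(p, A1) = (p, A0)" using inj_onD[OF p.Fn_inj _ SA(2,1)] by blast
      then show False using A_ne by simp
    qed
    ultimately show ?thesis using A_all B by blast
  qed
  \<comment> \<open>As \<open>m\<close> is at least 2, \<open>f p\<close> is another orbit point and
    its arm \<open>B\<close> is not free. The interchange takes every arm to \<open>B\<close>, which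
    supplies the hypothesis of \<open>char_exists\<close> without expansivity.\<close>
  define B where "B = arm p (f p)"
  have fp: "f p \<noteq> p" using p.exact_neq[of 1] m2 by simp
  have B: "B \<in> arms T p" "f p \<in> B" using arm_in_arms[OF fT fp] arm_refl[OF fT fp] p(1) by (auto simp: B_def)
  have Bnf: "B \<inter> p.orb \<noteq> {}" using B(2) p.orb_f[OF p.z_orb] by blast
  have H: "\<exists>n. c \<in> snd ((F ^^ n) b) \<or> snd ((F ^^ n) b) \<inter> p.orb \<noteq> {}" if b: "b \<in> p.SA" for b
  proof -
    obtain w A' where wA: "b = (w, A')" by fastforce
    then have w: "w \<in> p.orb" using b by (simp add: p.SA_iff)
    obtain j where j: "p = (f ^^ j) w" using p.orb_reach[OF w p.z_orb] by metis
    obtain C where C: "(F ^^ j) b = (p, C)" using fst_Fn[of j b] wA j by (metis fst_conv prod.collapse)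
    then have "C \<in> arms T p" using p.Fn_SA[OF b, of j] by (simp add: p.SA_iff)
    then have "C = B \<or> (F ^^ m) (p, C) = (p, B)"
      using A_all[of C] A_all[OF B(1)] F0 F1 by auto
    then show ?thesis
    proof
      assume "C = B"
      then show ?thesis using C Bnf by (intro exI[of _ j]) simp
    next
      assume "(F ^^ m) (p, C) = (p, B)"
      then have "(F ^^ (m + j)) b = (p, B)" using C by (simp add: funpow_add)
      then show ?thesis using Bnf by (intro exI[of _ "m + j"]) simp
    qed
  qed
  have cp: "char_point T f c p m" using char_pointI'[OF pp p(2) two H] .
  have "c \<noteq> p" using p.nc[of 0] by auto
  then have "arm p c = A0 \<or> arm p c = A1" using A_all arm_in_arms[OF cT] by blast
  then show False using ret_G0'[OF cp p(2)] F0 F1 A_ne by auto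
qed

theorem fails_imp_evil: "has_evil_orbit T f m"
proof -
  have im: "(f ^^ m) ` K \<subseteq> T" using fpT K_T by blast
  have KT: "K \<subseteq> T" using K_T by blast
  obtain p where p: "p \<in> K" "p \<in> seg (f c) ((f ^^ m) p)" "seg p ((f ^^ m) p) \<inter> K = {p}"
    using gate_fixed_point[OF closed_K KT K_convex U_K[OF c1_U] continuous_on_subset[OF cont_fp KT] im] .
  interpret failing_gate T f c m p
    by (unfold failing_gate_def failing_gate_axioms_def) (use failing_axioms p in blast)
  obtain y where y: "y \<in> seg p (a 0)" "y \<in> seg (a 0) (a 1)" "y \<in> seg p (a 1)"
    using median_exists[OF pT aT aT] .
  have yT: "y \<in> T" using seg_in[OF y(1) pT aT] .
  have "PR (a 0) (a 1)" unfolding PR_def by (intro disjI1 exI[of _ 0]) (use t_ge in simp)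
  moreover have "med p y (a 0) (a 1)" using y by (simp add: med_def)
  ultimately have W: "itin y = W" by (rule PR_itin)
  have ya: "y \<noteq> a 0" "y \<noteq> a 1" using W a_itin_neq by auto
  show ?thesis
  proof (cases "y = p")
    case False
    \<comment> \<open>A median different from all three points is a branch point, and there
      expansivity turns the period of the itinerary into a period of the point.\<close>
    then have yb: "y \<in> branch_points T" using median_branch[OF y _ ya pT aT aT] by blast
    have "itin ((f ^^ m) y) = itin y"
    proof
      fix n show "itin ((f ^^ m) y) n = itin y n" using W_per[of n] by (simp add: itin_shift W add.commute)
    qed
    moreover have "(f ^^ m) y \<in> V" "y \<in> V" using fp_branch[OF yb] yb by (auto simp: V_def)
    ultimately have "(f ^^ m) y = y" using expand[of "(f ^^ m) y" y] by (metis itin_def)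
    then show ?thesis using evil_at_branch[OF yb W] by blast
  next
    case True
    \<comment> \<open>Now \<open>p\<close> itself has itinerary \<open>W\<close> and never meets
      \<open>c\<close>, so by \<open>q_neq_p\<close> the gate is a true fixed point of
      \<open>f ^^ m\<close>.\<close>
    have "(f ^^ n) p \<noteq> c" for n
      using fun_cong[OF W, of n] sy_W[of "(f ^^ n) p" n] True by (simp add: itin_def)
    then have q: "(f ^^ m) p = p" using q_neq_p by blast
    have "card (arms T p) \<ge> 3" using three_arms[OF pT _ q] W y(2) True by blast
    then have "p \<in> branch_points T" using pT by (simp add: branch_points_def)
    then show ?thesis using evil_at_branch[OF _ _ q] W True by blast
  qed
qed

end

context hubbard
begin

theorem has_evil_iff_fails:
  assumes "m \<ge> 1"
  shows "has_evil_orbit T f m \<longleftrightarrow> fails_admissibility nu m"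
proof
  assume "fails_admissibility nu m"
  then interpret failing T f c m
    by (unfold_locales) (use assms in auto)
  show "has_evil_orbit T f m" by (rule fails_imp_evil)
qed (rule has_evil_imp_fails)

end

section \<open>Planar embeddings\<close>

definition cyc :: "real \<Rightarrow> real \<Rightarrow> real \<Rightarrow> bool" where
  "cyc a b c \<longleftrightarrow> (a < b \<and> b < c) \<or> (b < c \<and> c < a) \<or> (c < a \<and> a < b)"

lemma cis_eqD:
  assumes "cis s = cis t" obtains n :: int where "s = t + 2 * pi * n"
proof -
  have "sin s = sin t \<and> cos s = cos t" using assms by (metis cis.simps(1) cis.simps(2))
  then show ?thesis using sin_cos_eq_iff that by blast
qed

lemma cis_add_2pi: "cis (s + 2 * pi) = cis s"
  by (simp flip: cis_mult)

text \<open>The integers lifting the three angles satisfy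
  \<open>i \<le> j \<le> k \<le> i + 1\<close>; the three possibilities are the three rotations
  listed in \<open>cyc\<close>.\<close>

lemma ccw_imp_cyc:
  assumes "s < t" "t < u" "u < s + 2 * pi"
    and "cis s = cis (\<beta> + a)" "cis t = cis (\<beta> + b)" "cis u = cis (\<beta> + c)"
    and "0 \<le> a" "a < 2 * pi" "0 \<le> b" "b < 2 * pi" "0 \<le> c" "c < 2 * pi"
  shows "cyc a b c"
proof -
  obtain i :: int where i: "s = \<beta> + a + 2 * pi * i" using cis_eqD[OF assms(4)] .
  obtain j :: int where j: "t = \<beta> + b + 2 * pi * j" using cis_eqD[OF assms(5)] .
  obtain k :: int where k: "u = \<beta> + c + 2 * pi * k" using cis_eqD[OF assms(6)] .
  have le: "n \<le> 0" if "2 * pi * of_int n < 2 * pi" for n :: int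
    using that by (simp add: mult_less_cancel_left1)
  have bounds: "x < y + 1" if "2 * pi * of_int x < 2 * pi * of_int y + 2 * pi" for x y :: int
  proof -
    have "2 * pi * of_int (x - y) < 2 * pi" using that by (simp add: algebra_simps)
    then show ?thesis using le[of "x - y"] by simp
  qed
  have "i < j + 1" by (rule bounds) (use i j assms in linarith)
  moreover have "j < k + 1" by (rule bounds) (use j k assms in linarith)
  moreover have "k < (i + 1) + 1" by (rule bounds) (use i k assms in \<open>simp add: algebra_simps\<close>)
  ultimately consider "j = i" "k = i" | "j = i" "k = i + 1" | "j = i + 1" "k = i + 1" by linarith
  then show ?thesis
    unfolding cyc_def by cases (use i j k assms in \<open>simp_all add: algebra_simps\<close>)
qed

lemma cyc_imp_ccw:
  assumes "cyc a b c" "0 \<le> a" "a < 2 * pi" "0 \<le> b" "b < 2 * pi" "0 \<le> c" "c < 2 * pi"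
  obtains s t u where "s < t" "t < u" "u < s + 2 * pi"
    "cis s = cis (\<beta> + a)" "cis t = cis (\<beta> + b)" "cis u = cis (\<beta> + c)"
proof -
  have p: "cis (\<beta> + x + 2 * pi) = cis (\<beta> + x)" for x by (rule cis_add_2pi)
  consider "a < b" "b < c" | "b < c" "c < a" | "c < a" "a < b" using assms(1) by (auto simp: cyc_def)
  then show ?thesis
  proof cases
    case 1 then show ?thesis using that[of "\<beta> + a" "\<beta> + b" "\<beta> + c"] assms by simp
  next
    case 2 then show ?thesis using that[of "\<beta> + a" "\<beta> + b + 2 * pi" "\<beta> + c + 2 * pi"] p assms by simp
  next
    case 3 then show ?thesis using that[of "\<beta> + a" "\<beta> + b" "\<beta> + c + 2 * pi"] p assms by simp
  qed
qed

lemma angle_exists: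
  assumes "dist w z = r" "r > 0"
  obtains a where "0 \<le> a" "a < 2 * pi" "w = z + of_real r * cis a"
proof -
  define d where "d = w - z"
  have n: "norm d = r" using assms by (simp add: d_def dist_norm)
  have "d = of_real (norm d) * exp (\<i> * of_real (Arg2pi d))"
    using Arg2pi[of d] by (simp add: is_Arg_def)
  then have "d = of_real r * cis (Arg2pi d)" using n by (simp add: cis_conv_exp)
  then have "w = z + of_real r * cis (Arg2pi d)" by (simp add: d_def algebra_simps)
  then show ?thesis using that[of "Arg2pi d"] Arg2pi[of d] by simp
qed

section \<open>First exits and the cyclic order induced by an embedding\<close>

context top_tree
begin

text \<open>Near an interior point of an edge the tree consists of that edge alone, which gives at
  most two arms.\<close>

lemma branch_points_vertices:
  assumes VE: "finite V" "finite E" "T = V \<union> \<Union>E"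
    "\<And>e. e \<in> E \<Longrightarrow> \<exists>a b. is_arc e a b \<and> e \<inter> V = {a, b}"
    "\<And>e e'. \<lbrakk>e \<in> E; e' \<in> E; e \<noteq> e'\<rbrakk> \<Longrightarrow> e \<inter> e' \<subseteq> V"
  shows "branch_points T \<subseteq> V"
proof
  fix x assume x: "x \<in> branch_points T"
  show "x \<in> V"
  proof (rule ccontr)
    assume xV: "x \<notin> V"
    have xT: "x \<in> T" using x by (simp add: branch_points_def)
    then obtain e where e: "e \<in> E" "x \<in> e" using xV VE(3) by blast
    obtain a b where ab: "is_arc e a b" "e \<inter> V = {a, b}" using VE(4)[OF e(1)] by blast
    obtain g where g: "continuous_on {0..1::real} g" "inj_on g {0..1}" "g ` {0..1} = e" "g 0 = a" "g 1 = b"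
      using is_arcE[OF ab(1)] by metis
    obtain t where t: "t \<in> {0..1}" "x = g t" using g(3) e(2) by blast
    define Z where "Z = V \<union> \<Union>(E - {e})"
    have "closed e'" if "e' \<in> E" for e' using VE(4)[OF that] is_arc_closed by blast
    then have Z: "closed Z" unfolding Z_def using VE(1,2)
      by (intro closed_Un closed_Union) (auto intro: finite_imp_closed)
    have xZ: "x \<notin> Z" using VE(5)[OF e(1)] e(2) xV by (auto simp: Z_def)
    have TZ: "y \<in> e" if "y \<in> T" "y \<notin> Z" for y using that VE(3) by (auto simp: Z_def)
    have ne: "a \<noteq> x" "b \<noteq> x" using ab(2) xV by auto
    have eT: "e \<subseteq> T" using e(1) VE(3) by blast
    have abT: "a \<in> T" "b \<in> T" using eT ab(2) by auto
    have A: "A = arm x a \<or> A = arm x b" if A: "A \<in> arms T x" for A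
    proof -
      obtain v where v: "v \<in> T" "v \<noteq> x" "A = arm x v" using A arms_nonempty by blast
      obtain y where y: "y \<in> T" "y \<noteq> x" "y \<in> - Z" "arm x y = arm x v"
        using arm_at[OF xT v(1,2), of "- Z"] Z xZ by (auto simp: closed_def)
      have "y \<in> e" using TZ[OF y(1)] y(3) by simp
      then obtain s where s: "s \<in> {0..1}" "y = g s" using g(3) by blast
      have "s \<noteq> t" using s t y(2) by auto
      then consider "s < t" | "t < s" by linarith
      then show ?thesis
      proof cases
        case 1
        have "connected (g ` {0..<t})"
          by (rule connected_continuous_image) (use t in \<open>auto intro: continuous_on_subset[OF g(1)]\<close>)
        moreover have "g ` {0..<t} \<subseteq> T - {x}"
        proof
          fix w assume "w \<in> g ` {0..<t}"
          then obtain q where q: "q \<in> {0..<t}" "w = g q" by blast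
          then have "g q \<noteq> g t" using inj_onD[OF g(2), of q t] t by auto
          then show "w \<in> T - {x}" using q t g(3) eT by auto
        qed
        moreover have "a \<in> g ` {0..<t}" "y \<in> g ` {0..<t}" using g(4) 1 s by auto
        ultimately have "y \<in> arm x a" unfolding arm_def using connected_componentI by (metis mem_Collect_eq)
        then show ?thesis using arm_eq y(4) v(3) by metis
      next
        case 2
        have "connected (g ` {t<..1})"
          by (rule connected_continuous_image) (use t in \<open>auto intro: continuous_on_subset[OF g(1)]\<close>)
        moreover have "g ` {t<..1} \<subseteq> T - {x}"
        proof
          fix w assume "w \<in> g ` {t<..1}"
          then obtain q where q: "q \<in> {t<..1}" "w = g q" by blast
          then have "g q \<noteq> g t" using inj_onD[OF g(2), of q t] t by auto
          then show "w \<in> T - {x}" using q t g(3) eT by auto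
        qed
        moreover have "b \<in> g ` {t<..1}" "y \<in> g ` {t<..1}" using g(5) 2 s by auto
        ultimately have "y \<in> arm x b" unfolding arm_def using connected_componentI by (metis mem_Collect_eq)
        then show ?thesis using arm_eq y(4) v(3) by metis
      qed
    qed
    then have "arms T x \<subseteq> {arm x a, arm x b}" by blast
    then have "card (arms T x) \<le> card {arm x a, arm x b}" by (intro card_mono) auto
    also have "\<dots> \<le> 2" by (simp add: card_insert_if)
    finally show False using x by (simp add: branch_points_def)
  qed
qed

lemma finite_branch_points: "finite (branch_points T)"
proof (rule graphE)
  fix V E
  assume VE: "finite V" "finite E" "T = V \<union> \<Union>E"
    "\<And>e. e \<in> E \<Longrightarrow> \<exists>a b. is_arc e a b \<and> e \<inter> V = {a, b}"
    "\<And>e e'. \<lbrakk>e \<in> E; e' \<in> E; e \<noteq> e'\<rbrakk> \<Longrightarrow> e \<inter> e' \<subseteq> V"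
  show ?thesis using branch_points_vertices[OF VE] VE(1) finite_subset by blast
qed

text \<open>The first point of the segment at distance at least \<open>r\<close> has distance
  exactly \<open>r\<close>, by the intermediate value theorem.\<close>

lemma first_exit_exists:
  assumes h: "continuous_on T h" "inj_on h T" and x: "x \<in> T" and v: "v \<in> T" "v \<noteq> x"
    and r: "0 < r" "r < dist (h v) (h x)"
  obtains y where "y \<in> seg x v" "first_exit T h r x (arm x v) y"
proof -
  have cd: "continuous_on T (\<lambda>y. dist (h y) (h x))"
    by (intro continuous_on_dist h(1) continuous_on_const)
  define C where "C = T \<inter> (\<lambda>y. dist (h y) (h x)) -` {r..}"
  have "closed C" unfolding C_def by (rule continuous_closed_preimage[OF cd closed_T closed_atLeast])
  moreover have "x \<notin> C" "v \<in> C" using r v by (auto simp: C_def)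
  ultimately obtain y S where y: "y \<in> C" "S \<subseteq> seg x v" "is_arc S x y" "S \<inter> C = {y}"
    using is_arc_first_hit[OF seg_arc[OF x v(1) v(2)[symmetric]]] by metis
  have ST: "S \<subseteq> T" using y(2) seg_subset[OF x v(1)] by blast
  then have S: "seg x y = S" using seg_eq y(3) by blast
  have ys: "y \<in> seg x v" using y(2) is_arc_ends[OF y(3)] by blast
  have yT: "y \<in> T" using y(1) by (simp add: C_def)
  have yx: "y \<noteq> x" using is_arc_ends[OF y(3)] by blast
  have lt: "dist (h z) (h x) < r" if z: "z \<in> seg x y" "z \<noteq> y" for z
  proof -
    have "z \<notin> C" using z S y(4) by blast
    moreover have "z \<in> T" using z(1) S ST by blast
    ultimately show ?thesis by (simp add: C_def)
  qed
  have "dist (h y) (h x) = r"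
  proof (rule ccontr)
    assume "dist (h y) (h x) \<noteq> r"
    then have gt: "dist (h y) (h x) > r" using y(1) by (simp add: C_def)
    have "connected ((\<lambda>w. dist (h w) (h x)) ` seg x y)"
      by (rule connected_continuous_image[OF continuous_on_subset[OF cd seg_subset[OF x yT]] connected_seg[OF x yT]])
    moreover have "0 \<in> (\<lambda>w. dist (h w) (h x)) ` seg x y" using seg_ends(1)[OF x yT] by force
    moreover have "dist (h y) (h x) \<in> (\<lambda>w. dist (h w) (h x)) ` seg x y" using seg_ends(2)[OF x yT] by force
    ultimately have "{0..dist (h y) (h x)} \<subseteq> (\<lambda>w. dist (h w) (h x)) ` seg x y"
      by (rule connected_contains_Icc)
    then have "r \<in> (\<lambda>w. dist (h w) (h x)) ` seg x y" using r(1) gt by auto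
    then obtain w where w: "w \<in> seg x y" "r = dist (h w) (h x)" by blast
    then show False using lt[of w] gt by (cases "w = y") auto
  qed
  moreover have "y \<in> arm x v" using arm_seg[OF ys yx x v(1)] arm_refl[OF yT yx] by simp
  ultimately have "first_exit T h r x (arm x v) y" using lt by (simp add: first_exit_def)
  then show ?thesis using that ys by blast
qed

text \<open>Two exits in one arm would part at a branch point strictly inside the circle, and
  \<open>r\<close> is too small for that.\<close>

lemma first_exit_unique:
  assumes x: "x \<in> T" and A: "A \<in> arms T x" and small: "\<And>b. \<lbrakk>b \<in> branch_points T; b \<noteq> x\<rbrakk> \<Longrightarrow> r < dist (h b) (h x)"
    and y: "first_exit T h r x A y" "first_exit T h r x A y'"
  shows "y = y'"
proof -
  have yA: "y \<in> A" "y' \<in> A" using y by (auto simp: first_exit_def)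
  have e: "arm x y = arm x y'" using arms_mem_eq[OF A] yA by blast
  have yx: "y \<in> T" "y \<noteq> x" "y' \<in> T" "y' \<noteq> x"
    using yA arms_mem_eq[OF A] arm_subset by blast+
  obtain w where w: "w \<in> seg x y" "w \<in> seg y y'" "w \<in> seg x y'" using median_exists[OF x yx(1,3)] .
  have wx: "w \<noteq> x" using arm_eq_iff[OF x yx(1,3,2,4)] e w(2) by auto
  have d: "dist (h y) (h x) = r" "dist (h y') (h x) = r" using y by (auto simp: first_exit_def)
  have l: "z \<noteq> y \<Longrightarrow> z \<in> seg x y \<Longrightarrow> dist (h z) (h x) < r" "z \<noteq> y' \<Longrightarrow> z \<in> seg x y' \<Longrightarrow> dist (h z) (h x) < r" for z
    using y by (auto simp: first_exit_def)
  show ?thesis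
  proof (rule ccontr)
    assume n: "y \<noteq> y'"
    show False
    proof (cases "w = y \<or> w = y'")
      case True
      then show False using l(2)[of y] l(1)[of y'] w n d by auto
    next
      case False
      then have wb: "w \<in> branch_points T" using median_branch[OF w wx _ _ x yx(1,3)] by blast
      show False using small[OF wb wx] l(1)[of w] w False by simp
    qed
  qed
qed

definition small_radius :: "('a \<Rightarrow> complex) \<Rightarrow> 'a \<Rightarrow> real \<Rightarrow> bool" where
  "small_radius h x r \<longleftrightarrow> 0 < r \<and> (\<forall>A\<in>arms T x. \<exists>y. first_exit T h r x A y) \<and>
     (\<forall>b\<in>branch_points T. b \<noteq> x \<longrightarrow> r < dist (h b) (h x))"

lemma eventually_lt_dist:
  assumes "(d::real) > 0" shows "\<forall>\<^sub>F r in at_right 0. r < d"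
  using assms by (auto simp: eventually_at_right_field)

lemma small_radius:
  assumes h: "continuous_on T h" "inj_on h T" and x: "x \<in> T"
  shows "\<forall>\<^sub>F r in at_right 0. small_radius h x r"
proof -
  have pos: "\<forall>\<^sub>F r in at_right (0::real). 0 < r" by (simp add: eventually_at_right_less)
  have 1: "\<forall>\<^sub>F r in at_right 0. \<exists>y. first_exit T h r x A y" if A: "A \<in> arms T x" for A
  proof -
    obtain v where v: "v \<in> T" "v \<noteq> x" "A = arm x v" using A arms_nonempty by blast
    have "dist (h v) (h x) > 0" using inj_onD[OF h(2)] v x by auto
    then have "\<forall>\<^sub>F r in at_right 0. r < dist (h v) (h x)" by (rule eventually_lt_dist)
    with pos show ?thesis
    proof eventually_elim
      case (elim r)
      then show ?case using first_exit_exists[OF h x v(1,2)] v(3) by metis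
    qed
  qed
  have 2: "\<forall>\<^sub>F r in at_right 0. b \<noteq> x \<longrightarrow> r < dist (h b) (h x)" if b: "b \<in> branch_points T" for b
  proof (cases "b = x")
    case False
    have "b \<in> T" using b by (simp add: branch_points_def)
    then have "dist (h b) (h x) > 0" using inj_onD[OF h(2), of b x] x False by auto
    from eventually_lt_dist[OF this] show ?thesis by eventually_elim simp
  qed simp
  have "\<forall>\<^sub>F r in at_right 0. \<forall>A\<in>arms T x. \<exists>y. first_exit T h r x A y"
    using 1 by (intro eventually_ball_finite finite_arms) auto
  moreover have "\<forall>\<^sub>F r in at_right 0. \<forall>b\<in>branch_points T. b \<noteq> x \<longrightarrow> r < dist (h b) (h x)"
    using 2 by (intro eventually_ball_finite finite_branch_points) auto
  ultimately show ?thesis using pos unfolding small_radius_def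
    by eventually_elim blast
qed

lemma ccw_angles:
  assumes h: "inj_on h T" and x: "x \<in> T" and r: "small_radius h x r"
  obtains \<alpha> where "\<And>A. A \<in> arms T x \<Longrightarrow> 0 \<le> \<alpha> A \<and> \<alpha> A < 2 * pi" "inj_on \<alpha> (arms T x)"
    "\<And>A B C. \<lbrakk>A \<in> arms T x; B \<in> arms T x; C \<in> arms T x\<rbrakk> \<Longrightarrow> ccw_arms T h r x A B C \<longleftrightarrow> cyc (\<alpha> A) (\<alpha> B) (\<alpha> C)"
proof -
  have r0: "r > 0" and sm: "\<And>b. \<lbrakk>b \<in> branch_points T; b \<noteq> x\<rbrakk> \<Longrightarrow> r < dist (h b) (h x)"
    using r by (auto simp: small_radius_def)
  have ex: "\<exists>y a. first_exit T h r x A y \<and> 0 \<le> a \<and> a < 2 * pi \<and> h y = h x + of_real r * cis a" if A: "A \<in> arms T x" for A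
  proof -
    obtain y where y: "first_exit T h r x A y" using r A by (auto simp: small_radius_def)
    then have "dist (h y) (h x) = r" by (simp add: first_exit_def)
    from angle_exists[OF this r0] show ?thesis using y by metis
  qed
  then obtain Y \<alpha> where Y: "\<And>A. A \<in> arms T x \<Longrightarrow> first_exit T h r x A (Y A) \<and> 0 \<le> \<alpha> A \<and> \<alpha> A < 2 * pi \<and>
      h (Y A) = h x + of_real r * cis (\<alpha> A)" by metis
  have uniq: "y = Y A" if "A \<in> arms T x" "first_exit T h r x A y" for A y
    using first_exit_unique[OF x that(1) sm that(2)] Y[OF that(1)] by blast
  have inj: "inj_on \<alpha> (arms T x)"
  proof (rule inj_onI)
    fix A B assume AB: "A \<in> arms T x" "B \<in> arms T x" "\<alpha> A = \<alpha> B"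
    have m: "Y A \<in> A" "Y B \<in> B" using Y[OF AB(1)] Y[OF AB(2)] by (auto simp: first_exit_def)
    have t: "Y A \<in> T" "Y B \<in> T" using m arms_mem_eq[OF AB(1)] arms_mem_eq[OF AB(2)] arm_subset by blast+
    have "h (Y A) = h (Y B)" using Y[OF AB(1)] Y[OF AB(2)] AB(3) by simp
    then have "Y A = Y B" using inj_onD[OF h] t by blast
    then show "A = B" using m arms_mem_eq[OF AB(1)] arms_mem_eq[OF AB(2)] by metis
  qed
  have ccw: "ccw_arms T h r x A B C \<longleftrightarrow> cyc (\<alpha> A) (\<alpha> B) (\<alpha> C)"
    if ABC: "A \<in> arms T x" "B \<in> arms T x" "C \<in> arms T x" for A B C
  proof
    note YA = Y[OF ABC(1)] and YB = Y[OF ABC(2)] and YC = Y[OF ABC(3)]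
    assume "ccw_arms T h r x A B C"
    then obtain a b c s t u where e: "first_exit T h r x A a" "first_exit T h r x B b" "first_exit T h r x C c"
      and p: "h a = h x + of_real r * cis s" "h b = h x + of_real r * cis t" "h c = h x + of_real r * cis u"
      and o: "s < t" "t < u" "u < s + 2 * pi"
      unfolding ccw_arms_def by blast
    have "a = Y A" "b = Y B" "c = Y C" using uniq ABC e by auto
    then have "cis s = cis (0 + \<alpha> A)" "cis t = cis (0 + \<alpha> B)" "cis u = cis (0 + \<alpha> C)"
      using p YA YB YC r0 by auto
    then show "cyc (\<alpha> A) (\<alpha> B) (\<alpha> C)" using ccw_imp_cyc[OF o] YA YB YC by blast
  next
    note YA = Y[OF ABC(1)] and YB = Y[OF ABC(2)] and YC = Y[OF ABC(3)]
    assume c: "cyc (\<alpha> A) (\<alpha> B) (\<alpha> C)"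
    obtain s t u where o: "s < t" "t < u" "u < s + 2 * pi"
      "cis s = cis (0 + \<alpha> A)" "cis t = cis (0 + \<alpha> B)" "cis u = cis (0 + \<alpha> C)"
      using cyc_imp_ccw[OF c] YA YB YC by metis
    then have "h (Y A) = h x + of_real r * cis s" "h (Y B) = h x + of_real r * cis t" "h (Y C) = h x + of_real r * cis u"
      using YA YB YC by auto
    then show "ccw_arms T h r x A B C" unfolding ccw_arms_def using o(1-3) YA YB YC by blast
  qed
  show ?thesis using that[of \<alpha>] Y inj ccw by blast
qed

end

lemma cyc_irrefl: "\<not> cyc g a a"
  by (simp add: cyc_def)

lemma cyc_trans: "\<lbrakk>cyc g a b; cyc g b c\<rbrakk> \<Longrightarrow> cyc g a c"
  by (auto simp: cyc_def)

lemma cyc_total: "\<lbrakk>a \<noteq> b; a \<noteq> g; b \<noteq> g\<rbrakk> \<Longrightarrow> cyc g a b \<or> cyc g b a"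
  unfolding cyc_def by linarith

section \<open>Planarity excludes evil orbits\<close>

context char_branch
begin

text \<open>Seen from the fixed arm \<open>G0\<close>, the cyclic order is a linear order on the other arms.
  A permutation preserving it is the identity.\<close>

lemma planar_ret_G1:
  assumes h: "continuous_on T h" "inj_on h T" and resp: "respects_cyclic_order T f h" and r0: "ret G0 = G0"
  shows "ret G1 = G1"
proof (rule ccontr)
  assume ne: "ret G1 \<noteq> G1"
  have "\<forall>\<^sub>F r in at_right 0. small_radius h z r \<and> (\<forall>x\<in>branch_points T. \<forall>A \<in> arms T x. \<forall>B \<in> arms T x. \<forall>C \<in> arms T x.
          ccw_arms T h r x A B C \<longrightarrow> ccw_arms T h r (f x)
            (local_arm_image T f x A) (local_arm_image T f x B) (local_arm_image T f x C))"
    using resp small_radius[OF h zT] unfolding respects_cyclic_order_def by (rule eventually_conj[rotated])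
  \<comment> \<open>\<open>respects_cyclic_order\<close> treats all branch points with the same
    radius, so one \<open>r\<close> serves the entire orbit of \<open>z\<close>.\<close>
  then obtain r where r: "small_radius h z r"
    and step: "\<And>x A B C. \<lbrakk>x \<in> branch_points T; A \<in> arms T x; B \<in> arms T x; C \<in> arms T x; ccw_arms T h r x A B C\<rbrakk> \<Longrightarrow>
       ccw_arms T h r (f x) (local_arm_image T f x A) (local_arm_image T f x B) (local_arm_image T f x C)"
    using eventually_happens'[OF trivial_limit_at_right_real] by (metis (no_types, lifting))
  obtain \<alpha> where \<alpha>: "inj_on \<alpha> (arms T z)"
    "\<And>A B C. \<lbrakk>A \<in> arms T z; B \<in> arms T z; C \<in> arms T z\<rbrakk> \<Longrightarrow> ccw_arms T h r z A B C \<longleftrightarrow> cyc (\<alpha> A) (\<alpha> B) (\<alpha> C)"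
    using ccw_angles[OF h(2) zT r] by metis
  have iter: "ccw_arms T h r ((f ^^ n) z) (snd ((F ^^ n) (z, A))) (snd ((F ^^ n) (z, B))) (snd ((F ^^ n) (z, C)))"
    if ABC: "A \<in> arms T z" "B \<in> arms T z" "C \<in> arms T z" "ccw_arms T h r z A B C" for A B C n
  proof (induction n)
    case (Suc n)
    have S: "(z, A) \<in> SA" "(z, B) \<in> SA" "(z, C) \<in> SA" using ABC z_orb by (auto simp: SA_iff)
    have F: "\<exists>A'. (F ^^ n) (z, D) = ((f ^^ n) z, A') \<and> A' \<in> arms T ((f ^^ n) z)" if "(z, D) \<in> SA" for D
      using Fn_SA[OF that, of n] fst_Fn[of n "(z, D)"] by (cases "(F ^^ n) (z, D)") (auto simp: SA_iff)
    obtain A' B' C' where F': "(F ^^ n) (z, A) = ((f ^^ n) z, A')" "A' \<in> arms T ((f ^^ n) z)"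
      "(F ^^ n) (z, B) = ((f ^^ n) z, B')" "B' \<in> arms T ((f ^^ n) z)"
      "(F ^^ n) (z, C) = ((f ^^ n) z, C')" "C' \<in> arms T ((f ^^ n) z)"
      using F[OF S(1)] F[OF S(2)] F[OF S(3)] by blast
    have "ccw_arms T h r ((f ^^ n) z) A' B' C'" using Suc F' by simp
    from step[OF fp_branch[OF branch] F'(2,4,6) this] show ?case using F' by (simp add: F_arm)
  qed (use ABC in simp)
  have ret_cyc: "cyc (\<alpha> G0) (\<alpha> (ret A)) (\<alpha> (ret B))"
    if AB: "A \<in> arms T z" "B \<in> arms T z" "cyc (\<alpha> G0) (\<alpha> A) (\<alpha> B)" for A B
  proof -
    have "ccw_arms T h r z G0 A B" using \<alpha>(2)[OF G0_arm AB(1,2)] AB(3) by simp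
    from iter[OF G0_arm AB(1,2) this, of m] have "ccw_arms T h r z G0 (ret A) (ret B)"
      using ret[of G0] ret[of A] ret[of B] r0 per by simp
    then show ?thesis using \<alpha>(2)[OF G0_arm ret_arms[OF AB(1)] ret_arms[OF AB(2)]] by simp
  qed
  \<comment> \<open>If \<open>ret\<close> moves \<open>G1\<close>, the iterates move monotonically
    in the linear order seen from \<open>G0\<close> and never repeat, although there are only
    finitely many arms.\<close>
  define G where "G i = (ret ^^ i) G1" for i
  have G: "G i \<in> arms T z" "G (Suc i) = ret (G i)" for i using retn_arms[OF G1_arm] by (auto simp: G_def)
  have "\<alpha> (G 0) \<noteq> \<alpha> (G 1)" "\<alpha> (G 0) \<noteq> \<alpha> G0" "\<alpha> (G 1) \<noteq> \<alpha> G0"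
    using inj_onD[OF \<alpha>(1)] ne evil_ret_G1(1)[OF r0] G0_neq_G1 G1_arm G0_arm ret_arms[OF G1_arm] by (auto simp: G_def)
  then consider "cyc (\<alpha> G0) (\<alpha> (G 0)) (\<alpha> (G 1))" | "cyc (\<alpha> G0) (\<alpha> (G 1)) (\<alpha> (G 0))"
    using cyc_total by blast
  then have "inj G"
  proof cases
    case 1
    have s: "cyc (\<alpha> G0) (\<alpha> (G i)) (\<alpha> (G (Suc i)))" for i
    proof (induction i)
      case (Suc i)
      then show ?case using ret_cyc[OF G(1) G(1), of i "Suc i"] G(2) by simp
    qed (use 1 in simp)
    have "cyc (\<alpha> G0) (\<alpha> (G i)) (\<alpha> (G (Suc (i + k))))" for i k
    proof (induction k)
      case (Suc k)
      then show ?case using cyc_trans[OF _ s[of "Suc (i + k)"]] by simp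
    qed (use s in simp)
    then have lt: "cyc (\<alpha> G0) (\<alpha> (G i)) (\<alpha> (G j))" if "i < j" for i j
      using less_iff_Suc_add that by metis
    show ?thesis
    proof (rule linorder_inj_onI)
      show "G i \<noteq> G j" if "i < j" for i j using lt[OF that] cyc_irrefl by metis
    qed auto
  next
    case 2
    have s: "cyc (\<alpha> G0) (\<alpha> (G (Suc i))) (\<alpha> (G i))" for i
    proof (induction i)
      case (Suc i)
      then show ?case using ret_cyc[OF G(1) G(1), of "Suc i" i] G(2) by simp
    qed (use 2 in simp)
    have "cyc (\<alpha> G0) (\<alpha> (G (Suc (i + k)))) (\<alpha> (G i))" for i k
    proof (induction k)
      case (Suc k)
      then show ?case using cyc_trans[OF s[of "Suc (i + k)"]] by simp
    qed (use s in simp)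
    then have lt: "cyc (\<alpha> G0) (\<alpha> (G j)) (\<alpha> (G i))" if "i < j" for i j
      using less_iff_Suc_add that by metis
    show ?thesis
    proof (rule linorder_inj_onI)
      show "G i \<noteq> G j" if "i < j" for i j using lt[OF that] cyc_irrefl by metis
    qed auto
  qed
  moreover have "range G \<subseteq> arms T z" using G by blast
  ultimately show False using finite_arms finite_subset finite_imageD infinite_UNIV_nat by metis
qed

end

context hubbard
begin

theorem planar_no_evil:
  assumes "planar_dynamics T f" shows "\<not> has_evil_orbit T f m"
proof
  assume "has_evil_orbit T f m"
  then obtain w where w: "char_branch T f c w m" "(F ^^ m) (w, arm w c) = (w, arm w c)"
    using evil_orbitE by metis
  interpret w: char_branch T f c w m by (rule w(1))
  obtain h h' where h: "homeomorphism T (h ` T) h h'" "respects_cyclic_order T f (h :: 'a \<Rightarrow> complex)"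
    using assms by (auto simp: planar_dynamics_def)
  have "continuous_on T h" "inj_on h T"
    using h(1) by (auto simp: homeomorphism_def intro: inj_on_inverseI)
  moreover have r: "w.ret w.G0 = w.G0" using w(2) w.ret[of w.G0] by simp
  ultimately show False using w.planar_ret_G1[OF _ _ h(2)] w.evil_ret_G1(2)[OF r] by blast
qed

end

section \<open>Straight-line embedding with prescribed angles\<close>

lemma (in top_tree) seg_convex:
  assumes "x \<in> seg a b" "y \<in> seg a b" "a \<in> T" "b \<in> T"
  shows "seg x y \<subseteq> seg a b"
proof
  fix w assume w: "w \<in> seg x y"
  have T: "x \<in> T" "y \<in> T" using assms seg_in by blast+
  consider "y \<in> seg a x" | "y \<in> seg x b" using seg_split(1)[OF assms(1,3,4)] assms(2) by blast
  then show "w \<in> seg a b"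
  proof cases
    case 1
    have "w \<in> seg y x" using w seg_sym[OF T] by simp
    then have "w \<in> seg a x" using seg_sub2[OF _ 1 assms(3) T(1)] by blast
    then show ?thesis using seg_sub1[OF _ assms(1,3,4)] by blast
  next
    case 2
    have "w \<in> seg x b" using seg_sub1[OF w 2 T(1) assms(4)] .
    then show ?thesis using seg_sub2[OF _ assms(1,3,4)] by blast
  qed
qed

locale graph_tree = top_tree T for T :: "'a::t2_space set" +
  fixes Vs :: "'a set" and Es :: "'a set set"
  assumes finV: "finite Vs" and finE: "finite Es" and T_eq: "T = Vs \<union> \<Union>Es"
    and edge: "e \<in> Es \<Longrightarrow> \<exists>a b. is_arc e a b \<and> e \<inter> Vs = {a, b}"
    and meet: "\<lbrakk>e \<in> Es; e' \<in> Es; e \<noteq> e'\<rbrakk> \<Longrightarrow> e \<inter> e' \<subseteq> Vs"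
begin

lemma Vs_T: "v \<in> Vs \<Longrightarrow> v \<in> T" using T_eq by blast
lemma edge_T: "e \<in> Es \<Longrightarrow> e \<subseteq> T" using T_eq by blast

lemma edge_closed: "e \<in> Es \<Longrightarrow> closed e" using edge[of e] is_arc_closed by blast

lemma edge_rep:
  assumes "e \<in> Es" "v \<in> Vs" "v \<in> e"
  obtains w where "w \<in> Vs" "w \<noteq> v" "e = seg v w" "e \<inter> Vs = {v, w}"
proof -
  obtain a b where ab: "is_arc e a b" "e \<inter> Vs = {a, b}" using edge[OF assms(1)] by blast
  have "a \<noteq> b" using is_arc_ends[OF ab(1)] by blast
  have m: "a \<in> Vs" "b \<in> Vs" using ab(2) by auto
  have s: "seg a b = e" using seg_eq[OF ab(1) edge_T[OF assms(1)]] .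
  have s': "seg b a = e" using s seg_sym[OF Vs_T[OF m(1)] Vs_T[OF m(2)]] by simp
  have "v = a \<or> v = b" using assms ab(2) by blast
  then show ?thesis
  proof
    assume "v = a" then show ?thesis using that[of b] m s ab(2) \<open>a \<noteq> b\<close> by simp
  next
    assume "v = b" then show ?thesis using that[of a] m s' ab(2) \<open>a \<noteq> b\<close> by (simp add: insert_commute)
  qed
qed

lemma edge_ends:
  assumes "seg v w \<in> Es" "v \<in> Vs" "w \<in> Vs" "v \<noteq> w"
  shows "seg v w \<inter> Vs = {v, w}"
proof -
  have e: "v \<in> seg v w" "w \<in> seg v w" using seg_ends[OF Vs_T Vs_T] assms by auto
  obtain u where u: "seg v w \<inter> Vs = {v, u}" using edge_rep[OF assms(1,2) e(1)] by metis
  have "w \<in> seg v w \<inter> Vs" using e(2) assms(3) by blast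
  then have "w = u" unfolding u using assms(4) by auto
  then show ?thesis using u by simp
qed

lemma edge_arm_inj:
  assumes e: "seg v w \<in> Es" "seg v w' \<in> Es" and V: "v \<in> Vs" "w \<in> Vs" "w' \<in> Vs" "w \<noteq> v" "w' \<noteq> v"
    and a: "arm v w = arm v w'"
  shows "seg v w = seg v w'"
proof (rule ccontr)
  assume n: "seg v w \<noteq> seg v w'"
  obtain u where u: "u \<in> T" "u \<noteq> v" "u \<in> seg v w" "u \<in> seg v w'"
    using common_germ[OF a Vs_T Vs_T Vs_T] V by metis
  have "u \<in> Vs" using meet[OF e n] u by blast
  then have "u = w" "u = w'"
    using edge_ends[OF e(1) V(1,2)] edge_ends[OF e(2) V(1,3)] u V(4,5) by auto
  then show False using n by simp
qed

lemma arm_edge: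
  assumes "v \<in> Vs" "A \<in> arms T v"
  obtains w where "w \<in> Vs" "w \<noteq> v" "seg v w \<in> Es" "A = arm v w"
proof -
  obtain x where x: "x \<in> T" "x \<noteq> v" "A = arm v x" using assms(2) arms_nonempty by blast
  define Z where "Z = (Vs - {v}) \<union> \<Union>{e \<in> Es. v \<notin> e}"
  have "closed Z" unfolding Z_def using finV finE edge_closed
    by (intro closed_Un closed_Union) (auto intro: finite_imp_closed)
  then have "open (- Z)" "v \<in> - Z" by (auto simp: closed_def Z_def)
  then obtain y where y: "y \<in> T" "y \<noteq> v" "y \<in> - Z" "arm v y = arm v x"
    using arm_at[OF Vs_T[OF assms(1)] x(1,2)] by metis
  have "y \<notin> Vs" using y by (auto simp: Z_def)
  then obtain e where e: "e \<in> Es" "y \<in> e" using y(1) T_eq by blast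
  have "v \<in> e" using y(3) e by (auto simp: Z_def)
  then obtain w where w: "w \<in> Vs" "w \<noteq> v" "e = seg v w" using edge_rep[OF e(1) assms(1)] by metis
  have "arm v y = arm v w" using arm_seg[of y v w] e w y(2) Vs_T assms(1) by simp
  then show ?thesis using that w e y(4) x(3) by metis
qed

text \<open>\<open>v0\<close> is inserted so that the construction can start without edges.\<close>

definition X :: "'a \<Rightarrow> 'a set set \<Rightarrow> 'a set" where "X v0 A = insert v0 (\<Union>A)"

text \<open>The part \<open>X v0 A\<close> is embedded by \<open>h\<close> such that every edge is a straight segment leaving
  its end \<open>v\<close> at the angle prescribed by \<open>\<theta>\<close>, up to a rotation \<open>\<beta> v\<close>.\<close>

definition good :: "('a \<Rightarrow> 'a set \<Rightarrow> real) \<Rightarrow> 'a \<Rightarrow> 'a set set \<Rightarrow> ('a \<Rightarrow> complex) \<Rightarrow> ('a \<Rightarrow> real) \<Rightarrow> bool" where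
  "good \<theta> v0 A h \<beta> \<longleftrightarrow> A \<subseteq> Es \<and> (\<forall>x\<in>X v0 A. \<forall>y\<in>X v0 A. seg x y \<subseteq> X v0 A) \<and>
     continuous_on (X v0 A) h \<and> inj_on h (X v0 A) \<and>
     (\<forall>v\<in>Vs. \<forall>w\<in>Vs. v \<noteq> w \<longrightarrow> seg v w \<in> A \<longrightarrow>
        (\<forall>y\<in>seg v w. h y = h v + of_real (dist (h y) (h v)) * cis (\<beta> v + \<theta> v (arm v w))))"

lemma closed_X: "A \<subseteq> Es \<Longrightarrow> closed (X v0 A)"
  unfolding X_def using finE edge_closed
  by (intro closed_insert closed_Union) (auto intro: finite_subset)

lemma X_T: "\<lbrakk>A \<subseteq> Es; v0 \<in> Vs\<rbrakk> \<Longrightarrow> X v0 A \<subseteq> T"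
  unfolding X_def using edge_T Vs_T by blast

lemma X_edge_Vs:
  assumes "A \<subseteq> Es" "v0 \<in> Vs" "e \<in> Es" "e \<notin> A" "y \<in> e" "y \<in> X v0 A" shows "y \<in> Vs"
proof (cases "y = v0")
  case False
  then obtain e' where "e' \<in> A" "y \<in> e'" using assms(6) by (auto simp: X_def)
  then show ?thesis using meet[of e e'] assms by blast
qed (use assms in simp)

text \<open>By connectedness the rest of the tree touches \<open>X v0 A\<close>, and does so in a
  vertex. The edge found there has a new other end, since by convexity two ends in
  \<open>X v0 A\<close> would bring in the whole edge.\<close>

lemma next_edge:
  assumes A: "A \<subseteq> Es" "v0 \<in> Vs" "X v0 A \<noteq> T"
    and conv: "\<And>x y. \<lbrakk>x \<in> X v0 A; y \<in> X v0 A\<rbrakk> \<Longrightarrow> seg x y \<subseteq> X v0 A"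
  obtains v w where "v \<in> Vs" "w \<in> Vs" "v \<noteq> w" "seg v w \<in> Es" "seg v w \<notin> A" "v \<in> X v0 A" "w \<notin> X v0 A"
    "seg v w \<inter> X v0 A = {v}"
proof -
  define R where "R = \<Union>(Es - A) \<union> (Vs - X v0 A)"
  have cR: "closed R" unfolding R_def using finV finE edge_closed
    by (intro closed_Un closed_Union) (auto intro: finite_imp_closed)
  have TR: "T = X v0 A \<union> R"
    using X_T[OF A(1,2)] T_eq edge_T A(1) by (auto simp: R_def X_def)
  have "X v0 A \<inter> R \<noteq> {}"
  proof
    assume e: "X v0 A \<inter> R = {}"
    have "v0 \<in> X v0 A" by (simp add: X_def)
    moreover have "R \<noteq> {}" using A(3) TR by auto
    ultimately show False
      using connected_T closed_X[OF A(1), of v0] cR e TR unfolding connected_closed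
      by (metis Int_Un_eq(1) Un_upper1 Un_upper2 empty_iff inf.absorb2 inf_assoc inf_bot_left inf_commute order_refl)
  qed
  then obtain u where u: "u \<in> X v0 A" "u \<in> R" by blast
  then obtain e where e: "e \<in> Es" "e \<notin> A" "u \<in> e" by (auto simp: R_def)
  have uV: "u \<in> Vs" using X_edge_Vs[OF A(1,2) e u(1)] .
  obtain w where w: "w \<in> Vs" "w \<noteq> u" "e = seg u w" "e \<inter> Vs = {u, w}" using edge_rep[OF e(1) uV e(3)] .
  have wX: "w \<notin> X v0 A"
  proof
    assume "w \<in> X v0 A"
    then have sub: "seg u w \<subseteq> X v0 A" using conv u(1) by blast
    obtain y where y: "y \<in> seg u w" "y \<noteq> u" "y \<noteq> w"
      using seg_initial[OF Vs_T[OF uV] Vs_T[OF w(1)] w(2)[symmetric] open_UNIV] by (metis UNIV_I)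
    have "y \<in> Vs" using X_edge_Vs[OF A(1,2) e(1,2)] y(1) w(3) sub by blast
    then show False using w y by blast
  qed
  have "seg u w \<inter> X v0 A = {u}"
  proof -
    have "y = u" if "y \<in> e" "y \<in> X v0 A" for y
      using X_edge_Vs[OF A(1,2) e(1,2) that] w(4) that wX by blast
    then show ?thesis using e(3) u(1) w(3) by blast
  qed
  then show ?thesis using that[OF uV w(1) w(2)[symmetric]] e w(3) u(1) wX by blast
qed

lemma extend:
  assumes \<theta>: "\<And>v. v \<in> Vs \<Longrightarrow> inj_on (\<theta> v) (arms T v)"
    "\<And>v A. \<lbrakk>v \<in> Vs; A \<in> arms T v\<rbrakk> \<Longrightarrow> 0 \<le> \<theta> v A \<and> \<theta> v A < 2 * pi"
    and v0: "v0 \<in> Vs" and g: "good \<theta> v0 A h \<beta>" and ne: "X v0 A \<noteq> T"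
  obtains e h' \<beta>' where "e \<in> Es" "e \<notin> A" "good \<theta> v0 (insert e A) h' \<beta>'"
proof -
  let ?X = "X v0 A"
  have AE: "A \<subseteq> Es" and conv: "\<And>x y. \<lbrakk>x \<in> ?X; y \<in> ?X\<rbrakk> \<Longrightarrow> seg x y \<subseteq> ?X"
    and hc: "continuous_on ?X h" and hi: "inj_on h ?X"
    and ray: "\<And>v w y. \<lbrakk>v \<in> Vs; w \<in> Vs; v \<noteq> w; seg v w \<in> A; y \<in> seg v w\<rbrakk> \<Longrightarrow>
      h y = h v + of_real (dist (h y) (h v)) * cis (\<beta> v + \<theta> v (arm v w))"
    using g unfolding good_def by blast+
  have XT: "?X \<subseteq> T" using X_T[OF AE v0] .
  obtain v w where vw: "v \<in> Vs" "w \<in> Vs" "v \<noteq> w" "seg v w \<in> Es" "seg v w \<notin> A" "v \<in> ?X" "w \<notin> ?X"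
    "seg v w \<inter> ?X = {v}" using next_edge[OF AE v0 ne conv] .
  define e where "e = seg v w"
  have vT: "v \<in> T" "w \<in> T" using vw Vs_T by auto
  have eV: "e \<inter> Vs = {v, w}" using edge_ends[OF vw(4,1,2,3)] by (simp add: e_def)
  define \<phi> where "\<phi> = \<beta> v + \<theta> v (arm v w)"
  \<comment> \<open>\<open>Z\<close> is the part already drawn away from \<open>v\<close>, at
    distance at least \<open>d\<close> from \<open>h v\<close>. A new edge shorter than
    \<open>d\<close> can only collide with edges at \<open>v\<close>, and these leave in other
    directions because \<open>\<theta> v\<close> is injective.\<close>
  define Z where "Z = \<Union>{e' \<in> A. v \<notin> e'} \<union> ({v0} - {v})"
  have ZX: "Z \<subseteq> ?X" by (auto simp: Z_def X_def)
  have "closed (\<Union>{e' \<in> A. v \<notin> e'})" using AE finE edge_closed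
    by (intro closed_Union) (auto intro: finite_subset)
  moreover have "closed ({v0} - {v})" by (simp add: finite_imp_closed)
  ultimately have "closed Z" unfolding Z_def by (rule closed_Un)
  then have "compact Z" using compact_Int_closed[OF compact_T] ZX XT by (metis inf.absorb2 subset_trans)
  then have "compact (h ` Z)" by (intro compact_continuous_image continuous_on_subset[OF hc ZX])
  then have hZ: "closed (h ` Z)" by (rule compact_imp_closed)
  have hv: "h v \<notin> h ` Z"
  proof
    assume "h v \<in> h ` Z"
    then obtain y where y: "y \<in> Z" "h v = h y" by blast
    then have "y = v" using inj_onD[OF hi] vw(6) ZX by blast
    then show False using y(1) by (auto simp: Z_def)
  qed
  have "\<exists>d>0. \<forall>y\<in>h ` Z. d \<le> dist (h v) y" by (rule separate_point_closed[OF hZ hv])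
  then obtain d where d: "d > 0" "\<forall>y\<in>h ` Z. d \<le> dist (h v) y" by (elim exE conjE)
  have avoid: "y = v" if y: "y \<in> ?X" "h y = h v + of_real s * cis \<phi>" "0 \<le> s" "s < d" for y s
  proof (rule ccontr)
    assume yv: "y \<noteq> v"
    have ds: "dist (h y) (h v) = s" using y(2,3) by (simp add: dist_norm norm_mult)
    have "y \<notin> Z"
    proof
      assume "y \<in> Z"
      then have "h y \<in> h ` Z" by (rule imageI)
      then have "d \<le> dist (h v) (h y)" by (rule bspec[OF d(2)])
      then show False using ds y(4) by (simp add: dist_commute)
    qed
    then obtain e' where e': "e' \<in> A" "y \<in> e'" "v \<in> e'" using y(1) yv by (auto simp: Z_def X_def)
    obtain w' where w': "w' \<in> Vs" "w' \<noteq> v" "e' = seg v w'" using edge_rep[OF _ vw(1) e'(3)] e'(1) AE by blast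
    have h': "h y = h v + of_real s * cis (\<beta> v + \<theta> v (arm v w'))"
      using ray[OF vw(1) w'(1) w'(2)[symmetric], of y] e' w'(3) unfolding ds by simp
    have "h y \<noteq> h v" using inj_onD[OF hi, of y v] y(1) vw(6) yv by blast
    then have "s \<noteq> 0" using ds by auto
    then have "cis (\<beta> v + \<theta> v (arm v w)) = cis (\<beta> v + \<theta> v (arm v w'))"
      using h' y(2) by (simp add: \<phi>_def)
    then obtain n :: int where n: "\<beta> v + \<theta> v (arm v w) = \<beta> v + \<theta> v (arm v w') + 2 * pi * n" by (rule cis_eqD)
    have arms: "arm v w \<in> arms T v" "arm v w' \<in> arms T v"
      using arm_in_arms vT(2) vw(3) Vs_T[OF w'(1)] w'(2) by metis+
    have 1: "2 * pi * of_int n < 2 * pi * 1"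
      using n \<theta>(2)[OF vw(1) arms(1)] \<theta>(2)[OF vw(1) arms(2)] by linarith
    have 2: "2 * pi * (-1) < 2 * pi * of_int n"
      using n \<theta>(2)[OF vw(1) arms(1)] \<theta>(2)[OF vw(1) arms(2)] by linarith
    have "of_int n < (1::real)" "(-1::real) < of_int n"
      using mult_left_less_imp_less[OF 1] mult_left_less_imp_less[OF 2] pi_gt_zero by auto
    then have "n = 0" by linarith
    then have "\<theta> v (arm v w) = \<theta> v (arm v w')" using n by simp
    then have "arm v w = arm v w'" using inj_onD[OF \<theta>(1)[OF vw(1)]] arms by blast
    then have "seg v w = seg v w'"
      using edge_arm_inj[OF vw(4) _ vw(1,2) w'(1) vw(3)[symmetric] w'(2)] e'(1) w'(3) AE by blast
    then show False using vw(5) e'(1) w'(3) by simp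
  qed
  obtain gg where gg: "continuous_on {0..1::real} gg" "inj_on gg {0..1}" "gg ` {0..1} = e" "gg 0 = v" "gg 1 = w"
    using is_arcE[OF seg_arc[OF vT vw(3)]] unfolding e_def by metis
  obtain k where k: "homeomorphism {0..1} e gg k" using homeomorphism_compact[OF _ gg(1,3,2)] by auto
  have kc: "continuous_on e k" and ki: "k ` e = {0..1}" and kg: "\<And>y. y \<in> e \<Longrightarrow> gg (k y) = y"
    and gk: "\<And>s. s \<in> {0..1} \<Longrightarrow> k (gg s) = s" using k by (auto simp: homeomorphism_def)
  have k01: "k v = 0" "k w = 1" using gk[of 0] gk[of 1] gg(4,5) by auto
  have kr: "0 \<le> k y" "k y \<le> 1" if "y \<in> e" for y using ki that by auto
  have ve: "v \<in> e" "w \<in> e" using eV by auto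
  define r0 where "r0 = d / 2"
  have r0: "0 < r0" "r0 < d" using d(1) by (auto simp: r0_def)
  define h' where "h' = (\<lambda>y. if y \<in> ?X then h y else h v + of_real (r0 * k y) * cis \<phi>)"
  have hX: "h' y = h y" if "y \<in> ?X" for y using that by (simp add: h'_def)
  have he: "h' y = h v + of_real (r0 * k y) * cis \<phi>" if "y \<in> e" for y
  proof (cases "y \<in> ?X")
    case True
    then have "y = v" using vw(8) that by (auto simp: e_def)
    then show ?thesis using hX vw(6) k01 by simp
  qed (simp add: h'_def)
  \<comment> \<open>No edge at \<open>w\<close> has been drawn, so the rotation there is still free.
    It is chosen such that the reversed direction \<open>\<phi> + pi\<close> is the one prescribed
    for the arm of \<open>v\<close>.\<close>
  define \<beta>' where "\<beta>' = \<beta>(w := \<phi> + pi - \<theta> w (arm w v))"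
  have Xe: "X v0 (insert e A) = ?X \<union> e" by (auto simp: X_def)
  have eT: "e \<subseteq> T" using edge_T vw(4) by (simp add: e_def)
  have rk: "0 \<le> r0 * k y" "r0 * k y < d" if "y \<in> e" for y
  proof -
    show "0 \<le> r0 * k y" using kr[OF that] r0 by simp
    have "r0 * k y \<le> r0" by (rule mult_left_le) (use kr[OF that] r0 in auto)
    then show "r0 * k y < d" using r0(2) by (rule le_less_trans)
  qed
  have "good \<theta> v0 (insert e A) h' \<beta>'"
    unfolding good_def
  proof (intro conjI ballI impI)
    show "insert e A \<subseteq> Es" using AE vw(4) by (simp add: e_def)
    have ce: "closed e" using edge_closed vw(4) by (simp add: e_def)
    have "continuous_on ?X h'" using hc by (rule continuous_on_eq) (simp add: hX)
    moreover have "continuous_on e h'"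
    proof (rule continuous_on_eq)
      show "continuous_on e (\<lambda>y. h v + of_real (r0 * k y) * cis \<phi>)" by (intro continuous_intros kc)
    qed (simp add: he)
    ultimately show "continuous_on (X v0 (insert e A)) h'"
      unfolding Xe by (rule continuous_on_closed_Un[OF closed_X[OF AE] ce])
    have 1: "x = y" if "x \<in> ?X" "y \<in> e" "h' x = h' y" for x y
    proof -
      have eq: "h x = h v + of_real (r0 * k y) * cis \<phi>" using that he hX by simp
      have xv: "x = v" using avoid[OF that(1) eq rk[OF that(2)]] .
      then have "of_real (r0 * k y) * cis \<phi> = 0" using eq by simp
      then have "k y = 0" using r0(1) by simp
      then have "k y = k v" using k01 by simp
      then have "y = v" using kg[OF that(2)] kg[OF ve(1)] by metis
      then show ?thesis using xv by simp
    qed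
    have 2: "x = y" if "x \<in> e" "y \<in> e" "h' x = h' y" for x y
    proof -
      have "of_real (r0 * k x) * cis \<phi> = of_real (r0 * k y) * cis \<phi>" using that he by simp
      then have "k x = k y" using r0(1) by simp
      then show ?thesis using kg[OF that(1)] kg[OF that(2)] by metis
    qed
    show "inj_on h' (X v0 (insert e A))"
      unfolding Xe
    proof (rule inj_onI)
      fix x y assume a: "x \<in> ?X \<union> e" "y \<in> ?X \<union> e" "h' x = h' y"
      consider "x \<in> ?X" "y \<in> ?X" | "x \<in> ?X" "y \<in> e" | "x \<in> e" "y \<in> ?X" | "x \<in> e" "y \<in> e" using a by blast
      then show "x = y"
      proof cases
        case 1 then show ?thesis using inj_onD[OF hi] a(3) hX by simp
      next
        case 2 then show ?thesis using 1[OF _ _ a(3)] by blast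
      next
        case 3 then show ?thesis using 1[OF _ _ a(3)[symmetric]] by blast
      next
        case 4 then show ?thesis using 2[OF _ _ a(3)] by blast
      qed
    qed
  next
    fix x y assume xy: "x \<in> X v0 (insert e A)" "y \<in> X v0 (insert e A)"
    have ee: "seg x y \<subseteq> e" if "x \<in> e" "y \<in> e" for x y
      using seg_convex that vT unfolding e_def by blast
    have Xe': "seg x y \<subseteq> ?X \<union> e" if "x \<in> ?X" "y \<in> e" for x y
    proof
      fix u assume "u \<in> seg x y"
      then have "u \<in> seg x v \<or> u \<in> seg v y" using seg_trans[OF _ _ _ vT(1)] that XT eT by blast
      then show "u \<in> ?X \<union> e" using conv[OF that(1) vw(6)] ee[OF ve(1) that(2)] by blast
    qed
    have T: "x \<in> T" "y \<in> T" using xy XT eT unfolding Xe by blast+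
    consider "x \<in> ?X" "y \<in> ?X" | "x \<in> ?X" "y \<in> e" | "x \<in> e" "y \<in> ?X" | "x \<in> e" "y \<in> e"
      using xy unfolding Xe by blast
    then show "seg x y \<subseteq> X v0 (insert e A)"
      unfolding Xe
    proof cases
      case 1 then show "seg x y \<subseteq> ?X \<union> e" using conv by blast
    next
      case 2 then show "seg x y \<subseteq> ?X \<union> e" by (rule Xe')
    next
      case 3 then show "seg x y \<subseteq> ?X \<union> e" using Xe'[of y x] seg_sym[OF T] by simp
    next
      case 4 then show "seg x y \<subseteq> ?X \<union> e" using ee by blast
    qed
  next
    fix a b y assume ab: "a \<in> Vs" "b \<in> Vs" "a \<noteq> b" "seg a b \<in> insert e A" "y \<in> seg a b"
    show "h' y = h' a + of_real (dist (h' y) (h' a)) * cis (\<beta>' a + \<theta> a (arm a b))"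
    proof (cases "seg a b \<in> A")
      case True
      have "a \<in> seg a b" using seg_ends Vs_T ab by blast
      then have X: "a \<in> ?X" "y \<in> ?X" using True ab(5) by (auto simp: X_def)
      then have "a \<noteq> w" using vw(7) by blast
      then have e1: "h' y = h y" "h' a = h a" "\<beta>' a = \<beta> a" using hX X by (auto simp: \<beta>'_def)
      show ?thesis unfolding e1 by (rule ray[OF ab(1-3) True ab(5)])
    next
      case False
      then have s: "seg a b = e" using ab(4) by blast
      then have ye: "y \<in> e" using ab(5) by simp
      have "{a, b} = {v, w}" using edge_ends[OF _ ab(1-3)] s eV vw(4) unfolding e_def by metis
      then consider "a = v" "b = w" | "a = w" "b = v" using doubleton_eq_iff by metis
      then show ?thesis
      proof cases
        case 1
        have "h' a = h v" using 1 hX vw(6) by simp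
        moreover have "dist (h' y) (h v) = r0 * k y"
          using he[OF ye] kr(1)[OF ye] r0(1) by (simp add: dist_norm norm_mult)
        moreover have "\<beta>' a + \<theta> a (arm a b) = \<phi>" using 1 vw(3) by (simp add: \<beta>'_def \<phi>_def)
        ultimately show ?thesis using he[OF ye] by simp
      next
        case 2
        have hw: "h' a = h v + of_real r0 * cis \<phi>" using 2 he[OF ve(2)] k01 by simp
        have "h' y - h' a = of_real (r0 * (1 - k y)) * (- cis \<phi>)"
          using he[OF ye] hw by (simp add: algebra_simps)
        then have e1: "h' y - h' a = of_real (r0 * (1 - k y)) * cis (\<phi> + pi)"
          by (simp only: minus_cis)
        have nonneg: "0 \<le> r0 * (1 - k y)" using kr[OF ye] r0 by simp
        have "norm (h' y - h' a) = \<bar>r0 * (1 - k y)\<bar>"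
          unfolding e1 norm_mult norm_cis norm_of_real by (rule mult_1_right)
        then have "norm (h' y - h' a) = r0 * (1 - k y)" using nonneg by (simp only: abs_of_nonneg)
        then have "h' y - h' a = of_real (dist (h' y) (h' a)) * cis (\<phi> + pi)" using e1 by (simp add: dist_norm)
        moreover have "\<beta>' a + \<theta> a (arm a b) = \<phi> + pi" using 2 by (simp add: \<beta>'_def)
        ultimately show ?thesis by (simp add: algebra_simps)
      qed
    qed
  qed
  then show ?thesis using that vw(4,5) unfolding e_def by blast
qed

lemma good_exists:
  assumes \<theta>: "\<And>v. v \<in> Vs \<Longrightarrow> inj_on (\<theta> v) (arms T v)"
    "\<And>v A. \<lbrakk>v \<in> Vs; A \<in> arms T v\<rbrakk> \<Longrightarrow> 0 \<le> \<theta> v A \<and> \<theta> v A < 2 * pi"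
    and v0: "v0 \<in> Vs"
  shows "\<exists>A h \<beta>. good \<theta> v0 A h \<beta> \<and> X v0 A = T"
proof -
  have step: "good \<theta> v0 A h \<beta> \<Longrightarrow> ?thesis" if "card (Es - A) = n" for n A h \<beta>
    using that
  proof (induction n arbitrary: A h \<beta> rule: less_induct)
    case (less n)
    show ?case
    proof (cases "X v0 A = T")
      case True then show ?thesis using less.prems by blast
    next
      case False
      obtain e h' \<beta>' where e: "e \<in> Es" "e \<notin> A" "good \<theta> v0 (insert e A) h' \<beta>'"
        using extend[OF \<theta> v0 less.prems(1) False] .
      have "Es - insert e A \<subset> Es - A" using e by blast
      then have "card (Es - insert e A) < n" using psubset_card_mono[of "Es - A"] finE less.prems(2) by simp
      then show ?thesis using less.IH[OF _ e(3) refl] by blast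
    qed
  qed
  have "good \<theta> v0 {} (\<lambda>_. 0) (\<lambda>_. 0)" by (simp add: good_def X_def)
  then show ?thesis using step by blast
qed

theorem planar_embedding:
  assumes \<theta>: "\<And>v. v \<in> Vs \<Longrightarrow> inj_on (\<theta> v) (arms T v)"
    "\<And>v A. \<lbrakk>v \<in> Vs; A \<in> arms T v\<rbrakk> \<Longrightarrow> 0 \<le> \<theta> v A \<and> \<theta> v A < 2 * pi"
  shows "\<exists>(h :: 'a \<Rightarrow> complex) \<beta>. continuous_on T h \<and> inj_on h T \<and>
    (\<forall>v\<in>Vs. \<forall>A\<in>arms T v. \<forall>\<^sub>F r in at_right 0.
       \<exists>y. first_exit T h r v A y \<and> h y = h v + of_real r * cis (\<beta> v + \<theta> v A))"
proof -
  have "Vs \<noteq> {}"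
  proof
    assume V: "Vs = {}"
    then have "Es \<noteq> {}" using T_eq T_nonempty by auto
    then show False using edge V by blast
  qed
  then obtain v0 where v0: "v0 \<in> Vs" by blast
  obtain A h \<beta> where g: "good \<theta> v0 A h \<beta>" "X v0 A = T" using good_exists[OF \<theta> v0] by blast
  have h: "continuous_on T h" "inj_on h T" and AE: "A \<subseteq> Es" using g by (auto simp: good_def)
  have AE': "e \<in> A" if e: "e \<in> Es" for e
  proof (rule ccontr)
    assume n: "e \<notin> A"
    have "e \<subseteq> Vs" using X_edge_Vs[OF AE v0 e n] edge_T[OF e] g(2) by blast
    moreover obtain a b where ab: "is_arc e a b" "e \<inter> Vs = {a, b}" using edge[OF e] by blast
    ultimately have "e = {a, b}" by blast
    moreover have "seg a b = e" "a \<noteq> b" using seg_eq[OF ab(1) edge_T[OF e]] is_arc_ends[OF ab(1)] by auto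
    moreover obtain y where "y \<in> seg a b" "y \<noteq> a" "y \<noteq> b"
      using seg_initial[of a b UNIV] ab(2) Vs_T \<open>a \<noteq> b\<close> by (metis Int_iff UNIV_I insertCI open_UNIV)
    ultimately show False by blast
  qed
  have "\<forall>\<^sub>F r in at_right 0. \<exists>y. first_exit T h r v B y \<and> h y = h v + of_real r * cis (\<beta> v + \<theta> v B)"
    if v: "v \<in> Vs" and B: "B \<in> arms T v" for v B
  proof -
    obtain w where w: "w \<in> Vs" "w \<noteq> v" "seg v w \<in> Es" "B = arm v w" using arm_edge[OF v B] .
    have T: "v \<in> T" "w \<in> T" using Vs_T v w by auto
    have "dist (h w) (h v) > 0" using inj_onD[OF h(2) _ T(2,1)] w(2) by auto
    then have "\<forall>\<^sub>F r in at_right 0. r < dist (h w) (h v)" by (rule eventually_lt_dist)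
    moreover have "\<forall>\<^sub>F r in at_right (0::real). 0 < r" by (simp add: eventually_at_right_less)
    ultimately show ?thesis
    proof eventually_elim
      case (elim r)
      obtain y where y: "y \<in> seg v w" "first_exit T h r v (arm v w) y"
        using first_exit_exists[OF h T w(2) elim(2,1)] .
      have "h y = h v + of_real (dist (h y) (h v)) * cis (\<beta> v + \<theta> v (arm v w))"
        using g(1) AE'[OF w(3)] v w y(1) unfolding good_def by metis
      moreover have "dist (h y) (h v) = r" using y(2) by (simp add: first_exit_def)
      ultimately show ?case using y(2) w(4) by auto
    qed
  qed
  then have "\<forall>v\<in>Vs. \<forall>B\<in>arms T v. \<forall>\<^sub>F r in at_right 0.
      \<exists>y. first_exit T h r v B y \<and> h y = h v + of_real r * cis (\<beta> v + \<theta> v B)" by blast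
  then show ?thesis using h by blast
qed

end

text \<open>Lowering distinct residues by one keeps their cyclic order: at most one of them wraps
  around, from 0 to \<open>N - 1\<close>.\<close>

lemma cyc_mod_pred:
  fixes N :: nat
  assumes c: "cyc (real a) (real b) (real c)" and lt: "a < N" "b < N" "c < N" "a' < N" "b' < N" "c' < N"
    and s: "Suc a' mod N = a" "Suc b' mod N = b" "Suc c' mod N = c"
  shows "cyc (real a') (real b') (real c')"
proof -
  have *: "(Suc x' < N \<and> x = Suc x') \<or> (Suc x' = N \<and> x = 0)" if "x' < N" "Suc x' mod N = x" for x' x :: nat
    using that by (cases "Suc x' = N") auto
  show ?thesis
    using c *[OF lt(4) s(1)] *[OF lt(5) s(2)] *[OF lt(6) s(3)] unfolding cyc_def by auto
qed

lemma cyc_scale: "k > 0 \<Longrightarrow> cyc (k * a) (k * b) (k * c) \<longleftrightarrow> cyc a b c"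
  by (simp add: cyc_def)

section \<open>Angles from arrival times when all orbits are tame\<close>

context hubbard
begin

lemma branch_periodic_point:
  assumes x: "x \<in> branch_points T" and p: "\<exists>n>0. (f ^^ n) x = x"
  obtains m where "periodic_point T f c x m"
proof -
  define m where "m = (LEAST n. n > 0 \<and> (f ^^ n) x = x)"
  have m: "m > 0 \<and> (f ^^ m) x = x" unfolding m_def using p by (rule LeastI_ex)
  have least: "(f ^^ n) x \<noteq> x" if "1 \<le> n" "n < m" for n
    using not_less_Least[OF that(2)[unfolded m_def]] that(1) by simp
  have "periodic_point T f c x m"
    by (rule branch_periodic_pointI[OF x _ _ least]) (use m in auto)
  then show ?thesis using that by blast
qed

lemma branch_eventually_periodic:
  assumes x: "x \<in> branch_points T"
  obtains i where "\<exists>n>0. (f ^^ n) ((f ^^ i) x) = (f ^^ i) x"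
proof -
  have "\<not> inj_on (\<lambda>n. (f ^^ n) x) (UNIV :: nat set)"
  proof
    assume "inj_on (\<lambda>n. (f ^^ n) x) (UNIV :: nat set)"
    moreover have "range (\<lambda>n. (f ^^ n) x) \<subseteq> branch_points T" using fp_branch[OF x] by blast
    ultimately show False using finite_branch_points finite_subset finite_imageD infinite_UNIV_nat by metis
  qed
  then obtain p q :: nat where pq: "p \<noteq> q" "(f ^^ p) x = (f ^^ q) x" unfolding inj_on_def by blast
  define i j where "i = min p q" and "j = max p q"
  have ij: "i < j" "(f ^^ i) x = (f ^^ j) x" using pq by (auto simp: i_def j_def min_def max_def)
  have "(f ^^ (j - i)) ((f ^^ i) x) = (f ^^ (j - i + i)) x" by (simp only: funpow_add comp_apply)
  also have "\<dots> = (f ^^ i) x" using ij by simp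
  finally show ?thesis using that[of i] ij(1) by (intro that[of i] exI[of _ "j - i"]) simp
qed

definition BA :: "('a \<times> 'a set) set" where "BA = Sigma (branch_points T) (arms T)"

lemma F_BA: "a \<in> BA \<Longrightarrow> F a \<in> BA"
  using local_arm_image_arms f_branch branch_T by (cases a) (auto simp: BA_def F_arm)

lemma Fn_BA: "a \<in> BA \<Longrightarrow> (F ^^ n) a \<in> BA" by (induction n) (auto intro: F_BA)

lemma Fn_BA_inj:
  assumes "(x, A) \<in> BA" "(x, B) \<in> BA" "(F ^^ n) (x, A) = (F ^^ n) (x, B)"
  shows "A = B"
  using assms(3)
proof (induction n)
  case (Suc n)
  obtain y A' where 1: "(F ^^ n) (x, A) = (y, A')" by fastforce
  obtain y' B' where 2: "(F ^^ n) (x, B) = (y', B')" by fastforce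
  have y: "y = (f ^^ n) x" "y' = y" using fst_Fn[of n "(x, A)"] fst_Fn[of n "(x, B)"] 1 2 by auto
  have BA: "(y, A') \<in> BA" "(y, B') \<in> BA" using Fn_BA[OF assms(1), of n] Fn_BA[OF assms(2), of n] 1 2 y by auto
  then have yb: "y \<in> T" "y \<noteq> c" using branch_T c_not_branch by (auto simp: BA_def)
  have "local_arm_image T f y A' = local_arm_image T f y B'" using Suc.prems 1 2 y(2) by (simp add: F_arm)
  then have "A' = B'" using inj_onD[OF local_arm_image_inj[OF yb]] BA by (auto simp: BA_def)
  then show ?case using Suc.IH 1 2 y(2) by simp
qed simp

text \<open>The local arms over the cycle into which the orbit of \<open>x\<close> falls. This set
  is the same for \<open>x\<close> and \<open>f x\<close>, so the choice made in \<open>base\<close>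
  is the same for both.\<close>

definition PA :: "'a \<Rightarrow> ('a \<times> 'a set) set" where
  "PA x = {(w, A). (\<exists>i. w = (f ^^ i) x) \<and> (\<exists>n>0. (f ^^ n) w = w) \<and> A \<in> arms T w}"

lemma PA_f:
  shows "PA (f x) = PA x"
proof -
  have "(\<exists>i. w = (f ^^ i) (f x)) \<longleftrightarrow> (\<exists>i. w = (f ^^ i) x)" if "n > 0" "(f ^^ n) w = w" for w n
  proof
    assume "\<exists>i. w = (f ^^ i) (f x)"
    then obtain i where "w = (f ^^ i) (f x)" ..
    then have "w = (f ^^ Suc i) x" by (simp add: funpow_swap1)
    then show "\<exists>i. w = (f ^^ i) x" by blast
  next
    assume "\<exists>i. w = (f ^^ i) x"
    then obtain i where i: "w = (f ^^ i) x" ..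
    obtain n' where n': "n = Suc n'" using \<open>n > 0\<close> by (cases n) auto
    have "w = (f ^^ n) ((f ^^ i) x)" using that(2) i by simp
    also have "\<dots> = (f ^^ n') (f ((f ^^ i) x))" by (simp add: n' funpow_swap1)
    also have "f ((f ^^ i) x) = (f ^^ i) (f x)" by (simp add: funpow_swap1)
    also have "(f ^^ n') ((f ^^ i) (f x)) = (f ^^ (n' + i)) (f x)" by (simp add: funpow_add)
    finally show "\<exists>i. w = (f ^^ i) (f x)" by blast
  qed
  then show ?thesis unfolding PA_def by auto
qed

definition base :: "'a \<Rightarrow> 'a \<times> 'a set" where "base x = (SOME b. b \<in> PA x)"

definition time :: "'a \<Rightarrow> 'a set \<Rightarrow> nat" where "time x A = (LEAST n. (F ^^ n) (x, A) = base x)"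

definition len :: "'a \<Rightarrow> nat" where "len x = (LEAST n. n > 0 \<and> (F ^^ n) (base x) = base x)"

lemma base_f: "base (f x) = base x" and len_f: "len (f x) = len x"
  by (simp_all add: base_def len_def PA_f)

context
  assumes tame: "\<And>m. \<not> has_evil_orbit T f m"
begin

lemma PA_reach:
  assumes x: "x \<in> branch_points T" and ab: "a \<in> PA x" "b \<in> PA x"
  obtains n where "n > 0" "(F ^^ n) a = b"
proof -
  obtain w A where a: "a = (w, A)" by fastforce
  obtain u B where b: "b = (u, B)" by fastforce
  have w: "\<exists>i. w = (f ^^ i) x" "\<exists>n>0. (f ^^ n) w = w" "A \<in> arms T w" using ab(1) a by (auto simp: PA_def)
  have u: "\<exists>i. u = (f ^^ i) x" "\<exists>n>0. (f ^^ n) u = u" "B \<in> arms T u" using ab(2) b by (auto simp: PA_def)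
  have wb: "w \<in> branch_points T" using w(1) fp_branch[OF x] by blast
  obtain m where "periodic_point T f c w m" using branch_periodic_point[OF wb w(2)] .
  then interpret w: periodic_point T f c w m .
  have uo: "u \<in> w.orb"
  proof -
    obtain i j where ij: "w = (f ^^ i) x" "u = (f ^^ j) x" using w(1) u(1) by blast
    obtain n where n: "n > 0" "(f ^^ n) u = u" using u(2) by blast
    have "(f ^^ (n * k)) u = u" for k
    proof (induction k)
      case (Suc k)
      have "(f ^^ (n * Suc k)) u = (f ^^ n) ((f ^^ (n * k)) u)" by (simp add: funpow_add)
      then show ?case using Suc n(2) by simp
    qed simp
    then have "u = (f ^^ (n * i)) ((f ^^ j) x)" using ij(2) by simp
    also have "\<dots> = (f ^^ (n * i + j)) x" by (simp add: funpow_add)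
    also have "n * i + j = (n * i + j - i) + i" using n(1) by (cases n) auto
    also have "(f ^^ (n * i + j - i + i)) x = (f ^^ (n * i + j - i)) w"
      unfolding ij(1) by (simp only: funpow_add comp_apply)
    finally show ?thesis using w.orbI by simp
  qed
  have "branch_orbit T f m w.orb"
    unfolding branch_orbit_def periodic_orbit_def
    using w.m w.per w.exact_neq fp_branch[OF wb] by (auto simp: w.orb_def)
  then have "tame T f w.orb" using tame by (auto simp: has_evil_orbit_def)
  moreover have SA: "a \<in> w.SA" "b \<in> w.SA" using a b w(3) u(3) uo w.z_orb by (auto simp: w.SA_iff)
  ultimately obtain n where n: "(F ^^ n) a = b" unfolding tame_def w.SA_def by blast
  \<comment> \<open>A return of \<open>b\<close> to itself is appended to make the time positive, as
    \<open>len\<close> demands.\<close>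
  obtain k where k: "k \<ge> 1" "(F ^^ k) b = b" using w.Fn_return[OF SA(2)] by metis
  have "(F ^^ (k + n)) a = b" using n k by (simp add: funpow_add)
  then show ?thesis using that[of "k + n"] k by simp
qed

lemma PA_eventually:
  assumes "(x, A) \<in> BA" obtains i where "(F ^^ i) (x, A) \<in> PA x"
proof -
  have x: "x \<in> branch_points T" using assms by (simp add: BA_def)
  obtain i where i: "\<exists>n>0. (f ^^ n) ((f ^^ i) x) = (f ^^ i) x" using branch_eventually_periodic[OF x] .
  obtain B where B: "(F ^^ i) (x, A) = ((f ^^ i) x, B)"
    using fst_Fn[of i "(x, A)"] by (metis fst_conv prod.collapse)
  then have "B \<in> arms T ((f ^^ i) x)" using Fn_BA[OF assms, of i] by (simp add: BA_def)
  then have "(F ^^ i) (x, A) \<in> PA x" using i B by (auto simp: PA_def)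
  then show ?thesis using that by blast
qed

lemma base_PA: "(x, A) \<in> BA \<Longrightarrow> base x \<in> PA x"
  unfolding base_def using PA_eventually by (metis someI_ex)

lemma len:
  assumes "(x, A) \<in> BA" shows "len x > 0" "(F ^^ len x) (base x) = base x"
proof -
  have x: "x \<in> branch_points T" using assms by (simp add: BA_def)
  have "\<exists>n. n > 0 \<and> (F ^^ n) (base x) = base x"
    using PA_reach[OF x base_PA[OF assms] base_PA[OF assms]] by metis
  from LeastI_ex[OF this] show "len x > 0" "(F ^^ len x) (base x) = base x" by (auto simp: len_def)
qed

lemma len_mult: "(x, A) \<in> BA \<Longrightarrow> (F ^^ (k * len x)) (base x) = base x"
proof (induction k)
  case (Suc k)
  have "(F ^^ (Suc k * len x)) (base x) = (F ^^ len x) ((F ^^ (k * len x)) (base x))" by (simp add: funpow_add)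
  then show ?case using Suc len(2) by simp
qed simp

lemma time:
  assumes "(x, A) \<in> BA" shows "(F ^^ time x A) (x, A) = base x"
proof -
  have x: "x \<in> branch_points T" using assms by (simp add: BA_def)
  obtain i where i: "(F ^^ i) (x, A) \<in> PA x" using PA_eventually[OF assms] .
  obtain n where "(F ^^ n) ((F ^^ i) (x, A)) = base x" using PA_reach[OF x i base_PA[OF assms]] by metis
  then have "(F ^^ (n + i)) (x, A) = base x" by (simp add: funpow_add)
  then show ?thesis unfolding time_def by (rule LeastI)
qed

text \<open>Arms whose arrival times are congruent are both at the base arm at the later of the two
  times, and iterates of \<open>F\<close> do not identify arms at a branch point.\<close>

lemma time_inj:
  assumes "(x, A) \<in> BA" "(x, B) \<in> BA" "time x A mod len x = time x B mod len x"
  shows "A = B"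
proof -
  have *: "A = B" if A: "(x, A) \<in> BA" and B: "(x, B) \<in> BA" and e: "time x A mod len x = time x B mod len x"
    and le: "time x A \<le> time x B" for A B
  proof -
    obtain k where k: "time x B = time x A + len x * k" using mod_eq_nat2E[OF e le] .
    have "(F ^^ time x B) (x, A) = (F ^^ (k * len x + time x A)) (x, A)" by (simp add: k ac_simps)
    also have "\<dots> = (F ^^ (k * len x)) (base x)" using time[OF A] by (simp add: funpow_add)
    also have "\<dots> = base x" using len_mult[OF A] .
    also have "\<dots> = (F ^^ time x B) (x, B)" using time[OF B] by simp
    finally show ?thesis by (rule Fn_BA_inj[OF A B])
  qed
  show ?thesis
  proof (cases "time x A \<le> time x B")
    case True then show ?thesis using *[OF assms] by blast
  next
    case False then show ?thesis using *[OF assms(2,1) assms(3)[symmetric]] by simp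
  qed
qed

text \<open>One step uses up one unit of arrival time. The exception is the base arm itself, with
  time 0, whose image needs \<open>len x - 1\<close> further steps; hence the reduction modulo
  \<open>len x\<close>.\<close>

lemma time_step:
  assumes A: "(x, A) \<in> BA"
  shows "Suc (time (f x) (local_arm_image T f x A)) mod len x = time x A mod len x"
proof -
  define A' where "A' = local_arm_image T f x A"
  have F: "F (x, A) = (f x, A')" by (simp add: F_arm A'_def)
  have BA': "(f x, A') \<in> BA" using F_BA[OF A] F by simp
  have Sn: "(F ^^ Suc n) (x, A) = (F ^^ n) (f x, A')" for n
    using F by (simp only: funpow_Suc_right comp_apply)
  have t': "(F ^^ time (f x) A') (f x, A') = base x" using time[OF BA'] base_f by simp
  have min': "time (f x) A' \<le> n" if "(F ^^ n) (f x, A') = base x" for n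
    unfolding time_def base_f using that by (rule Least_le)
  have min: "time x A \<le> n" if "(F ^^ n) (x, A) = base x" for n
    unfolding time_def using that by (rule Least_le)
  show ?thesis
  proof (cases "time x A")
    case (Suc n)
    have "(F ^^ n) (f x, A') = base x" using time[OF A] Suc Sn by metis
    then have "time (f x) A' \<le> n" by (rule min')
    moreover have "time x A \<le> Suc (time (f x) A')" using min[of "Suc (time (f x) A')"] t' Sn by simp
    ultimately show ?thesis using Suc by (simp add: A'_def)
  next
    case 0
    then have b: "(x, A) = base x" using time[OF A] by simp
    have ret: "(F ^^ Suc (time (f x) A')) (base x) = base x" using t' Sn b by simp
    have "len x \<le> Suc (time (f x) A')" unfolding len_def by (rule Least_le) (use ret in simp)
    moreover have "Suc (time (f x) A') \<le> len x"
    proof -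
      obtain k where k: "len x = Suc k" using len(1)[OF A] by (cases "len x") auto
      have "(F ^^ k) (f x, A') = base x" using len(2)[OF A] Sn[of k] b k by metis
      then show ?thesis using min'[of k] k by simp
    qed
    ultimately have "Suc (time (f x) A') = len x" by simp
    then show ?thesis using 0 by (simp add: A'_def)
  qed
qed

lemma angles_exist:
  "\<exists>\<theta> :: 'a \<Rightarrow> 'a set \<Rightarrow> real. (\<forall>x. inj_on (\<theta> x) (arms T x)) \<and>
    (\<forall>x. \<forall>A\<in>arms T x. 0 \<le> \<theta> x A \<and> \<theta> x A < 2 * pi) \<and>
    (\<forall>x\<in>branch_points T. \<forall>A\<in>arms T x. \<forall>B\<in>arms T x. \<forall>C\<in>arms T x. cyc (\<theta> x A) (\<theta> x B) (\<theta> x C) \<longrightarrow>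
      cyc (\<theta> (f x) (local_arm_image T f x A)) (\<theta> (f x) (local_arm_image T f x B)) (\<theta> (f x) (local_arm_image T f x C)))"
proof -
  have "\<exists>g :: 'a set \<Rightarrow> real. inj_on g (arms T x) \<and> (\<forall>A\<in>arms T x. 0 \<le> g A \<and> g A < 2 * pi)" for x
  proof -
    define n where "n = card (arms T x)"
    obtain g where g: "bij_betw g (arms T x) {0..<n}"
      unfolding n_def using ex_bij_betw_finite_nat[OF finite_arms] by blast
    have "inj_on (\<lambda>A. 2 * pi / real n * real (g A)) (arms T x)"
    proof (rule inj_onI)
      fix A B assume AB: "A \<in> arms T x" "B \<in> arms T x" "2 * pi / real n * real (g A) = 2 * pi / real n * real (g B)"
      have "g A < n" using bij_betwE[OF g] AB(1) by auto
      then have "g A = g B" using AB(3) by simp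
      then show "A = B" using g AB(1,2) by (auto simp: bij_betw_def dest: inj_onD)
    qed
    moreover have "0 \<le> 2 * pi / real n * real (g A) \<and> 2 * pi / real n * real (g A) < 2 * pi" if "A \<in> arms T x" for A
    proof -
      have "g A < n" using bij_betwE[OF g] that by auto
      then show ?thesis by (simp add: divide_simps)
    qed
    ultimately show ?thesis by blast
  qed
  then obtain g :: "'a \<Rightarrow> 'a set \<Rightarrow> real" where
    g: "\<And>x. inj_on (g x) (arms T x)" "\<And>x A. A \<in> arms T x \<Longrightarrow> 0 \<le> g x A \<and> g x A < 2 * pi" by metis
  define k where "k x = 2 * pi / real (len x)" for x
  \<comment> \<open>At branch points the arrival times modulo \<open>len x\<close> mark positions on
    the circle; at other points any injective choice \<open>g\<close> will do.\<close>
  define \<theta> where "\<theta> x A = (if x \<in> branch_points T then k x * real (time x A mod len x) else g x A)" for x A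
  have k: "k x > 0" if "(x, A) \<in> BA" for x A using len(1)[OF that] by (simp add: k_def)
  have BA: "(x, A) \<in> BA" if "x \<in> branch_points T" "A \<in> arms T x" for x A using that by (simp add: BA_def)
  have 1: "inj_on (\<theta> x) (arms T x)" for x
    proof (cases "x \<in> branch_points T")
      case True
      show ?thesis
      proof (rule inj_onI)
        fix A B assume AB: "A \<in> arms T x" "B \<in> arms T x" "\<theta> x A = \<theta> x B"
        then have "time x A mod len x = time x B mod len x"
          using True k[OF BA[OF True AB(1)]] by (simp add: \<theta>_def)
        then show "A = B" using time_inj BA[OF True] AB by blast
      qed
    next
      case False
      then have "\<theta> x = g x" by (auto simp: \<theta>_def)
      then show ?thesis using g(1) by simp
    qed
  have 2: "0 \<le> \<theta> x A \<and> \<theta> x A < 2 * pi" if A: "A \<in> arms T x" for x A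
    proof (cases "x \<in> branch_points T")
      case True
      have l: "len x > 0" using len(1)[OF BA[OF True A]] .
      then have "time x A mod len x < len x" by simp
      then show ?thesis using True l by (simp add: \<theta>_def k_def divide_simps)
    next
      case False then show ?thesis using g(2)[OF A] by (simp add: \<theta>_def)
    qed
  have 3: "cyc (\<theta> (f x) (local_arm_image T f x A)) (\<theta> (f x) (local_arm_image T f x B))
       (\<theta> (f x) (local_arm_image T f x C))"
    if x: "x \<in> branch_points T" and ABC: "A \<in> arms T x" "B \<in> arms T x" "C \<in> arms T x"
      and c: "cyc (\<theta> x A) (\<theta> x B) (\<theta> x C)" for x A B C
  proof -
    have l: "len x > 0" using len(1)[OF BA[OF x ABC(1)]] .
    have kx: "k x > 0" using k[OF BA[OF x ABC(1)]] .
    have c': "cyc (real (time x A mod len x)) (real (time x B mod len x)) (real (time x C mod len x))"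
      using c x cyc_scale[OF kx] by (simp add: \<theta>_def)
    have s: "Suc (time (f x) (local_arm_image T f x D) mod len x) mod len x = time x D mod len x"
      if "D \<in> arms T x" for D using time_step[OF BA[OF x that]] by (simp add: mod_Suc_eq)
    have "cyc (real (time (f x) (local_arm_image T f x A) mod len x))
       (real (time (f x) (local_arm_image T f x B) mod len x)) (real (time (f x) (local_arm_image T f x C) mod len x))"
      by (rule cyc_mod_pred[OF c' _ _ _ _ _ _ s[OF ABC(1)] s[OF ABC(2)] s[OF ABC(3)]]) (use l in simp_all)
    moreover have "k (f x) = k x" by (simp add: k_def len_f)
    ultimately show ?thesis
      using f_branch[OF x] cyc_scale[OF kx] by (simp add: \<theta>_def len_f)
  qed
  show ?thesis by (rule exI[of _ \<theta>]) (use 1 2 3 in blast)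
qed

theorem tame_imp_planar: "planar_dynamics T f"
proof (rule graphE)
  fix Vs Es
  assume VE: "finite Vs" "finite Es" "T = Vs \<union> \<Union>Es"
    "\<And>e. e \<in> Es \<Longrightarrow> \<exists>a b. is_arc e a b \<and> e \<inter> Vs = {a, b}"
    "\<And>e e'. \<lbrakk>e \<in> Es; e' \<in> Es; e \<noteq> e'\<rbrakk> \<Longrightarrow> e \<inter> e' \<subseteq> Vs"
  interpret G: graph_tree T Vs Es by unfold_locales (use VE in blast)+
  obtain \<theta> :: "'a \<Rightarrow> 'a set \<Rightarrow> real" where \<theta>0: "\<forall>x. inj_on (\<theta> x) (arms T x)"
    "\<forall>x. \<forall>A\<in>arms T x. 0 \<le> \<theta> x A \<and> \<theta> x A < 2 * pi"
    "\<forall>x\<in>branch_points T. \<forall>A\<in>arms T x. \<forall>B\<in>arms T x. \<forall>C\<in>arms T x. cyc (\<theta> x A) (\<theta> x B) (\<theta> x C) \<longrightarrow>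
      cyc (\<theta> (f x) (local_arm_image T f x A)) (\<theta> (f x) (local_arm_image T f x B)) (\<theta> (f x) (local_arm_image T f x C))"
    using angles_exist by (elim exE conjE)
  have \<theta>: "\<And>x. inj_on (\<theta> x) (arms T x)"
    "\<And>x A. A \<in> arms T x \<Longrightarrow> 0 \<le> \<theta> x A \<and> \<theta> x A < 2 * pi"
    "\<And>x A B C. \<lbrakk>x \<in> branch_points T; A \<in> arms T x; B \<in> arms T x; C \<in> arms T x; cyc (\<theta> x A) (\<theta> x B) (\<theta> x C)\<rbrakk> \<Longrightarrow>
      cyc (\<theta> (f x) (local_arm_image T f x A)) (\<theta> (f x) (local_arm_image T f x B)) (\<theta> (f x) (local_arm_image T f x C))"
    using \<theta>0 by blast+
  have emb: "\<exists>(h :: 'a \<Rightarrow> complex) \<beta>. continuous_on T h \<and> inj_on h T \<and>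
    (\<forall>v\<in>Vs. \<forall>A\<in>arms T v. \<forall>\<^sub>F r in at_right 0.
       \<exists>y. first_exit T h r v A y \<and> h y = h v + of_real r * cis (\<beta> v + \<theta> v A))"
    by (rule G.planar_embedding) (use \<theta> in auto)
  obtain h :: "'a \<Rightarrow> complex" and \<beta> where h: "continuous_on T h" "inj_on h T"
    and ex: "\<forall>v\<in>Vs. \<forall>A\<in>arms T v. \<forall>\<^sub>F r in at_right 0.
      \<exists>y. first_exit T h r v A y \<and> h y = h v + of_real r * cis (\<beta> v + \<theta> v A)"
    using emb by (elim exE conjE)
  have bV: "branch_points T \<subseteq> Vs" using branch_points_vertices[OF VE] .
  have "\<forall>\<^sub>F r in at_right 0. \<forall>x\<in>branch_points T. \<forall>A\<in>arms T x.
      \<exists>y. first_exit T h r x A y \<and> h y = h x + of_real r * cis (\<beta> x + \<theta> x A)"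
    using ex bV by (intro eventually_ball_finite finite_branch_points ballI finite_arms) blast
  moreover have "\<forall>\<^sub>F r in at_right 0. \<forall>x\<in>branch_points T. small_radius h x r"
    using small_radius[OF h] branch_T by (intro eventually_ball_finite finite_branch_points) blast
  ultimately have "respects_cyclic_order T f h"
    unfolding respects_cyclic_order_def
  proof eventually_elim
    case (elim r)
    show ?case
    proof (intro ballI impI)
      fix x A B C
      assume x: "x \<in> branch_points T" and ABC: "A \<in> arms T x" "B \<in> arms T x" "C \<in> arms T x"
        and ccw: "ccw_arms T h r x A B C"
      have r0: "r > 0" and sm: "\<And>b. \<lbrakk>b \<in> branch_points T; b \<noteq> x\<rbrakk> \<Longrightarrow> r < dist (h b) (h x)"
        using elim(2) x by (auto simp: small_radius_def)
      have angle: "h y = h x + of_real r * cis (\<beta> x + \<theta> x D)" if D: "D \<in> arms T x" and y: "first_exit T h r x D y" for D y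
      proof -
        obtain y' where y': "first_exit T h r x D y'" "h y' = h x + of_real r * cis (\<beta> x + \<theta> x D)"
          using elim(1) x D by blast
        have "y = y'" using first_exit_unique[OF branch_T[OF x] D sm y y'(1)] .
        then show ?thesis using y'(2) by simp
      qed
      obtain a b c s t u where e: "first_exit T h r x A a" "first_exit T h r x B b" "first_exit T h r x C c"
        and p: "h a = h x + of_real r * cis s" "h b = h x + of_real r * cis t" "h c = h x + of_real r * cis u"
        and o: "s < t" "t < u" "u < s + 2 * pi"
        using ccw unfolding ccw_arms_def by blast
      have "cis s = cis (\<beta> x + \<theta> x A)" "cis t = cis (\<beta> x + \<theta> x B)" "cis u = cis (\<beta> x + \<theta> x C)"
        using p angle[OF ABC(1) e(1)] angle[OF ABC(2) e(2)] angle[OF ABC(3) e(3)] r0 by auto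
      then have "cyc (\<theta> x A) (\<theta> x B) (\<theta> x C)" using ccw_imp_cyc[OF o] \<theta>(2) ABC by blast
      define A' B' C' where d: "A' = local_arm_image T f x A" "B' = local_arm_image T f x B" "C' = local_arm_image T f x C"
      have c': "cyc (\<theta> (f x) A') (\<theta> (f x) B') (\<theta> (f x) C')"
        unfolding d by (rule \<theta>(3)[OF x ABC]) fact
      have ABC': "A' \<in> arms T (f x)" "B' \<in> arms T (f x)" "C' \<in> arms T (f x)"
        unfolding d using local_arm_image_arms[OF branch_T[OF x]] ABC by auto
      obtain s t u where o: "s < t" "t < u" "u < s + 2 * pi"
        "cis s = cis (\<beta> (f x) + \<theta> (f x) A')" "cis t = cis (\<beta> (f x) + \<theta> (f x) B')" "cis u = cis (\<beta> (f x) + \<theta> (f x) C')"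
        using cyc_imp_ccw[OF c'] \<theta>(2) ABC' by metis
      have "\<exists>y. first_exit T h r (f x) D y \<and> h y = h (f x) + of_real r * cis (\<beta> (f x) + \<theta> (f x) D)"
        if "D \<in> arms T (f x)" for D using elim(1) f_branch[OF x] that by blast
      then show "ccw_arms T h r (f x) A' B' C'"
        using ABC' o unfolding ccw_arms_def by metis
    qed
  qed
  moreover have "\<exists>h'. homeomorphism T (h ` T) h h'" using homeomorphism_compact[OF compact_T h(1) refl h(2)] .
  ultimately show ?thesis unfolding planar_dynamics_def by blast
qed

end

end

theorem theorem4p2:
  fixes T :: "'a::t2_space set" and f :: "'a \<Rightarrow> 'a" and c :: 'a
  assumes "hubbard_tree T f c"
  shows "(\<forall>m\<ge>1. has_evil_orbit T f m \<longleftrightarrow> fails_admissibility (kneading T f c) m) \<and>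
         (planar_dynamics T f \<longleftrightarrow> (\<forall>m\<ge>1. \<not> fails_admissibility (kneading T f c) m))"
proof -
  interpret hubbard T f c
    by unfold_locales (use assms in \<open>auto simp: hubbard_tree_def\<close>)
  have "m \<ge> 1" if "has_evil_orbit T f m" for m
    using that by (auto simp: has_evil_orbit_def branch_orbit_def periodic_orbit_def)
  then have "planar_dynamics T f \<longleftrightarrow> (\<forall>m\<ge>1. \<not> has_evil_orbit T f m)"
    using planar_no_evil tame_imp_planar by blast
  then show ?thesis using has_evil_iff_fails by blast
qed

end
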